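(* Let $T\in(0,\infty)$, and let $(Y^0,Y^1)=(Y^0_t,Y^1_t)_{0\le t\le T}$ be the unique pair of processes in $\mathcal{S}^2_T\cap\mathcal{Q}_T$ such that, for $i\in\{0,1\}$ and $0\le t\le T$, $\mathsf{P}$-a.s., $$Y^i_t=\operatorname*{ess\,sup}_{\theta\in\mathcal{T}_{t,T}}\mathsf{E}\Big[\int_t^\theta\psi_i(s)\,ds+\Gamma_i\mathbf{1}_{\{\theta=T\}}+\big\{Y^{1-i}_\theta-\gamma_{i,1-i}(\theta)\big\}\mathbf{1}_{\{\theta<T\}}\,\Big|\,\mathcal{F}_t\Big],\qquad Y^i_T=\Gamma_i,$$ where $\psi_1=\psi$, $\psi_0=0$, $\Gamma_1=\Gamma$, $\Gamma_0=0$, $\gamma_{0,1}=\gamma_-$, $\gamma_{1,0}=\gamma_+$. For $t\in[0,T]$ define the stopping times $$\sigma^*_t=\inf\{s\ge t: Y^0_s=Y^1_s-\gamma_-(s)\}\wedge T,\qquad \tau^*_t=\inf\{s\ge t: Y^1_s=Y^0_s-\gamma_+(s)\}\wedge T.$$ Then for every $t\in[0,T]$, $$Y^1_t-Y^0_t=D_{t,T}(\sigma^*_t,\tau^*_t)\quad\mathsf{P}\text{-a.s.}$$ Furthermore, for any $\sigma,\tau\in\mathcal{T}_{t,T}$, $$D_{t,T}(\sigma^*_t,\tau)\le D_{t,T}(\sigma^*_t,\tau^*_t)\le D_{t,T}(\sigma,\tau^*_t).$$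
   Context: Setting. $(\Omega,\mathcal{F},\mathsf{P})$ is a complete probability space with a filtration $\mathbb{F}=(\mathcal{F}_t)_{t\ge0}$ satisfying the usual conditions of right-continuity and completeness, with $\mathcal{F}=\bigvee_t\mathcal{F}_t$; $\mathbb{F}$ is assumed quasi-left-continuous (i.e. $\mathcal{F}_{\tau}=\mathcal{F}_{\tau-}$ for every predictable time $\tau$). $T\in(0,\infty)$ is fixed and $\mathbb{F}_T=(\mathcal{F}_t)_{0\le t\le T}$. $\mathcal{T}_{t,T}$ is the set of $\mathbb{F}_T$-stopping times $\nu$ with $t\le\nu\le T$ $\mathsf{P}$-a.s. $x\wedge y=\min(x,y)$. (In)equalities between conditional expectations are understood $\mathsf{P}$-a.s. Spaces. $L^2$: random variables $Z$ with $\mathsf{E}[|Z|^2]<\infty$. $\mathcal{M}^2_T$: real-valued $\mathbb{F}_T$-progressively measurable processes $X$ with $\mathsf{E}[\int_0^T|X_t|^2dt]<\infty$. $\mathcal{S}^2_T$: $\mathbb{F}_T$-progressively measurable processes $X$ with $\mathsf{E}[(\sup_{0\le t\le T}|X_t|)^2]<\infty$. $\mathcal{Q}_T$: $\mathbb{F}_T$-adapted càdlàg processes on $[0,T]$ which are quasi-left-continuous (left-continuous over stopping times: if $\tau_n\uparrow\tau$ are stopping times then $X_{\tau_n}\to X_\tau$ a.s.). Standing assumptions. $\psi\in\mathcal{M}^2_T$; $\gamma_-,\gamma_+\in\mathcal{S}^2_T\cap\mathcal{Q}_T$; $\Gamma\in L^2$ is $\mathcal{F}_T$-measurable; $-\gamma_+(T)\le\Gamma\le\gamma_-(T)$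 $\mathsf{P}$-a.s.; and for all $t\in[0,T]$, $\gamma_-(t)+\gamma_+(t)>0$ $\mathsf{P}$-a.s. Under these assumptions the existence and uniqueness (up to indistinguishability) of the pair $(Y^0,Y^1)$ is a known result and may be taken as given. Dynkin game payoff. For $\sigma,\tau\in\mathcal{T}_{t,T}$, $$D_{t,T}(\sigma,\tau)=\mathsf{E}\Big[\int_t^{\sigma\wedge\tau}\psi(s)\,ds+\gamma_-(\sigma)\mathbf{1}_{\{\sigma\le\tau\}}\mathbf{1}_{\{\sigma<T\}}-\gamma_+(\tau)\mathbf{1}_{\{\tau<\sigma\}}+\Gamma\,\mathbf{1}_{\{\sigma=\tau=T\}}\,\Big|\,\mathcal{F}_t\Big].$$ *)

theory Defs
  imports "HOL-Probability.Probability"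
begin

section \<open>Filtered probability spaces\<close>

text \<open>
  The time set is \<open>[0, \<infinity>]\<close>, represented by \<^typ>\<open>ennreal\<close>, so that stopping times may take the
  value \<open>\<infinity>\<close> and the library notions \<^const>\<open>stopping_time\<close> and \<^const>\<open>filtration.pre_sigma\<close>
  apply; the added \<open>F \<infinity>\<close> is the whole sigma-algebra. The measures carried by the \<open>F t\<close> are
  irrelevant, only their sigma-algebras are used.
\<close>

locale usual_filtered_prob_space =
  prob_space M + complete_measure M + filtration "space M" F
  for M :: "'a measure" and F :: "ennreal \<Rightarrow> 'a measure" +
  assumes sets_F_infinity: "sets (F \<infinity>) = sets M"
    and generated: "sets M = sigma_sets (space M) (\<Union>t\<in>{..<\<infinity>}. sets (F t))"
    and right_continuous: "\<And>t. t < \<infinity> \<Longrightarrow> sets (F t) = (\<Inter>s\<in>{t<..}. sets (F s))"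
    and null_sets_F0: "null_sets M \<subseteq> sets (F 0)"
begin

text \<open>
  Predictable times are those announced by a sequence of stopping times; by completeness of the
  filtration it does not matter whether this is required almost surely or everywhere.
\<close>

definition predictable_time :: "('a \<Rightarrow> ennreal) \<Rightarrow> bool" where
  "predictable_time \<tau> \<longleftrightarrow> stopping_time F \<tau> \<and>
     (\<exists>\<tau>n :: nat \<Rightarrow> 'a \<Rightarrow> ennreal. (\<forall>n. stopping_time F (\<tau>n n)) \<and>
        (AE \<omega> in M. incseq (\<lambda>n. \<tau>n n \<omega>) \<and> (\<lambda>n. \<tau>n n \<omega>) \<longlonglongrightarrow> \<tau> \<omega> \<and>
                    (0 < \<tau> \<omega> \<longrightarrow> (\<forall>n. \<tau>n n \<omega> < \<tau> \<omega>))))"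

definition strict_pre_sigma :: "('a \<Rightarrow> ennreal) \<Rightarrow> 'a measure" where
  "strict_pre_sigma \<tau> =
     sigma (space M) (sets (F 0) \<union> {A \<inter> {\<omega> \<in> space M. t < \<tau> \<omega>} | A t. A \<in> sets (F t)})"

end

locale quasi_left_continuous_filtration = usual_filtered_prob_space +
  assumes quasi_left_continuous:
    "\<And>\<tau>. predictable_time \<tau> \<Longrightarrow> sets (pre_sigma \<tau>) = sets (strict_pre_sigma \<tau>)"


section \<open>Stopping times and spaces of processes on \<open>[0, T]\<close>\<close>

text \<open>
  Processes have type \<^typ>\<open>real \<Rightarrow> 'a \<Rightarrow> real\<close>; only their values at times in \<open>[0, T]\<close> matter.
  A random time with \<open>\<nu> \<le> T\<close> almost surely is a stopping time of the filtration restricted to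
  \<open>[0, T]\<close> iff it is a stopping time of \<open>F\<close>, since \<open>{\<nu> \<le> s}\<close> has full measure for \<open>s \<ge> T\<close>.
\<close>

definition stopping_times ::
  "'a measure \<Rightarrow> (ennreal \<Rightarrow> 'a measure) \<Rightarrow> real \<Rightarrow> real \<Rightarrow> ('a \<Rightarrow> real) set" where
  "stopping_times M F t T =
     {\<nu>. stopping_time F (\<lambda>\<omega>. ennreal (\<nu> \<omega>)) \<and> (AE \<omega> in M. t \<le> \<nu> \<omega> \<and> \<nu> \<omega> \<le> T)}"

definition adapted :: "(ennreal \<Rightarrow> 'a measure) \<Rightarrow> real \<Rightarrow> (real \<Rightarrow> 'a \<Rightarrow> real) \<Rightarrow> bool" where
  "adapted F T X \<longleftrightarrow> (\<forall>t\<in>{0..T}. X t \<in> borel_measurable (F (ennreal t)))"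

definition progressively_measurable ::
  "(ennreal \<Rightarrow> 'a measure) \<Rightarrow> real \<Rightarrow> (real \<Rightarrow> 'a \<Rightarrow> real) \<Rightarrow> bool" where
  "progressively_measurable F T X \<longleftrightarrow>
     (\<forall>t\<in>{0..T}. (\<lambda>(s, \<omega>). X s \<omega>) \<in>
        borel_measurable (restrict_space borel {0..t} \<Otimes>\<^sub>M F (ennreal t)))"

definition M2_space ::
  "'a measure \<Rightarrow> (ennreal \<Rightarrow> 'a measure) \<Rightarrow> real \<Rightarrow> (real \<Rightarrow> 'a \<Rightarrow> real) set" where
  "M2_space M F T =
     {X. progressively_measurable F T X \<and>
         (\<integral>\<^sup>+\<omega>. (\<integral>\<^sup>+t\<in>{0..T}. ennreal (\<bar>X t \<omega>\<bar>\<^sup>2) \<partial>lborel) \<partial>M) < \<infinity>}"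

definition S2_space ::
  "'a measure \<Rightarrow> (ennreal \<Rightarrow> 'a measure) \<Rightarrow> real \<Rightarrow> (real \<Rightarrow> 'a \<Rightarrow> real) set" where
  "S2_space M F T =
     {X. progressively_measurable F T X \<and>
         (\<integral>\<^sup>+\<omega>. (SUP t\<in>{0..T}. ennreal \<bar>X t \<omega>\<bar>)\<^sup>2 \<partial>M) < \<infinity>}"

definition cadlag_on :: "real \<Rightarrow> (real \<Rightarrow> real) \<Rightarrow> bool" where
  "cadlag_on T x \<longleftrightarrow>
     (\<forall>t\<in>{0..<T}. (x \<longlongrightarrow> x t) (at_right t)) \<and> (\<forall>t\<in>{0<..T}. \<exists>l. (x \<longlongrightarrow> l) (at_left t))"

definition quasi_left_continuous_process ::
  "'a measure \<Rightarrow> (ennreal \<Rightarrow> 'a measure) \<Rightarrow> real \<Rightarrow> (real \<Rightarrow> 'a \<Rightarrow> real) \<Rightarrow> bool" where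
  "quasi_left_continuous_process M F T X \<longleftrightarrow>
     (\<forall>(\<tau>n :: nat \<Rightarrow> 'a \<Rightarrow> real) \<tau>.
        (\<forall>n. \<tau>n n \<in> stopping_times M F 0 T) \<longrightarrow> \<tau> \<in> stopping_times M F 0 T \<longrightarrow>
        (AE \<omega> in M. incseq (\<lambda>n. \<tau>n n \<omega>) \<and> (\<lambda>n. \<tau>n n \<omega>) \<longlonglongrightarrow> \<tau> \<omega>) \<longrightarrow>
        (AE \<omega> in M. (\<lambda>n. X (\<tau>n n \<omega>) \<omega>) \<longlonglongrightarrow> X (\<tau> \<omega>) \<omega>))"

definition Q_space ::
  "'a measure \<Rightarrow> (ennreal \<Rightarrow> 'a measure) \<Rightarrow> real \<Rightarrow> (real \<Rightarrow> 'a \<Rightarrow> real) set" where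
  "Q_space M F T =
     {X. adapted F T X \<and> (AE \<omega> in M. cadlag_on T (\<lambda>t. X t \<omega>)) \<and>
         quasi_left_continuous_process M F T X}"


section \<open>Essential supremum of a family of random variables\<close>

text \<open>
  \<open>Z\<close> is (a version of) the essential supremum of \<open>(f i)\<close>, \<open>i \<in> I\<close>: the almost surely least
  random variable dominating every member of the family almost surely. The library's
  \<^const>\<open>esssup\<close> is the essential supremum of a single function, a number.
\<close>

definition is_ess_sup ::
  "'a measure \<Rightarrow> 'i set \<Rightarrow> ('i \<Rightarrow> 'a \<Rightarrow> real) \<Rightarrow> ('a \<Rightarrow> real) \<Rightarrow> bool" where
  "is_ess_sup M I f Z \<longleftrightarrow>
     Z \<in> borel_measurable M \<and> (\<forall>i\<in>I. AE \<omega> in M. f i \<omega> \<le> Z \<omega>) \<and>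
     (\<forall>Z'\<in>borel_measurable M.
        (\<forall>i\<in>I. AE \<omega> in M. f i \<omega> \<le> Z' \<omega>) \<longrightarrow> (AE \<omega> in M. Z \<omega> \<le> Z' \<omega>))"


section \<open>The switching system and the Dynkin game\<close>

definition switching_payoff ::
  "'a measure \<Rightarrow> (ennreal \<Rightarrow> 'a measure) \<Rightarrow> real \<Rightarrow> (real \<Rightarrow> 'a \<Rightarrow> real) \<Rightarrow>
   (real \<Rightarrow> 'a \<Rightarrow> real) \<Rightarrow> ('a \<Rightarrow> real) \<Rightarrow> (real \<Rightarrow> 'a \<Rightarrow> real) \<Rightarrow> real \<Rightarrow> ('a \<Rightarrow> real) \<Rightarrow>
   'a \<Rightarrow> real" where
  "switching_payoff M F T \<psi> \<gamma> \<Gamma> Y t \<theta> =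
     real_cond_exp M (F (ennreal t)) (\<lambda>\<omega>.
       (LBINT s:{t..\<theta> \<omega>}. \<psi> s \<omega>) + \<Gamma> \<omega> * of_bool (\<theta> \<omega> = T) +
       (Y (\<theta> \<omega>) \<omega> - \<gamma> (\<theta> \<omega>) \<omega>) * of_bool (\<theta> \<omega> < T))"

text \<open>
  The system satisfied by \<open>Y i\<close>, \<open>i \<in> {0, 1}\<close>, where \<open>\<psi>\<^sub>1 = \<psi>\<close>, \<open>\<psi>\<^sub>0 = 0\<close>, \<open>\<Gamma>\<^sub>1 = \<Gamma>\<close>, \<open>\<Gamma>\<^sub>0 = 0\<close>,
  and the cost of switching is \<open>\<gamma>m\<close> from mode 0 to 1 and \<open>\<gamma>p\<close> from mode 1 to 0.
\<close>

definition switching_system ::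
  "'a measure \<Rightarrow> (ennreal \<Rightarrow> 'a measure) \<Rightarrow> real \<Rightarrow> (real \<Rightarrow> 'a \<Rightarrow> real) \<Rightarrow>
   (real \<Rightarrow> 'a \<Rightarrow> real) \<Rightarrow> (real \<Rightarrow> 'a \<Rightarrow> real) \<Rightarrow> ('a \<Rightarrow> real) \<Rightarrow>
   (nat \<Rightarrow> real \<Rightarrow> 'a \<Rightarrow> real) \<Rightarrow> bool" where
  "switching_system M F T \<psi> \<gamma>m \<gamma>p \<Gamma> Y \<longleftrightarrow>
     (let \<psi>i = (\<lambda>i. if i = 1 then \<psi> else (\<lambda>s \<omega>. 0));
          \<Gamma>i = (\<lambda>i. if i = 1 then \<Gamma> else (\<lambda>\<omega>. 0));
          \<gamma>i = (\<lambda>i. if i = 1 then \<gamma>p else \<gamma>m)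
      in \<forall>i\<in>{0, 1}. Y i \<in> S2_space M F T \<inter> Q_space M F T \<and>
           (\<forall>t\<in>{0..T}. is_ess_sup M (stopping_times M F t T)
              (switching_payoff M F T (\<psi>i i) (\<gamma>i i) (\<Gamma>i i) (Y (1 - i)) t) (Y i t)) \<and>
           (AE \<omega> in M. Y i T \<omega> = \<Gamma>i i \<omega>))"

definition dynkin_payoff ::
  "'a measure \<Rightarrow> (ennreal \<Rightarrow> 'a measure) \<Rightarrow> real \<Rightarrow> (real \<Rightarrow> 'a \<Rightarrow> real) \<Rightarrow>
   (real \<Rightarrow> 'a \<Rightarrow> real) \<Rightarrow> (real \<Rightarrow> 'a \<Rightarrow> real) \<Rightarrow> ('a \<Rightarrow> real) \<Rightarrow> real \<Rightarrow>
   ('a \<Rightarrow> real) \<Rightarrow> ('a \<Rightarrow> real) \<Rightarrow> 'a \<Rightarrow> real" where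
  "dynkin_payoff M F T \<psi> \<gamma>m \<gamma>p \<Gamma> t \<sigma> \<tau> =
     real_cond_exp M (F (ennreal t)) (\<lambda>\<omega>.
       (LBINT s:{t..min (\<sigma> \<omega>) (\<tau> \<omega>)}. \<psi> s \<omega>)
       + \<gamma>m (\<sigma> \<omega>) \<omega> * of_bool (\<sigma> \<omega> \<le> \<tau> \<omega>) * of_bool (\<sigma> \<omega> < T)
       - \<gamma>p (\<tau> \<omega>) \<omega> * of_bool (\<tau> \<omega> < \<sigma> \<omega>)
       + \<Gamma> \<omega> * of_bool (\<sigma> \<omega> = T \<and> \<tau> \<omega> = T))"

text \<open>
  \<open>inf {s \<ge> t. U s = V s} \<and> T\<close> for processes on \<open>[0, T]\<close>; inserting \<open>T\<close> into the set
  implements both the minimum with \<open>T\<close> and the convention \<open>inf \<emptyset> = \<infinity>\<close>.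
\<close>

definition first_contact_time ::
  "real \<Rightarrow> (real \<Rightarrow> 'a \<Rightarrow> real) \<Rightarrow> (real \<Rightarrow> 'a \<Rightarrow> real) \<Rightarrow> real \<Rightarrow> 'a \<Rightarrow> real" where
  "first_contact_time T U V t \<omega> = Inf (insert T {s \<in> {t..T}. U s \<omega> = V s \<omega>})"

end

theory Submission
  imports Defs
begin

text \<open>
  Adding the running reward \<open>\<integral>\<^sub>0\<^sup>s \<psi>\<^sub>i\<close> to \<open>Y\<^sup>i\<close> gives the Snell envelope of the obstacle
  \<open>Y\<^sup>1\<^sup>-\<^sup>i - \<gamma>\<^sub>i\<close> (plus the same reward). Such an envelope \<open>Z\<close> is a supermartingale, and it is a
  martingale up to the first contact with its obstacle \<open>H\<close>: if \<open>\<theta>\<^sub>n\<close> are asymptotically optimal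
  stopping times, then \<open>Z - H\<close> at time \<open>\<theta>\<^sub>n\<close> tends to \<open>0\<close> in \<open>L\<^sup>1\<close>, so along a subsequence the
  \<open>\<theta>\<^sub>n\<close> eventually lie beyond the first time \<open>D\<^sub>k\<close> at which \<open>Z - H < 1/k\<close>; hence \<open>Z\<close> has the same
  expectation at \<open>t\<close> and at \<open>D\<^sub>k\<close>. Quasi-left-continuity lets \<open>k \<rightarrow> \<infinity>\<close> and identifies
  \<open>lim D\<^sub>k\<close> with the contact time. This also shows that the contact time is a stopping time
  without recourse to the debut theorem.

  Between \<open>t\<close> and \<open>\<sigma>\<^sup>* \<and> \<tau>\<close> the process \<open>Y\<^sup>0\<close> is thus a martingale and \<open>Y\<^sup>1 + \<integral> \<psi>\<close> a
  supermartingale, so the difference bounds the payoff of \<open>(\<sigma>\<^sup>*, \<tau>)\<close> from above; symmetrically for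
  \<open>(\<sigma>, \<tau>\<^sup>*)\<close>.
\<close>

section \<open>Stopping times and regular processes\<close>

text \<open>The essential supremum is known only through its universal property, one fixed time at a
  time, so neither an optimal stopping time nor a dynamic programming identity is available at the
  outset. The substitute is a statement about expectations: pasting two stopping times along an
  event of \<open>F t\<close> makes the conditional payoffs upward directed, hence the expectation
  of \<open>Z t\<close> is the supremum of the expected payoffs. From there on integrals over events
  of \<open>F t\<close> carry the argument, and the martingale property comes out of a nonnegative
  random variable whose integral is not positive.

  Near-optimal times need not be ordered, so quasi-left-continuity cannot be applied to them
  directly. The times \<open>D t k\<close> increase in \<open>k\<close>, which is what makes the
  passage to the limit possible.

  At \<open>T\<close> the payoff is \<open>Z T\<close>, whatever the obstacle is there. Hence
  \<open>Z\<close> is compared with \<open>H\<close> only before \<open>T\<close>, and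
  \<open>T\<close> is a separate case in every pathwise argument.

  Times bounded everywhere and countable sets of rational times keep the measurability questions
  elementary; null sets enter again only when contact times and arbitrary members of
  \<open>stopping_times\<close> are treated.\<close>

locale horizon = usual_filtered_prob_space M F
  for M :: "'a measure" and F :: "ennreal \<Rightarrow> 'a measure" +
  fixes T :: real
  assumes T_pos: "0 < T"
begin

abbreviation ce :: "real \<Rightarrow> ('a \<Rightarrow> real) \<Rightarrow> 'a \<Rightarrow> real" where
  "ce t \<equiv> real_cond_exp M (F (ennreal t))"

section \<open>Sub-sigma-algebras and null sets\<close>

lemma sets_F_subset: "sets (F u) \<subseteq> sets M"
  using sets_F_mono[of u \<infinity>] sets_F_infinity by simp

lemma subalgebra_F: "subalgebra M (F u)"
  using sets_F_subset by (auto simp: subalgebra_def space_F)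

lemma sigma_finite_subalgebra_F: "sigma_finite_subalgebra M (F u)"
  by (intro finite_measure_subalgebra_is_sigma_finite) (unfold_locales, rule subalgebra_F)

lemma measurable_F_imp_M: "f \<in> borel_measurable (F u) \<Longrightarrow> f \<in> borel_measurable M"
  by (rule measurable_from_subalg[OF subalgebra_F])

text \<open>The preimages of an open set under the two functions differ by a null set, and
  completeness of \<open>M\<close> makes such a modification measurable.\<close>

lemma borel_measurable_AE_eq:
  fixes f g :: "'a \<Rightarrow> 'b::topological_space"
  assumes g: "g \<in> borel_measurable M" and ae: "AE \<omega> in M. f \<omega> = g \<omega>"
  shows "f \<in> borel_measurable M"
proof (rule borel_measurableI)
  fix S :: "'b set" assume "open S"
  then have "g -` S \<inter> space M \<in> sets M" using g by (auto intro: measurable_sets)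
  then show "f -` S \<inter> space M \<in> sets M"
    using ae by (auto intro!: in_sets_AE[where A="g -` S \<inter> space M"])
qed

text \<open>Both differences are null sets, so they lie in \<open>F 0\<close> and hence in
  \<open>F u\<close>. This is why a random time that agrees almost surely with a stopping time, such
  as a contact time, is itself a stopping time.\<close>

lemma sets_F_AE_eq:
  assumes ae: "AE \<omega> in M. \<omega> \<in> A \<longleftrightarrow> \<omega> \<in> B" and A: "A \<in> sets (F u)" and B: "B \<subseteq> space M"
  shows "B \<in> sets (F u)"
proof -
  have AM: "A \<in> sets M" using A sets_F_subset by blast
  then have As: "A \<subseteq> space M" by (rule sets.sets_into_space)
  have "AE \<omega> in M. \<omega> \<notin> A - B" "AE \<omega> in M. \<omega> \<notin> B - A" using ae by auto
  then have "A - B \<in> null_sets M" "B - A \<in> null_sets M"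
    using As B by (auto simp: null_sets_iff_AE)
  then have "A - B \<in> sets (F u)" "B - A \<in> sets (F u)"
    using null_sets_F0 sets_F_mono[of 0 u] by auto
  then have "(A - (A - B)) \<union> (B - A) \<in> sets (F u)" using A by auto
  moreover have "(A - (A - B)) \<union> (B - A) = B" by auto
  ultimately show ?thesis by simp
qed

text \<open>In contrast to the members of \<^const>\<open>stopping_times\<close>, the bounds hold everywhere; up to null
  sets this is no restriction.\<close>

definition stime :: "real \<Rightarrow> ('a \<Rightarrow> real) \<Rightarrow> bool" where
  "stime t \<theta> \<longleftrightarrow> (\<forall>\<omega>\<in>space M. t \<le> \<theta> \<omega> \<and> \<theta> \<omega> \<le> T) \<and>
     (\<forall>s\<in>{t..T}. {\<omega>\<in>space M. \<theta> \<omega> \<le> s} \<in> sets (F (ennreal s)))"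

lemma stime_range: "stime t \<theta> \<Longrightarrow> \<omega> \<in> space M \<Longrightarrow> t \<le> \<theta> \<omega> \<and> \<theta> \<omega> \<le> T"
  by (simp add: stime_def)

lemma stime_le_sets:
  assumes "stime t \<theta>" "0 \<le> s"
  shows "{\<omega>\<in>space M. \<theta> \<omega> \<le> s} \<in> sets (F (ennreal s))"
proof -
  consider "s < t" | "s \<in> {t..T}" | "s > T" by fastforce
  then show ?thesis
  proof cases
    case 1 then have "{\<omega>\<in>space M. \<theta> \<omega> \<le> s} = {}" using assms by (fastforce simp: stime_def)
    then show ?thesis by (metis sets.empty_sets)
  next
    case 2 then show ?thesis using assms by (auto simp: stime_def)
  next
    case 3 then have "{\<omega>\<in>space M. \<theta> \<omega> \<le> s} = space (F (ennreal s))"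
      using assms by (fastforce simp: stime_def space_F)
    then show ?thesis by (metis sets.top)
  qed
qed

lemma stimeI:
  assumes "\<And>\<omega>. \<omega> \<in> space M \<Longrightarrow> t \<le> \<theta> \<omega> \<and> \<theta> \<omega> \<le> T"
    and "\<And>s. t \<le> s \<Longrightarrow> s < T \<Longrightarrow> {\<omega>\<in>space M. \<theta> \<omega> \<le> s} \<in> sets (F (ennreal s))"
  shows "stime t \<theta>"
  unfolding stime_def
proof (intro conjI ballI)
  fix s assume s: "s \<in> {t..T}"
  show "{\<omega>\<in>space M. \<theta> \<omega> \<le> s} \<in> sets (F (ennreal s))"
  proof (cases "s < T")
    case False
    then have "{\<omega>\<in>space M. \<theta> \<omega> \<le> s} = space (F (ennreal s))"
      using assms(1) s by (fastforce simp: space_F)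
    then show ?thesis by (metis sets.top)
  qed (use assms(2) s in auto)
qed (use assms(1) in auto)

lemma stime_measurable:
  assumes "stime t \<theta>" shows "\<theta> \<in> borel_measurable M"
proof (rule borel_measurableI_le)
  fix s
  show "{\<omega> \<in> space M. \<theta> \<omega> \<le> s} \<in> sets M"
  proof (cases "s < t")
    case True
    then have "{\<omega> \<in> space M. \<theta> \<omega> \<le> s} = {}" using assms by (fastforce simp: stime_def)
    then show ?thesis by (metis sets.empty_sets)
  next
    case ge: False
    show ?thesis
    proof (cases "s \<le> T")
      case True
      then have "{\<omega>\<in>space M. \<theta> \<omega> \<le> s} \<in> sets (F (ennreal s))"
        using assms ge by (simp add: stime_def)
      then show ?thesis using sets_F_subset by blast
    next
      case False
      then have "{\<omega>\<in>space M. \<theta> \<omega> \<le> s} = space M" using assms by (fastforce simp: stime_def)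
      then show ?thesis by (metis sets.top)
    qed
  qed
qed

lemma stime_const:
  assumes "t \<le> s" "s \<le> T" shows "stime t (\<lambda>_. s)"
proof (rule stimeI)
  fix r :: real
  have "{\<omega>\<in>space M. s \<le> r} = (if s \<le> r then space (F (ennreal r)) else {})" by (auto simp: space_F)
  then show "{\<omega>\<in>space M. s \<le> r} \<in> sets (F (ennreal r))" by auto
qed (use assms in simp)

lemma stime_mono:
  assumes "stime t \<theta>" "0 \<le> s" "s \<le> t" shows "stime s \<theta>"
proof (rule stimeI)
  show "s \<le> \<theta> \<omega> \<and> \<theta> \<omega> \<le> T" if "\<omega> \<in> space M" for \<omega>
    using stime_range[OF assms(1) that] assms(3) by simp
  show "{\<omega>\<in>space M. \<theta> \<omega> \<le> r} \<in> sets (F (ennreal r))" if "s \<le> r" for r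
    using stime_le_sets[OF assms(1)] assms(2) that by simp
qed

lemma stime_min:
  assumes "stime t \<theta>" "stime t \<theta>'" "0 \<le> t" shows "stime t (\<lambda>\<omega>. min (\<theta> \<omega>) (\<theta>' \<omega>))"
proof (rule stimeI)
  fix s assume s: "t \<le> s"
  have "{\<omega>\<in>space M. min (\<theta> \<omega>) (\<theta>' \<omega>) \<le> s} =
      {\<omega>\<in>space M. \<theta> \<omega> \<le> s} \<union> {\<omega>\<in>space M. \<theta>' \<omega> \<le> s}" by auto
  then show "{\<omega>\<in>space M. min (\<theta> \<omega>) (\<theta>' \<omega>) \<le> s} \<in> sets (F (ennreal s))"
    using stime_le_sets assms s by auto
next
  show "t \<le> min (\<theta> \<omega>) (\<theta>' \<omega>) \<and> min (\<theta> \<omega>) (\<theta>' \<omega>) \<le> T" if "\<omega> \<in> space M" for \<omega>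
    using stime_range[OF assms(1) that] stime_range[OF assms(2) that] by (simp add: min_le_iff_disj)
qed

lemma stime_SUP:
  fixes D :: "nat \<Rightarrow> 'a \<Rightarrow> real"
  assumes "\<And>n. stime t (D n)" "0 \<le> t" shows "stime t (\<lambda>\<omega>. SUP n. D n \<omega>)"
proof -
  have b: "bdd_above (range (\<lambda>n. D n \<omega>))" if "\<omega> \<in> space M" for \<omega>
    using stime_range[OF assms(1) that] by (auto intro!: bdd_aboveI[of _ T])
  show ?thesis
  proof (rule stimeI)
    fix \<omega> assume w: "\<omega> \<in> space M"
    have "D 0 \<omega> \<le> (SUP n. D n \<omega>)" by (rule cSUP_upper[OF _ b[OF w]]) simp
    moreover have "(SUP n. D n \<omega>) \<le> T" by (rule cSUP_least) (use stime_range[OF assms(1) w] in auto)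
    ultimately show "t \<le> (SUP n. D n \<omega>) \<and> (SUP n. D n \<omega>) \<le> T"
      using stime_range[OF assms(1)[of 0] w] by auto
  next
    fix s assume s: "t \<le> s" "s < T"
    have "{\<omega>\<in>space M. (SUP n. D n \<omega>) \<le> s} = (\<Inter>n. {\<omega>\<in>space M. D n \<omega> \<le> s})"
      using b by (auto simp: cSUP_le_iff)
    then show "{\<omega>\<in>space M. (SUP n. D n \<omega>) \<le> s} \<in> sets (F (ennreal s))"
      using stime_le_sets assms s by (auto intro!: sets.countable_INT)
  qed
qed

text \<open>An event known at \<open>t\<close> is known at every later \<open>s\<close>, so each
  level set splits along it. This pasting is the source of upward directedness of the conditional
  payoffs.\<close>

lemma stime_combine:
  assumes "stime t \<theta>" "stime t \<theta>'" "0 \<le> t" "C \<in> sets (F (ennreal t))"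
  shows "stime t (\<lambda>\<omega>. if \<omega> \<in> C then \<theta> \<omega> else \<theta>' \<omega>)"
proof (rule stimeI)
  fix s assume s: "t \<le> s"
  have C: "C \<in> sets (F (ennreal s))"
    using assms(4) sets_F_mono[of "ennreal t" "ennreal s"] s by (auto intro: ennreal_leI)
  have "{\<omega>\<in>space M. (if \<omega> \<in> C then \<theta> \<omega> else \<theta>' \<omega>) \<le> s} =
      ({\<omega>\<in>space M. \<theta> \<omega> \<le> s} \<inter> C) \<union> ({\<omega>\<in>space M. \<theta>' \<omega> \<le> s} - C)" by auto
  also have "\<dots> \<in> sets (F (ennreal s))"
    using stime_le_sets[OF assms(1)] stime_le_sets[OF assms(2)] assms(3) s C
    by (auto intro!: sets.Un sets.Int sets.Diff)
  finally show "{\<omega>\<in>space M. (if \<omega> \<in> C then \<theta> \<omega> else \<theta>' \<omega>) \<le> s} \<in> sets (F (ennreal s))" .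
next
  show "t \<le> (if \<omega> \<in> C then \<theta> \<omega> else \<theta>' \<omega>) \<and> (if \<omega> \<in> C then \<theta> \<omega> else \<theta>' \<omega>) \<le> T" if "\<omega> \<in> space M" for \<omega>
    using stime_range[OF assms(1) that] stime_range[OF assms(2) that] by simp
qed

lemma stopping_times_AE_eq:
  assumes \<theta>: "stime t \<theta>" and t: "0 \<le> t" and ae: "AE \<omega> in M. \<nu> \<omega> = \<theta> \<omega>"
  shows "\<nu> \<in> stopping_times M F t T"
  unfolding stopping_times_def stopping_time_def
proof (intro CollectI conjI allI)
  fix u :: ennreal
  have "{\<omega> \<in> space M. ennreal (\<nu> \<omega>) \<le> u} \<in> sets (F u)"
  proof (cases u)
    case (real s)
    have "AE \<omega> in M. \<omega> \<in> {\<omega> \<in> space M. \<theta> \<omega> \<le> s} \<longleftrightarrow> \<omega> \<in> {\<omega> \<in> space M. ennreal (\<nu> \<omega>) \<le> u}"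
      using ae real by (auto simp: ennreal_le_iff)
    then show ?thesis
      using stime_le_sets[OF \<theta>, of s] real by (auto intro!: sets_F_AE_eq[of "{\<omega> \<in> space M. \<theta> \<omega> \<le> s}"])
  next
    case top
    then have "{\<omega> \<in> space M. ennreal (\<nu> \<omega>) \<le> u} = space (F u)" by (auto simp: space_F)
    then show ?thesis by (metis sets.top)
  qed
  then show "Measurable.pred (F u) (\<lambda>\<omega>. ennreal (\<nu> \<omega>) \<le> u)" by (simp add: pred_def space_F)
next
  show "AE \<omega> in M. t \<le> \<nu> \<omega> \<and> \<nu> \<omega> \<le> T"
    using ae AE_space by eventually_elim (use stime_range[OF \<theta>] in auto)
qed

lemma stime_stopping_times: "stime t \<theta> \<Longrightarrow> 0 \<le> t \<Longrightarrow> \<theta> \<in> stopping_times M F t T"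
  by (rule stopping_times_AE_eq) auto

text \<open>Clamping to \<open>[t, T]\<close> alters \<open>\<nu>\<close> only on a null set and
  leaves its level sets at times \<open>s\<close> with \<open>t \<le> s < T\<close>
  untouched.\<close>

lemma stopping_times_stime:
  assumes \<nu>: "\<nu> \<in> stopping_times M F t T" and t: "t \<in> {0..T}"
  obtains \<theta> where "stime t \<theta>" "AE \<omega> in M. \<nu> \<omega> = \<theta> \<omega>"
proof
  show "stime t (\<lambda>\<omega>. max t (min T (\<nu> \<omega>)))"
  proof (rule stimeI)
    fix s assume s: "t \<le> s" "s < T"
    have "{\<omega>\<in>space M. max t (min T (\<nu> \<omega>)) \<le> s} = {\<omega>\<in>space M. ennreal (\<nu> \<omega>) \<le> ennreal s}"
      using s t by (auto simp: ennreal_le_iff)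
    also have "\<dots> \<in> sets (F (ennreal s))"
      using \<nu> by (auto simp: stopping_times_def stopping_time_def pred_def space_F)
    finally show "{\<omega>\<in>space M. max t (min T (\<nu> \<omega>)) \<le> s} \<in> sets (F (ennreal s))" .
  qed (use t in auto)
  show "AE \<omega> in M. \<nu> \<omega> = max t (min T (\<nu> \<omega>))"
    using \<nu> by (auto simp: stopping_times_def)
qed

section \<open>Processes that can be evaluated at stopping times\<close>

definition dominated :: "(real \<Rightarrow> 'a \<Rightarrow> real) \<Rightarrow> bool" where
  "dominated X \<longleftrightarrow> (\<exists>B. integrable M B \<and> (AE \<omega> in M. \<forall>s\<in>{0..T}. \<bar>X s \<omega>\<bar> \<le> B \<omega>))"

text \<open>Shared by the members of \<open>S2_space\<close> and \<open>Q_space\<close> and by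
  running integrals, and stable under sums and differences, so that envelope and obstacle are
  treated alike even after a running reward has been added.\<close>

definition regular :: "(real \<Rightarrow> 'a \<Rightarrow> real) \<Rightarrow> bool" where
  "regular X \<longleftrightarrow> progressively_measurable F T X \<and> dominated X \<and>
     (AE \<omega> in M. \<forall>s\<in>{0..<T}. ((\<lambda>s. X s \<omega>) \<longlongrightarrow> X s \<omega>) (at_right s)) \<and>
     quasi_left_continuous_process M F T X"

lemma regular_bound:
  assumes "regular X"
  obtains B where "integrable M B" "AE \<omega> in M. \<forall>s\<in>{0..T}. \<bar>X s \<omega>\<bar> \<le> B \<omega>"
  using assms unfolding regular_def dominated_def by blast

lemma progressively_measurable_adapted:
  assumes X: "progressively_measurable F T X" and t: "t \<in> {0..T}"
  shows "X t \<in> borel_measurable (F (ennreal t))"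
proof -
  have X': "(\<lambda>(s, \<omega>). X s \<omega>) \<in>
      borel_measurable (restrict_space borel {0..t} \<Otimes>\<^sub>M F (ennreal t))"
    using X t by (simp add: progressively_measurable_def)
  have "(\<lambda>\<omega>. (t, \<omega>)) \<in> F (ennreal t) \<rightarrow>\<^sub>M restrict_space borel {0..t} \<Otimes>\<^sub>M F (ennreal t)"
    using t by (intro measurable_Pair1') (auto simp: space_restrict_space)
  from measurable_compose[OF this X'] show ?thesis by simp
qed

text \<open>Joint measurability is composed with the map sending \<open>\<omega>\<close> to
  \<open>(\<theta> \<omega>, \<omega>)\<close>; measurability at each fixed time would not permit
  inserting a random time.\<close>

lemma progressively_measurable_at_time:
  assumes X: "progressively_measurable F T X" and [measurable]: "\<theta> \<in> borel_measurable M"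
    and \<theta>: "\<And>\<omega>. \<omega> \<in> space M \<Longrightarrow> \<theta> \<omega> \<in> {0..T}"
  shows "(\<lambda>\<omega>. X (\<theta> \<omega>) \<omega>) \<in> borel_measurable M"
proof -
  have X': "(\<lambda>(s, \<omega>). X s \<omega>) \<in>
      borel_measurable (restrict_space borel {0..T} \<Otimes>\<^sub>M F (ennreal T))"
    using X T_pos by (simp add: progressively_measurable_def)
  have id: "(\<lambda>\<omega>. \<omega>) \<in> M \<rightarrow>\<^sub>M F (ennreal T)"
    using sets_F_subset[of "ennreal T"] by (intro measurableI) (auto simp: space_F)
  have "(\<lambda>\<omega>. (\<theta> \<omega>, \<omega>)) \<in> M \<rightarrow>\<^sub>M restrict_space borel {0..T} \<Otimes>\<^sub>M F (ennreal T)"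
    using \<theta> id by (intro measurable_Pair measurable_restrict_space2) auto
  from measurable_compose[OF this X'] show ?thesis by simp
qed

lemma at_time_measurable:
  assumes X: "regular X" and \<theta>: "stime t \<theta>" and t: "0 \<le> t"
  shows "(\<lambda>\<omega>. X (\<theta> \<omega>) \<omega>) \<in> borel_measurable M"
proof (rule progressively_measurable_at_time[where X=X and \<theta>=\<theta>])
  show "progressively_measurable F T X" using X unfolding regular_def by blast
  show "\<theta> \<omega> \<in> {0..T}" if "\<omega> \<in> space M" for \<omega>
    using stime_range[OF \<theta> that] t by simp
qed (rule stime_measurable[OF \<theta>])

lemma regular_adapted:
  assumes "regular X" "t \<in> {0..T}" shows "X t \<in> borel_measurable (F (ennreal t))"
proof (rule progressively_measurable_adapted[OF _ assms(2)])
  show "progressively_measurable F T X" using assms(1) unfolding regular_def by blast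
qed

lemma at_time_integrable:
  assumes "regular X" "stime t \<theta>" "0 \<le> t"
  shows "integrable M (\<lambda>\<omega>. X (\<theta> \<omega>) \<omega>)"
proof -
  obtain B where B: "integrable M B" "AE \<omega> in M. \<forall>s\<in>{0..T}. \<bar>X s \<omega>\<bar> \<le> B \<omega>"
    using assms(1) by (rule regular_bound)
  show ?thesis
  proof (rule Bochner_Integration.integrable_bound[OF B(1)])
    show "AE \<omega> in M. norm (X (\<theta> \<omega>) \<omega>) \<le> norm (B \<omega>)"
      using B(2) AE_space
    proof eventually_elim
      case (elim \<omega>)
      then have "\<theta> \<omega> \<in> {0..T}" using stime_range[OF assms(2)] assms(3) by force
      then show ?case using elim by fastforce
    qed
  qed (rule at_time_measurable[OF assms])
qed

lemma regular_integrable: "regular X \<Longrightarrow> s \<in> {0..T} \<Longrightarrow> integrable M (X s)"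
  using at_time_integrable[of X s "\<lambda>_. s"] stime_const[of s s] by auto

text \<open>Dominated convergence with the majorant from \<open>regular_bound\<close>. It is applied
  to grid roundings, to times that eventually coincide with their limit, and to increasing sequences
  under quasi-left-continuity.\<close>

lemma at_time_tendsto:
  fixes \<theta>n :: "nat \<Rightarrow> 'a \<Rightarrow> real"
  assumes X: "regular X" and \<theta>: "stime t \<theta>" "\<And>n. stime t (\<theta>n n)" and t: "0 \<le> t"
    and lim: "AE \<omega> in M. (\<lambda>n. X (\<theta>n n \<omega>) \<omega>) \<longlonglongrightarrow> X (\<theta> \<omega>) \<omega>" and A: "A \<in> sets M"
  shows "(\<lambda>n. LINT \<omega>:A|M. X (\<theta>n n \<omega>) \<omega>) \<longlonglongrightarrow> (LINT \<omega>:A|M. X (\<theta> \<omega>) \<omega>)"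
proof -
  obtain B where B: "integrable M B" "AE \<omega> in M. \<forall>s\<in>{0..T}. \<bar>X s \<omega>\<bar> \<le> B \<omega>"
    using X by (rule regular_bound)
  note [measurable] = A at_time_measurable[OF X \<theta>(1) t] at_time_measurable[OF X \<theta>(2) t]
  show ?thesis unfolding set_lebesgue_integral_def
  proof (rule integral_dominated_convergence[where w="\<lambda>\<omega>. \<bar>B \<omega>\<bar>"])
    show "AE \<omega> in M. (\<lambda>n. indicat_real A \<omega> *\<^sub>R X (\<theta>n n \<omega>) \<omega>) \<longlonglongrightarrow> indicat_real A \<omega> *\<^sub>R X (\<theta> \<omega>) \<omega>"
      using lim by eventually_elim (intro tendsto_intros)
    fix n
    show "AE \<omega> in M. norm (indicat_real A \<omega> *\<^sub>R X (\<theta>n n \<omega>) \<omega>) \<le> \<bar>B \<omega>\<bar>"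
      using B(2) AE_space
    proof eventually_elim
      case (elim \<omega>)
      then have "\<theta>n n \<omega> \<in> {0..T}" using stime_range[OF \<theta>(2)[of n]] t by force
      then have "\<bar>X (\<theta>n n \<omega>) \<omega>\<bar> \<le> B \<omega>" using elim by auto
      then show ?case by (auto simp: indicator_def)
    qed
  qed (use B(1) in auto)
qed

section \<open>Conditional expectations through integrals over events\<close>

lemma ce_integrable: "integrable M f \<Longrightarrow> integrable M (ce t f)"
  by (rule sigma_finite_subalgebra.real_cond_exp_int[OF sigma_finite_subalgebra_F])

lemma ce_integral: "integrable M f \<Longrightarrow> (LINT \<omega>|M. ce t f \<omega>) = (LINT \<omega>|M. f \<omega>)"
  by (rule sigma_finite_subalgebra.real_cond_exp_int[OF sigma_finite_subalgebra_F])

lemma ce_set_integral: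
  "integrable M f \<Longrightarrow> A \<in> sets (F (ennreal t)) \<Longrightarrow> (LINT \<omega>:A|M. ce t f \<omega>) = (LINT \<omega>:A|M. f \<omega>)"
  by (rule sigma_finite_subalgebra.real_cond_exp_intA[OF sigma_finite_subalgebra_F, symmetric])

text \<open>The event where \<open>g < f\<close> belongs to \<open>F u\<close>; testing on it forces
  the nonnegative function \<open>f - g\<close> restricted to it to have integral zero.\<close>

lemma set_integral_le_imp_AE_le:
  fixes f g :: "'a \<Rightarrow> real"
  assumes f: "integrable M f" "f \<in> borel_measurable (F u)"
    and g: "integrable M g" "g \<in> borel_measurable (F u)"
    and le: "\<And>A. A \<in> sets (F u) \<Longrightarrow> (LINT \<omega>:A|M. f \<omega>) \<le> (LINT \<omega>:A|M. g \<omega>)"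
  shows "AE \<omega> in M. f \<omega> \<le> g \<omega>"
proof -
  define A where "A = {\<omega> \<in> space M. g \<omega> < f \<omega>}"
  have A: "A \<in> sets (F u)"
    using borel_measurable_less[OF g(2) f(2)] unfolding A_def space_F[of u] .
  then have AM [measurable]: "A \<in> sets M" using sets_F_subset by blast
  have *: "set_integrable M A f" "set_integrable M A g"
    unfolding set_integrable_def
    by (rule integrable_mult_indicator[OF AM f(1)], rule integrable_mult_indicator[OF AM g(1)])
  have i: "integrable M (\<lambda>\<omega>. indicat_real A \<omega> * (f \<omega> - g \<omega>))"
    using integrable_mult_indicator[OF AM f(1)] integrable_mult_indicator[OF AM g(1)]
    by (simp add: right_diff_distrib)
  have "(LINT \<omega>|M. indicat_real A \<omega> * (f \<omega> - g \<omega>)) \<le> 0"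
    using le[OF A] set_integral_diff(2)[OF *] by (simp add: set_lebesgue_integral_def)
  moreover have nn: "AE \<omega> in M. 0 \<le> indicat_real A \<omega> * (f \<omega> - g \<omega>)"
    by (auto simp: A_def indicator_def)
  ultimately have "(LINT \<omega>|M. indicat_real A \<omega> * (f \<omega> - g \<omega>)) = 0"
    using integral_nonneg_AE[OF nn] by linarith
  then have "AE \<omega> in M. indicat_real A \<omega> * (f \<omega> - g \<omega>) = 0"
    using integral_nonneg_eq_0_iff_AE[OF i nn] by simp
  then show ?thesis using AE_space
    by eventually_elim (auto simp: A_def indicator_def split: if_splits)
qed

end

section \<open>The Snell envelope\<close>

text \<open>The filter \<open>at_right x\<close> ignores \<open>x\<close> itself, whereas
  \<open>r n\<close> may hit it, as a grid rounding does on grid points; there the value is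
  \<open>f x\<close> already.\<close>

lemma tendsto_at_right_sequentially:
  fixes f :: "real \<Rightarrow> real"
  assumes f: "(f \<longlongrightarrow> f x) (at_right x)" and r: "r \<longlonglongrightarrow> x" "\<And>n. x \<le> r n"
  shows "(\<lambda>n. f (r n)) \<longlonglongrightarrow> f x"
proof (rule topological_tendstoI)
  fix S assume S: "open S" "f x \<in> S"
  then obtain b where b: "b > x" "\<And>y. x < y \<Longrightarrow> y < b \<Longrightarrow> f y \<in> S"
    using topological_tendstoD[OF f S] by (auto simp: eventually_at_right_field)
  have "\<forall>\<^sub>F n in sequentially. r n < b" using order_tendstoD(2)[OF r(1) b(1)] .
  then show "\<forall>\<^sub>F n in sequentially. f (r n) \<in> S"
    by eventually_elim (metis S(2) b(2) order_le_less r(2))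
qed

lemma AE_eq_0_if_integral_nonpos:
  fixes f :: "'a \<Rightarrow> real"
  assumes "integrable M f" "AE x in M. 0 \<le> f x" "(LINT x|M. f x) \<le> 0"
  shows "AE x in M. f x = 0"
  using integral_nonneg_AE[OF assms(2)] integral_nonneg_eq_0_iff_AE[OF assms(1,2)] assms(3) by simp

lemma integrable_imp_set_integrable:
  fixes f :: "'a \<Rightarrow> real"
  shows "integrable M f \<Longrightarrow> A \<in> sets M \<Longrightarrow> set_integrable M A f"
  unfolding set_integrable_def by (rule integrable_mult_indicator)

lemma set_integral_mono_integrable:
  fixes f g :: "'a \<Rightarrow> real"
  assumes "integrable M f" "integrable M g" "A \<in> sets M" "AE x in M. f x \<le> g x"
  shows "(LINT x:A|M. f x) \<le> (LINT x:A|M. g x)"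
  unfolding set_lebesgue_integral_def
proof (rule integral_mono_AE)
  show "AE x in M. indicat_real A x *\<^sub>R f x \<le> indicat_real A x *\<^sub>R g x"
    using assms(4) by eventually_elim (auto simp: indicator_def)
qed (rule integrable_mult_indicator assms)+

text \<open>Optimal stopping reward whose obstacle \<open>H\<close> is replaced by the terminal
  reward \<open>\<xi>\<close> at the horizon, possibly with a jump.\<close>

definition stopped_payoff ::
  "real \<Rightarrow> (real \<Rightarrow> 'a \<Rightarrow> real) \<Rightarrow> ('a \<Rightarrow> real) \<Rightarrow> ('a \<Rightarrow> real) \<Rightarrow> 'a \<Rightarrow> real" where
  "stopped_payoff T H \<xi> \<theta> \<omega> = (if \<theta> \<omega> < T then H (\<theta> \<omega>) \<omega> else \<xi> \<omega>)"

lemma (in horizon) integrable_stopped_payoff: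
  assumes H: "regular H" and \<xi>: "integrable M \<xi>" and \<theta>: "stime t \<theta>" and t: "0 \<le> t"
  shows "integrable M (stopped_payoff T H \<xi> \<theta>)"
proof -
  note [measurable] = stime_measurable[OF \<theta>] at_time_measurable[OF H \<theta> t] borel_measurable_integrable[OF \<xi>]
  have "integrable M (\<lambda>\<omega>. \<bar>H (\<theta> \<omega>) \<omega>\<bar> + \<bar>\<xi> \<omega>\<bar>)"
    by (intro Bochner_Integration.integrable_add integrable_abs at_time_integrable[OF H \<theta> t] \<xi>)
  then show ?thesis
  proof (rule Bochner_Integration.integrable_bound)
    show "stopped_payoff T H \<xi> \<theta> \<in> borel_measurable M" unfolding stopped_payoff_def by measurable
  qed (auto simp: stopped_payoff_def)
qed

text \<open>\<open>dominates\<close> and \<open>least\<close> are the two clauses of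
  \<open>is_ess_sup\<close>, restricted to times bounded everywhere. The terminal reward is the
  terminal value \<open>Z T\<close> of the envelope itself.\<close>

locale snell_envelope = horizon M F T
  for M :: "'a measure" and F :: "ennreal \<Rightarrow> 'a measure" and T :: real +
  fixes Z H :: "real \<Rightarrow> 'a \<Rightarrow> real"
  assumes regular_Z: "regular Z" and regular_H: "regular H"
    and dominates: "\<And>t \<theta>. t \<in> {0..T} \<Longrightarrow> stime t \<theta> \<Longrightarrow>
      AE \<omega> in M. ce t (stopped_payoff T H (Z T) \<theta>) \<omega> \<le> Z t \<omega>"
    and least: "\<And>t Z'. t \<in> {0..T} \<Longrightarrow> Z' \<in> borel_measurable M \<Longrightarrow>
      (\<And>\<theta>. stime t \<theta> \<Longrightarrow> AE \<omega> in M. ce t (stopped_payoff T H (Z T) \<theta>) \<omega> \<le> Z' \<omega>) \<Longrightarrow>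
      AE \<omega> in M. Z t \<omega> \<le> Z' \<omega>"
begin

abbreviation G :: "('a \<Rightarrow> real) \<Rightarrow> 'a \<Rightarrow> real" where
  "G \<equiv> stopped_payoff T H (Z T)"

lemma integrable_Z: "t \<in> {0..T} \<Longrightarrow> integrable M (Z t)"
  by (rule regular_integrable[OF regular_Z])

lemma integrable_payoff: "stime t \<theta> \<Longrightarrow> 0 \<le> t \<Longrightarrow> integrable M (G \<theta>)"
  using integrable_Z[of T] T_pos by (intro integrable_stopped_payoff regular_H) simp_all

text \<open>On the event \<open>C\<close>, where the first conditional payoff is the larger one,
  follow \<open>\<theta>1\<close>, elsewhere \<open>\<theta>2\<close>. Since \<open>C\<close> lies
  in \<open>F t\<close>, its indicator passes through the conditional expectation.\<close>

lemma ce_payoff_combine: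
  assumes "stime t \<theta>1" "stime t \<theta>2" "0 \<le> t" "t \<le> T"
  shows "\<exists>\<theta>. stime t \<theta> \<and> (AE \<omega> in M. ce t (G \<theta>) \<omega> = max (ce t (G \<theta>1) \<omega>) (ce t (G \<theta>2) \<omega>))"
proof -
  interpret sfs: sigma_finite_subalgebra M "F (ennreal t)" by (rule sigma_finite_subalgebra_F)
  define C where "C = {\<omega>\<in>space (F (ennreal t)). ce t (G \<theta>2) \<omega> \<le> ce t (G \<theta>1) \<omega>}"
  have C[measurable]: "C \<in> sets (F (ennreal t))"
    unfolding C_def by (rule borel_measurable_le) (rule borel_measurable_cond_exp)+
  then have CM: "C \<in> sets M" using sets_F_subset by blast
  define \<theta> where "\<theta> = (\<lambda>\<omega>. if \<omega> \<in> C then \<theta>1 \<omega> else \<theta>2 \<omega>)"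
  have \<theta>: "stime t \<theta>" unfolding \<theta>_def using stime_combine assms(1-3) C by blast
  have i: "integrable M (G \<theta>1)" "integrable M (G \<theta>2)"
    using integrable_payoff assms by blast+
  have i1: "integrable M (\<lambda>\<omega>. indicat_real C \<omega> * G \<theta>1 \<omega>)"
    using integrable_mult_indicator[OF CM i(1)] by simp
  have i2: "integrable M (\<lambda>\<omega>. (1 - indicat_real C \<omega>) * G \<theta>2 \<omega>)"
    using integrable_mult_indicator[OF CM i(2)] i(2) by (simp add: left_diff_distrib)
  have eq: "G \<theta> = (\<lambda>\<omega>. indicat_real C \<omega> * G \<theta>1 \<omega> + (1 - indicat_real C \<omega>) * G \<theta>2 \<omega>)"
    by (auto simp: stopped_payoff_def \<theta>_def indicator_def)
  have "AE \<omega> in M. ce t (G \<theta>) \<omega> = ce t (\<lambda>\<omega>. indicat_real C \<omega> * G \<theta>1 \<omega>) \<omega> +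
      ce t (\<lambda>\<omega>. (1 - indicat_real C \<omega>) * G \<theta>2 \<omega>) \<omega>"
    unfolding eq by (rule sfs.real_cond_exp_add[OF i1 i2])
  moreover have "AE \<omega> in M. ce t (\<lambda>\<omega>. indicat_real C \<omega> * G \<theta>1 \<omega>) \<omega> = indicat_real C \<omega> * ce t (G \<theta>1) \<omega>"
    by (rule sfs.real_cond_exp_mult[OF _ _ i1]) (use i in measurable)
  moreover have "AE \<omega> in M. ce t (\<lambda>\<omega>. (1 - indicat_real C \<omega>) * G \<theta>2 \<omega>) \<omega> =
      (1 - indicat_real C \<omega>) * ce t (G \<theta>2) \<omega>"
    by (rule sfs.real_cond_exp_mult[OF _ _ i2]) (use i in measurable)
  ultimately have "AE \<omega> in M. ce t (G \<theta>) \<omega> = max (ce t (G \<theta>1) \<omega>) (ce t (G \<theta>2) \<omega>)"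
    using AE_space by eventually_elim (auto simp: C_def indicator_def space_F)
  then show ?thesis using \<theta> by blast
qed

text \<open>An upward directed family attains its essential supremum along an increasing sequence.
  With \<open>c\<close> the supremum of the expected payoffs, the limit \<open>Z'\<close> of such a
  sequence has expectation at most \<open>c\<close> and dominates the whole family, so
  \<open>least\<close> gives \<open>Z t \<le> Z'\<close>.\<close>

lemma near_optimal:
  assumes t: "t \<in> {0..T}" and e: "0 < e"
  shows "\<exists>\<theta>. stime t \<theta> \<and> (LINT \<omega>|M. Z t \<omega>) \<le> (LINT \<omega>|M. G \<theta> \<omega>) + e"
proof -
  have t': "0 \<le> t" "t \<le> T" using t by auto
  have iG: "integrable M (G \<theta>)" if "stime t \<theta>" for \<theta> using integrable_payoff that t' by blast
  have iZ: "integrable M (Z t)" using integrable_Z t by blast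
  define S where "S = (\<lambda>\<theta>. LINT \<omega>|M. G \<theta> \<omega>) ` Collect (stime t)"
  define c where "c = Sup S"
  have S_ne: "S \<noteq> {}" unfolding S_def using stime_const[of t T] t' by auto
  have "(LINT \<omega>|M. G \<theta> \<omega>) \<le> (LINT \<omega>|M. Z t \<omega>)" if "stime t \<theta>" for \<theta>
    using integral_mono_AE[OF ce_integrable[OF iG[OF that], of t] iZ dominates[OF t that]]
      ce_integral[OF iG[OF that], of t] by simp
  then have S_bdd: "bdd_above S" unfolding S_def by (auto intro!: bdd_aboveI)
  have le_c: "(LINT \<omega>|M. G \<theta> \<omega>) \<le> c" if "stime t \<theta>" for \<theta>
    unfolding c_def by (rule cSup_upper[OF _ S_bdd]) (use that in \<open>auto simp: S_def\<close>)
  have approx: "\<exists>\<theta>. stime t \<theta> \<and> c - d < (LINT \<omega>|M. G \<theta> \<omega>)" if "0 < d" for d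
    using less_cSup_iff[OF S_ne S_bdd, of "c - d"] that by (auto simp: c_def S_def)
  have int_max: "(LINT \<omega>|M. max (ce t (G \<theta>1) \<omega>) (ce t (G \<theta>2) \<omega>)) \<le> c"
    if \<theta>12: "stime t \<theta>1" "stime t \<theta>2" for \<theta>1 \<theta>2
  proof -
    obtain \<theta> where \<theta>: "stime t \<theta>"
      "AE \<omega> in M. ce t (G \<theta>) \<omega> = max (ce t (G \<theta>1) \<omega>) (ce t (G \<theta>2) \<omega>)"
      using ce_payoff_combine[OF \<theta>12 t'] by blast
    have "(LINT \<omega>|M. max (ce t (G \<theta>1) \<omega>) (ce t (G \<theta>2) \<omega>)) = (LINT \<omega>|M. ce t (G \<theta>) \<omega>)"
    proof (rule integral_cong_AE)
      show "AE \<omega> in M. max (ce t (G \<theta>1) \<omega>) (ce t (G \<theta>2) \<omega>) = ce t (G \<theta>) \<omega>"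
        using \<theta>(2) by eventually_elim simp
    qed auto
    also have "\<dots> \<le> c" using le_c[OF \<theta>(1)] ce_integral[OF iG[OF \<theta>(1)], of t] by simp
    finally show ?thesis .
  qed
  \<comment> \<open>Each new near-maximiser of the expectation is pasted with the previous choice;
    the pasting keeps its expectation and makes the conditional payoffs increase.\<close>
  have "\<exists>f. \<forall>n. (stime t (f n) \<and> c - 1 / real (Suc n) < (LINT \<omega>|M. G (f n) \<omega>)) \<and>
      (AE \<omega> in M. ce t (G (f n)) \<omega> \<le> ce t (G (f (Suc n))) \<omega>)"
  proof (rule dependent_nat_choice)
    show "\<exists>\<theta>. stime t \<theta> \<and> c - 1 / real (Suc 0) < (LINT \<omega>|M. G \<theta> \<omega>)"
      using approx[of 1] by simp
    fix \<theta>1 and n :: nat assume 1: "stime t \<theta>1 \<and> c - 1 / real (Suc n) < (LINT \<omega>|M. G \<theta>1 \<omega>)"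
    obtain \<theta>2 where 2: "stime t \<theta>2" "c - 1 / real (Suc (Suc n)) < (LINT \<omega>|M. G \<theta>2 \<omega>)"
      using approx[of "1 / real (Suc (Suc n))"] by auto
    obtain \<theta> where \<theta>: "stime t \<theta>"
      "AE \<omega> in M. ce t (G \<theta>) \<omega> = max (ce t (G \<theta>1) \<omega>) (ce t (G \<theta>2) \<omega>)"
      using ce_payoff_combine[OF conjunct1[OF 1] 2(1) t'] by blast
    have "(LINT \<omega>|M. ce t (G \<theta>2) \<omega>) \<le> (LINT \<omega>|M. ce t (G \<theta>) \<omega>)"
      by (rule integral_mono_AE[OF ce_integrable[OF iG[OF 2(1)]] ce_integrable[OF iG[OF \<theta>(1)]]])
        (use \<theta>(2) in eventually_elim, simp)
    then have "c - 1 / real (Suc (Suc n)) < (LINT \<omega>|M. G \<theta> \<omega>)"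
      using 2(2) ce_integral[OF iG[OF 2(1)], of t] ce_integral[OF iG[OF \<theta>(1)], of t] by simp
    moreover have "AE \<omega> in M. ce t (G \<theta>1) \<omega> \<le> ce t (G \<theta>) \<omega>"
      using \<theta>(2) by eventually_elim simp
    ultimately show "\<exists>\<theta>. (stime t \<theta> \<and> c - 1 / real (Suc (Suc n)) < (LINT \<omega>|M. G \<theta> \<omega>)) \<and>
        (AE \<omega> in M. ce t (G \<theta>1) \<omega> \<le> ce t (G \<theta>) \<omega>)"
      using \<theta>(1) by blast
  qed
  then obtain f where f: "\<And>n. stime t (f n)" "\<And>n. c - 1 / real (Suc n) < (LINT \<omega>|M. G (f n) \<omega>)"
    and f_mono: "\<And>n. AE \<omega> in M. ce t (G (f n)) \<omega> \<le> ce t (G (f (Suc n))) \<omega>" by blast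
  define X where "X n = ce t (G (f n))" for n
  have iX: "integrable M (X n)" and X_int: "(LINT \<omega>|M. X n \<omega>) = (LINT \<omega>|M. G (f n) \<omega>)" for n
    using ce_integrable[OF iG[OF f(1)]] ce_integral[OF iG[OF f(1)]] by (simp_all add: X_def)
  \<comment> \<open>A pointwise \<open>lim\<close> is measurable. Its arbitrary value at points of
    divergence matters only on a null set, since almost surely the sequence increases and is bounded
    by \<open>Z t\<close>.\<close>
  define Z' where "Z' \<omega> = lim (\<lambda>n. X n \<omega>)" for \<omega>
  have [measurable]: "X n \<in> borel_measurable M" for n using iX by auto
  have Z'[measurable]: "Z' \<in> borel_measurable M" unfolding Z'_def by measurable
  have X_le: "AE \<omega> in M. \<forall>n. X n \<omega> \<le> Z t \<omega>"
    using dominates[OF t f(1)] by (simp add: AE_all_countable X_def)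
  have X_Suc: "AE \<omega> in M. \<forall>n. X n \<omega> \<le> X (Suc n) \<omega>"
    using f_mono by (simp add: AE_all_countable X_def)
  have lim: "AE \<omega> in M. (\<lambda>n. X n \<omega>) \<longlonglongrightarrow> Z' \<omega> \<and> (\<forall>n. X n \<omega> \<le> Z' \<omega> \<and> X 0 \<omega> \<le> X n \<omega>)"
    using X_le X_Suc
  proof eventually_elim
    case (elim \<omega>)
    then have inc: "incseq (\<lambda>n. X n \<omega>)" by (simp add: incseq_Suc_iff)
    obtain L where L: "(\<lambda>n. X n \<omega>) \<longlonglongrightarrow> L" "\<forall>n. X n \<omega> \<le> L"
      using incseq_convergent[OF inc elim(1)] by blast
    then have "Z' \<omega> = L" unfolding Z'_def by (intro limI)
    then show ?case using L inc by (auto simp: incseq_def)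
  qed
  have conv: "integrable M Z'" "(\<lambda>n. LINT \<omega>|M. X n \<omega>) \<longlonglongrightarrow> (LINT \<omega>|M. Z' \<omega>)"
  proof -
    have w: "integrable M (\<lambda>\<omega>. \<bar>X 0 \<omega>\<bar> + \<bar>Z t \<omega>\<bar>)" using iX iZ by auto
    have lim': "AE \<omega> in M. (\<lambda>n. X n \<omega>) \<longlonglongrightarrow> Z' \<omega>" using lim by eventually_elim simp
    have bd: "AE \<omega> in M. norm (X n \<omega>) \<le> \<bar>X 0 \<omega>\<bar> + \<bar>Z t \<omega>\<bar>" for n
      using lim X_le
    proof eventually_elim
      case (elim \<omega>)
      then have "X 0 \<omega> \<le> X n \<omega>" "X n \<omega> \<le> Z t \<omega>" by auto
      then show ?case by auto
    qed
    show "integrable M Z'"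
      by (rule integrable_dominated_convergence[OF _ _ w lim' bd]; simp)
    show "(\<lambda>n. LINT \<omega>|M. X n \<omega>) \<longlonglongrightarrow> (LINT \<omega>|M. Z' \<omega>)"
      by (rule integral_dominated_convergence[OF _ _ w lim' bd]; simp)
  qed
  have "AE \<omega> in M. ce t (G \<theta>) \<omega> \<le> Z' \<omega>" if \<theta>: "stime t \<theta>" for \<theta>
  proof -
    have i\<theta>: "integrable M (ce t (G \<theta>))" using ce_integrable[OF iG[OF \<theta>]] .
    have iP: "integrable M (\<lambda>\<omega>. max 0 (ce t (G \<theta>) \<omega> - Z' \<omega>))"
      using i\<theta> conv(1) by auto
    \<comment> \<open>Where \<open>ce t (G \<theta>)\<close> exceeds \<open>Z'\<close> it also
      exceeds \<open>X n\<close>. The maximum of the two is again the conditional payoff of a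
      stopping time, with expectation at most \<open>c\<close>, while \<open>X n\<close> already has
      expectation above \<open>c - 1 / real (Suc n)\<close>.\<close>
    have le: "(LINT \<omega>|M. max 0 (ce t (G \<theta>) \<omega> - Z' \<omega>)) \<le> 1 / real (Suc n)" for n
    proof -
      have im: "integrable M (\<lambda>\<omega>. max (ce t (G \<theta>) \<omega>) (ce t (G (f n)) \<omega>))"
        using i\<theta> iX[of n] unfolding X_def by auto
      have "(LINT \<omega>|M. max 0 (ce t (G \<theta>) \<omega> - Z' \<omega>)) \<le>
          (LINT \<omega>|M. max (ce t (G \<theta>) \<omega>) (ce t (G (f n)) \<omega>) - X n \<omega>)"
      proof (rule integral_mono_AE[OF iP])
        show "AE \<omega> in M. max 0 (ce t (G \<theta>) \<omega> - Z' \<omega>) \<le> max (ce t (G \<theta>) \<omega>) (ce t (G (f n)) \<omega>) - X n \<omega>"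
          using lim
        proof eventually_elim
          case (elim \<omega>)
          then have "X n \<omega> \<le> Z' \<omega>" by blast
          then show ?case by (auto simp: X_def)
        qed
      qed (use im iX in auto)
      also have "\<dots> = (LINT \<omega>|M. max (ce t (G \<theta>) \<omega>) (ce t (G (f n)) \<omega>)) - (LINT \<omega>|M. X n \<omega>)"
        by (rule Bochner_Integration.integral_diff[OF im iX])
      also have "\<dots> \<le> 1 / real (Suc n)"
        using int_max[OF \<theta> f(1)[of n]] f(2)[of n] X_int[of n] by linarith
      finally show ?thesis .
    qed
    have "(LINT \<omega>|M. max 0 (ce t (G \<theta>) \<omega> - Z' \<omega>)) \<le> 0"
      by (rule LIMSEQ_le_const[OF LIMSEQ_inverse_real_of_nat]) (use le in \<open>auto simp: inverse_eq_divide\<close>)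
    then have "AE \<omega> in M. max 0 (ce t (G \<theta>) \<omega> - Z' \<omega>) = 0"
      by (intro AE_eq_0_if_integral_nonpos[OF iP]) auto
    then show ?thesis by eventually_elim (simp add: max_def split: if_splits)
  qed
  then have "AE \<omega> in M. Z t \<omega> \<le> Z' \<omega>" by (intro least[OF t Z'])
  then have "(LINT \<omega>|M. Z t \<omega>) \<le> (LINT \<omega>|M. Z' \<omega>)" by (rule integral_mono_AE[OF iZ conv(1)])
  also have "\<dots> \<le> c"
    by (rule LIMSEQ_le_const2[OF conv(2)]) (use X_int le_c f(1) in auto)
  finally have "(LINT \<omega>|M. Z t \<omega>) \<le> c" .
  then show ?thesis using approx[OF e] by force
qed

text \<open>A near-optimal time for the later date \<open>u\<close> is admissible at
  \<open>s\<close> as well, and on an event of \<open>F s\<close> its payoff integrates to the same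
  value whether conditioned at \<open>s\<close> or at \<open>u\<close>.\<close>

lemma supermartingale:
  assumes "0 \<le> s" "s \<le> u" "u \<le> T" and A: "A \<in> sets (F (ennreal s))"
  shows "(LINT \<omega>:A|M. Z u \<omega>) \<le> (LINT \<omega>:A|M. Z s \<omega>)"
proof (rule field_le_epsilon)
  fix e :: real assume "0 < e"
  have u: "u \<in> {0..T}" and s: "s \<in> {0..T}" using assms by auto
  obtain \<theta> where \<theta>: "stime u \<theta>" "(LINT \<omega>|M. Z u \<omega>) \<le> (LINT \<omega>|M. G \<theta> \<omega>) + e"
    using near_optimal[OF u \<open>0 < e\<close>] by blast
  have \<theta>s: "stime s \<theta>" using stime_mono[OF \<theta>(1)] assms by simp
  have AM: "A \<in> sets M" using A sets_F_subset by blast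
  have Au: "A \<in> sets (F (ennreal u))"
    using A sets_F_mono[of "ennreal s" "ennreal u"] assms by (auto intro: ennreal_leI)
  have iG: "integrable M (G \<theta>)" using integrable_payoff[OF \<theta>(1)] u by simp
  have iD: "integrable M (\<lambda>\<omega>. Z u \<omega> - ce u (G \<theta>) \<omega>)"
    using integrable_Z[OF u] ce_integrable[OF iG] by simp
  \<comment> \<open>The gap is nonnegative, so restricting it to \<open>A\<close> only lowers its
    integral: an error in total expectation bounds the error on every event.\<close>
  have "(LINT \<omega>:A|M. Z u \<omega> - ce u (G \<theta>) \<omega>) \<le> (LINT \<omega>|M. Z u \<omega> - ce u (G \<theta>) \<omega>)"
    unfolding set_lebesgue_integral_def
  proof (rule integral_mono_AE)
    show "AE \<omega> in M. indicat_real A \<omega> *\<^sub>R (Z u \<omega> - ce u (G \<theta>) \<omega>) \<le> Z u \<omega> - ce u (G \<theta>) \<omega>"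
      using dominates[OF u \<theta>(1)] by eventually_elim (auto simp: indicator_def)
  qed (rule integrable_mult_indicator[OF AM iD] iD)+
  also have "\<dots> \<le> e"
    using \<theta>(2) integrable_Z[OF u] ce_integrable[OF iG] ce_integral[OF iG, of u] by simp
  finally have 1: "(LINT \<omega>:A|M. Z u \<omega> - ce u (G \<theta>) \<omega>) \<le> e" .
  have "(LINT \<omega>:A|M. Z u \<omega> - ce u (G \<theta>) \<omega>) = (LINT \<omega>:A|M. Z u \<omega>) - (LINT \<omega>:A|M. ce u (G \<theta>) \<omega>)"
    using integrable_Z[OF u] ce_integrable[OF iG]
    by (intro set_integral_diff integrable_imp_set_integrable AM)
  moreover have "(LINT \<omega>:A|M. ce u (G \<theta>) \<omega>) = (LINT \<omega>:A|M. ce s (G \<theta>) \<omega>)"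
    using ce_set_integral[OF iG Au] ce_set_integral[OF iG A] by simp
  moreover have "(LINT \<omega>:A|M. ce s (G \<theta>) \<omega>) \<le> (LINT \<omega>:A|M. Z s \<omega>)"
    by (rule set_integral_mono_integrable[OF ce_integrable[OF iG] integrable_Z[OF s] AM dominates[OF s \<theta>s]])
  ultimately show "(LINT \<omega>:A|M. Z u \<omega>) \<le> (LINT \<omega>:A|M. Z s \<omega>) + e" using 1 by linarith
qed

end

section \<open>Optional sampling\<close>

text \<open>Rounding goes up: this keeps the rounded time a stopping time and makes it approach from
  the right, the side on which the paths are continuous.\<close>

definition grid_index :: "real \<Rightarrow> real \<Rightarrow> real \<Rightarrow> nat" where
  "grid_index t \<delta> x = nat \<lceil>(x - t) / \<delta>\<rceil>"

definition grid_round :: "real \<Rightarrow> real \<Rightarrow> real \<Rightarrow> real" where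
  "grid_round t \<delta> x = t + real (grid_index t \<delta> x) * \<delta>"

text \<open>The adjunction between the ceiling and the embedding of the integers. It turns events
  about the index into level sets of the unrounded time.\<close>

lemma grid_index_le_iff: "0 < \<delta> \<Longrightarrow> grid_index t \<delta> x \<le> k \<longleftrightarrow> x \<le> t + real k * \<delta>"
proof -
  assume "0 < \<delta>"
  have "grid_index t \<delta> x \<le> k \<longleftrightarrow> (x - t) / \<delta> \<le> real k"
    unfolding grid_index_def by linarith
  also have "\<dots> \<longleftrightarrow> x - t \<le> real k * \<delta>"
    using \<open>0 < \<delta>\<close> by (rule pos_divide_le_eq)
  finally show ?thesis by linarith
qed

lemma grid_index_mono: "0 < \<delta> \<Longrightarrow> x \<le> y \<Longrightarrow> grid_index t \<delta> x \<le> grid_index t \<delta> y"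
  by (meson grid_index_le_iff order_refl order_trans)

lemma grid_round_ge: "0 < \<delta> \<Longrightarrow> x \<le> grid_round t \<delta> x"
  unfolding grid_round_def by (simp add: grid_index_le_iff[symmetric])

lemma grid_round_le:
  assumes "0 < \<delta>" "t \<le> x" shows "grid_round t \<delta> x \<le> x + \<delta>"
proof -
  have "0 \<le> (x - t) / \<delta>" using assms by simp
  then have "real (grid_index t \<delta> x) \<le> (x - t) / \<delta> + 1" unfolding grid_index_def by linarith
  then have "real (grid_index t \<delta> x) * \<delta> \<le> ((x - t) / \<delta> + 1) * \<delta>"
    using assms(1) by (intro mult_right_mono) auto
  also have "\<dots> = x - t + \<delta>" using assms(1) by (simp add: field_simps)
  finally show ?thesis unfolding grid_round_def by simp
qed

text \<open>As \<open>T\<close> is a grid point, rounding does not leave \<open>[t, T]\<close>. The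
  rounded time is at most \<open>s\<close> exactly if the original one is at most the last grid
  point not after \<open>s\<close>, whose index is \<open>m\<close>.\<close>

lemma (in horizon) stime_grid_round:
  assumes \<theta>: "stime t \<theta>" and t: "0 \<le> t" and \<delta>: "0 < \<delta>" and N: "t + real N * \<delta> = T"
  shows "stime t (\<lambda>\<omega>. grid_round t \<delta> (\<theta> \<omega>))"
proof (rule stimeI)
  fix \<omega> assume w: "\<omega> \<in> space M"
  have "grid_index t \<delta> (\<theta> \<omega>) \<le> N"
    using stime_range[OF \<theta> w] N by (simp add: grid_index_le_iff[OF \<delta>])
  then have "real (grid_index t \<delta> (\<theta> \<omega>)) * \<delta> \<le> real N * \<delta>"
    using \<delta> by (intro mult_right_mono) auto
  then have "grid_round t \<delta> (\<theta> \<omega>) \<le> T" using N unfolding grid_round_def by linarith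
  then show "t \<le> grid_round t \<delta> (\<theta> \<omega>) \<and> grid_round t \<delta> (\<theta> \<omega>) \<le> T"
    using \<delta> by (simp add: grid_round_def)
next
  fix s assume s: "t \<le> s" "s < T"
  define m where "m = nat \<lfloor>(s - t) / \<delta>\<rfloor>"
  have sd: "0 \<le> (s - t) / \<delta>" using s \<delta> by simp
  have iff: "grid_round t \<delta> x \<le> s \<longleftrightarrow> x \<le> t + real m * \<delta>" for x
  proof -
    have "grid_round t \<delta> x \<le> s \<longleftrightarrow> real (grid_index t \<delta> x) \<le> (s - t) / \<delta>"
      using \<delta> by (simp add: grid_round_def pos_le_divide_eq) linarith
    also have "\<dots> \<longleftrightarrow> grid_index t \<delta> x \<le> m"
      unfolding m_def using sd by linarith
    finally show ?thesis by (simp add: grid_index_le_iff[OF \<delta>])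
  qed
  have "real m \<le> (s - t) / \<delta>" unfolding m_def using sd by linarith
  then have "t + real m * \<delta> \<le> s" using \<delta> by (simp add: pos_le_divide_eq)
  then have "sets (F (ennreal (t + real m * \<delta>))) \<subseteq> sets (F (ennreal s))"
    by (intro sets_F_mono ennreal_leI)
  moreover have "{\<omega>\<in>space M. \<theta> \<omega> \<le> t + real m * \<delta>} \<in> sets (F (ennreal (t + real m * \<delta>)))"
    using t \<delta> by (intro stime_le_sets[OF \<theta>]) simp
  ultimately show "{\<omega>\<in>space M. grid_round t \<delta> (\<theta> \<omega>) \<le> s} \<in> sets (F (ennreal s))"
    unfolding iff by blast
qed

context snell_envelope
begin

lemma integrable_at_Z: "stime t \<theta> \<Longrightarrow> 0 \<le> t \<Longrightarrow> integrable M (\<lambda>\<omega>. Z (\<theta> \<omega>) \<omega>)"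
  by (rule at_time_integrable[OF regular_Z])

text \<open>The difference of the two sampled values telescopes into increments over grid cells,
  each weighted by the indicator of \<open>B k\<close>, the part of \<open>A\<close> where
  \<open>\<rho> \<le> t + k * \<delta> < \<rho>'\<close>. This event is known at the left end of the
  cell, where the supermartingale inequality applies.\<close>

lemma optional_sampling_grid:
  assumes \<rho>: "stime t \<rho>" "stime t \<rho>'" and le: "\<And>\<omega>. \<omega> \<in> space M \<Longrightarrow> \<rho> \<omega> \<le> \<rho>' \<omega>"
    and t: "0 \<le> t" and \<delta>: "0 < \<delta>" and N: "t + real N * \<delta> = T" and A: "A \<in> sets (F (ennreal t))"
  shows "(LINT \<omega>:A|M. Z (grid_round t \<delta> (\<rho>' \<omega>)) \<omega>) \<le> (LINT \<omega>:A|M. Z (grid_round t \<delta> (\<rho> \<omega>)) \<omega>)"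
proof -
  let ?s = "\<lambda>k. t + real k * \<delta>"
  have AM: "A \<in> sets M" using A sets_F_subset by blast
  define B where "B k = A \<inter> {\<omega>\<in>space M. \<rho> \<omega> \<le> ?s k} - {\<omega>\<in>space M. \<rho>' \<omega> \<le> ?s k}" for k
  have s: "0 \<le> ?s k" "t \<le> ?s k" for k using t \<delta> by simp_all
  have sT: "?s k \<le> T" if "k \<le> N" for k
  proof -
    have "real k * \<delta> \<le> real N * \<delta>" using that \<delta> by (intro mult_right_mono) auto
    then show ?thesis using N by linarith
  qed
  have B: "B k \<in> sets (F (ennreal (?s k)))" for k
  proof -
    have "A \<in> sets (F (ennreal (?s k)))"
      using A sets_F_mono[OF ennreal_leI[OF s(2)]] by blast
    then show ?thesis unfolding B_def
      by (intro sets.Diff sets.Int stime_le_sets[OF \<rho>(1)] stime_le_sets[OF \<rho>(2)] s)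
  qed
  then have BM: "B k \<in> sets M" for k using sets_F_subset by blast
  have iZ: "integrable M (Z (?s k))" if "k \<le> N" for k
    using integrable_Z s sT[OF that] by simp
  have iD: "integrable M (\<lambda>\<omega>. indicat_real (B k) \<omega> *\<^sub>R (Z (?s (Suc k)) \<omega> - Z (?s k) \<omega>))" if "k < N" for k
    using that by (intro integrable_mult_indicator[OF BM] Bochner_Integration.integrable_diff iZ) auto
  have iR: "integrable M (\<lambda>\<omega>. Z (grid_round t \<delta> (\<rho> \<omega>)) \<omega>)" "integrable M (\<lambda>\<omega>. Z (grid_round t \<delta> (\<rho>' \<omega>)) \<omega>)"
    using integrable_at_Z[OF stime_grid_round[OF \<rho>(1) t \<delta> N] t]
      integrable_at_Z[OF stime_grid_round[OF \<rho>(2) t \<delta> N] t] .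
  have "(LINT \<omega>:A|M. Z (grid_round t \<delta> (\<rho>' \<omega>)) \<omega>) - (LINT \<omega>:A|M. Z (grid_round t \<delta> (\<rho> \<omega>)) \<omega>) =
      (LINT \<omega>:A|M. Z (grid_round t \<delta> (\<rho>' \<omega>)) \<omega> - Z (grid_round t \<delta> (\<rho> \<omega>)) \<omega>)"
    using iR by (intro set_integral_diff(2)[symmetric] integrable_imp_set_integrable AM)
  also have "\<dots> = (LINT \<omega>|M. (\<Sum>k<N. indicat_real (B k) \<omega> *\<^sub>R (Z (?s (Suc k)) \<omega> - Z (?s k) \<omega>)))"
    unfolding set_lebesgue_integral_def
  proof (rule Bochner_Integration.integral_cong[OF refl])
    fix \<omega> assume w: "\<omega> \<in> space M"
    let ?a = "grid_index t \<delta> (\<rho> \<omega>)" and ?b = "grid_index t \<delta> (\<rho>' \<omega>)"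
    have ab: "?a \<le> ?b" using grid_index_mono[OF \<delta> le[OF w]] .
    have bN: "?b \<le> N" using stime_range[OF \<rho>(2) w] N by (simp add: grid_index_le_iff[OF \<delta>])
    show "indicat_real A \<omega> *\<^sub>R (Z (grid_round t \<delta> (\<rho>' \<omega>)) \<omega> - Z (grid_round t \<delta> (\<rho> \<omega>)) \<omega>) =
        (\<Sum>k<N. indicat_real (B k) \<omega> *\<^sub>R (Z (?s (Suc k)) \<omega> - Z (?s k) \<omega>))"
    proof (cases "\<omega> \<in> A")
      case True
      \<comment> \<open>The cells that contribute are those from the index of \<open>\<rho>\<close>
        up to just before that of \<open>\<rho>'\<close>, so the sum collapses to its two end
        values.\<close>
      have "\<omega> \<in> B k \<longleftrightarrow> k \<in> {?a..<?b}" for k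
        using True w grid_index_le_iff[OF \<delta>, of t "\<rho> \<omega>" k] grid_index_le_iff[OF \<delta>, of t "\<rho>' \<omega>" k]
        by (auto simp: B_def)
      then have "(\<Sum>k<N. indicat_real (B k) \<omega> *\<^sub>R (Z (?s (Suc k)) \<omega> - Z (?s k) \<omega>)) =
          (\<Sum>k<N. if k \<in> {?a..<?b} then Z (?s (Suc k)) \<omega> - Z (?s k) \<omega> else 0)"
        by (intro sum.cong) (auto simp: indicator_def)
      also have "\<dots> = (\<Sum>k\<in>{..<N} \<inter> {?a..<?b}. Z (?s (Suc k)) \<omega> - Z (?s k) \<omega>)"
        by (rule sum.inter_restrict[symmetric]) simp
      also have "{..<N} \<inter> {?a..<?b} = {?a..<?b}" using bN by auto
      also have "(\<Sum>k = ?a..<?b. Z (?s (Suc k)) \<omega> - Z (?s k) \<omega>) = Z (?s ?b) \<omega> - Z (?s ?a) \<omega>"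
        by (rule sum_Suc_diff'[OF ab])
      finally show ?thesis using True by (simp add: grid_round_def)
    next
      case False then show ?thesis by (simp add: B_def)
    qed
  qed
  also have "\<dots> = (\<Sum>k<N. LINT \<omega>:B k|M. Z (?s (Suc k)) \<omega> - Z (?s k) \<omega>)"
    unfolding set_lebesgue_integral_def
    by (rule Bochner_Integration.integral_sum) (use iD in blast)
  also have "\<dots> \<le> 0"
  proof (rule sum_nonpos)
    fix k assume "k \<in> {..<N}"
    then have k: "Suc k \<le> N" "k \<le> N" by auto
    have "?s k \<le> ?s (Suc k)" using \<delta> by simp
    then have "(LINT \<omega>:B k|M. Z (?s (Suc k)) \<omega>) \<le> (LINT \<omega>:B k|M. Z (?s k) \<omega>)"
      by (rule supermartingale[OF s(1) _ sT[OF k(1)] B])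
    moreover have "(LINT \<omega>:B k|M. Z (?s (Suc k)) \<omega> - Z (?s k) \<omega>) =
        (LINT \<omega>:B k|M. Z (?s (Suc k)) \<omega>) - (LINT \<omega>:B k|M. Z (?s k) \<omega>)"
      by (intro set_integral_diff integrable_imp_set_integrable BM iZ k)
    ultimately show "(LINT \<omega>:B k|M. Z (?s (Suc k)) \<omega> - Z (?s k) \<omega>) \<le> 0" by linarith
  qed
  finally show ?thesis by simp
qed

text \<open>The mesh divides \<open>[t, T]\<close> into \<open>Suc n\<close> equal cells, so that
  \<open>T\<close> is always a grid point while the mesh tends to zero; right-continuity then gives
  pathwise convergence.\<close>

lemma grid_round_tendsto:
  assumes \<theta>: "stime t \<theta>" and t: "0 \<le> t" "t < T" and A: "A \<in> sets M"
  shows "(\<lambda>n. LINT \<omega>:A|M. Z (grid_round t ((T - t) / real (Suc n)) (\<theta> \<omega>)) \<omega>)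
      \<longlonglongrightarrow> (LINT \<omega>:A|M. Z (\<theta> \<omega>) \<omega>)"
proof (rule at_time_tendsto[OF regular_Z \<theta> _ t(1) _ A])
  have \<delta>: "0 < (T - t) / real (Suc n)" for n using t by simp
  have N: "t + real (Suc n) * ((T - t) / real (Suc n)) = T" for n by simp
  show st: "stime t (\<lambda>\<omega>. grid_round t ((T - t) / real (Suc n)) (\<theta> \<omega>))" for n
    by (rule stime_grid_round[OF \<theta> t(1) \<delta> N])
  have "AE \<omega> in M. \<forall>s\<in>{0..<T}. ((\<lambda>s. Z s \<omega>) \<longlongrightarrow> Z s \<omega>) (at_right s)"
    using regular_Z unfolding regular_def by blast
  then show "AE \<omega> in M. (\<lambda>n. Z (grid_round t ((T - t) / real (Suc n)) (\<theta> \<omega>)) \<omega>) \<longlonglongrightarrow> Z (\<theta> \<omega>) \<omega>"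
    using AE_space
  proof eventually_elim
    case (elim \<omega>)
    let ?r = "\<lambda>n. grid_round t ((T - t) / real (Suc n)) (\<theta> \<omega>)"
    have ge: "\<theta> \<omega> \<le> ?r n" for n by (rule grid_round_ge[OF \<delta>])
    show ?case
    proof (cases "\<theta> \<omega> < T")
      case True
      have d0: "(\<lambda>n. (T - t) / real (Suc n)) \<longlonglongrightarrow> 0"
        using tendsto_mult_right_zero[OF LIMSEQ_inverse_real_of_nat, of "T - t"]
        by (simp add: divide_inverse)
      have "?r \<longlonglongrightarrow> \<theta> \<omega>"
      proof (rule tendsto_sandwich[OF _ _ tendsto_const])
        show "(\<lambda>n. \<theta> \<omega> + (T - t) / real (Suc n)) \<longlonglongrightarrow> \<theta> \<omega>"
          using tendsto_add[OF tendsto_const d0, of "\<theta> \<omega>"] by simp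
        show "\<forall>\<^sub>F n in sequentially. ?r n \<le> \<theta> \<omega> + (T - t) / real (Suc n)"
          using stime_range[OF \<theta> elim(2)] by (intro always_eventually allI grid_round_le \<delta>) simp
      qed (use ge in auto)
      moreover have "((\<lambda>s. Z s \<omega>) \<longlongrightarrow> Z (\<theta> \<omega>) \<omega>) (at_right (\<theta> \<omega>))"
        using elim(1) True stime_range[OF \<theta> elim(2)] t by auto
      ultimately show ?thesis using tendsto_at_right_sequentially[of "\<lambda>s. Z s \<omega>"] ge by blast
    next
      \<comment> \<open>No right-continuity is available at \<open>T\<close>, but there the rounding
        is exact.\<close>
      case False
      then have "?r n = \<theta> \<omega>" for n
        using ge[of n] stime_range[OF st[of n] elim(2)] by linarith
      then show ?thesis by simp
    qed
  qed
qed

lemma optional_sampling: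
  assumes \<rho>: "stime t \<rho>" "stime t \<rho>'" and le: "\<And>\<omega>. \<omega> \<in> space M \<Longrightarrow> \<rho> \<omega> \<le> \<rho>' \<omega>"
    and t: "0 \<le> t" and A: "A \<in> sets (F (ennreal t))"
  shows "(LINT \<omega>:A|M. Z (\<rho>' \<omega>) \<omega>) \<le> (LINT \<omega>:A|M. Z (\<rho> \<omega>) \<omega>)"
proof (cases "t < T")
  case True
  have AM: "A \<in> sets M" using A sets_F_subset by blast
  show ?thesis
  proof (rule LIMSEQ_le)
    show "\<exists>N. \<forall>n\<ge>N. (LINT \<omega>:A|M. Z (grid_round t ((T - t) / real (Suc n)) (\<rho>' \<omega>)) \<omega>)
        \<le> (LINT \<omega>:A|M. Z (grid_round t ((T - t) / real (Suc n)) (\<rho> \<omega>)) \<omega>)"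
    proof (intro exI[of _ 0] allI impI)
      fix n
      have "0 < (T - t) / real (Suc n)" "t + real (Suc n) * ((T - t) / real (Suc n)) = T"
        using True by auto
      then show "(LINT \<omega>:A|M. Z (grid_round t ((T - t) / real (Suc n)) (\<rho>' \<omega>)) \<omega>)
          \<le> (LINT \<omega>:A|M. Z (grid_round t ((T - t) / real (Suc n)) (\<rho> \<omega>)) \<omega>)"
        using le by (intro optional_sampling_grid[OF \<rho> _ t _ _ A])
    qed
  qed (rule grid_round_tendsto \<rho> t True AM)+
next
  \<comment> \<open>The interval has no room for a grid of positive mesh, and both times can only be
    \<open>T\<close>.\<close>
  case False
  have "\<rho> \<omega> = \<rho>' \<omega>" if "\<omega> \<in> space M" for \<omega>
    using stime_range[OF \<rho>(1) that] stime_range[OF \<rho>(2) that] False by linarith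
  then have "(LINT \<omega>:A|M. Z (\<rho>' \<omega>) \<omega>) = (LINT \<omega>:A|M. Z (\<rho> \<omega>) \<omega>)"
    unfolding set_lebesgue_integral_def by (intro Bochner_Integration.integral_cong) auto
  then show ?thesis by simp
qed

lemma ce_at_stime_le:
  assumes \<theta>: "stime t \<theta>" and t: "t \<in> {0..T}"
  shows "AE \<omega> in M. ce t (\<lambda>\<omega>. Z (\<theta> \<omega>) \<omega>) \<omega> \<le> Z t \<omega>"
proof (rule set_integral_le_imp_AE_le)
  have t': "0 \<le> t" using t by simp
  have i: "integrable M (\<lambda>\<omega>. Z (\<theta> \<omega>) \<omega>)" using integrable_at_Z[OF \<theta> t'] .
  show "integrable M (ce t (\<lambda>\<omega>. Z (\<theta> \<omega>) \<omega>))" by (rule ce_integrable[OF i])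
  show "ce t (\<lambda>\<omega>. Z (\<theta> \<omega>) \<omega>) \<in> borel_measurable (F (ennreal t))" by simp
  show "integrable M (Z t)" by (rule integrable_Z[OF t])
  show "Z t \<in> borel_measurable (F (ennreal t))" by (rule regular_adapted[OF regular_Z t])
  fix A assume A: "A \<in> sets (F (ennreal t))"
  have "(LINT \<omega>:A|M. ce t (\<lambda>\<omega>. Z (\<theta> \<omega>) \<omega>) \<omega>) = (LINT \<omega>:A|M. Z (\<theta> \<omega>) \<omega>)"
    by (rule ce_set_integral[OF i A])
  also have "\<dots> \<le> (LINT \<omega>:A|M. Z t \<omega>)"
    using optional_sampling[OF stime_const[of t t] \<theta> _ t' A] stime_range[OF \<theta>] t by simp
  finally show "(LINT \<omega>:A|M. ce t (\<lambda>\<omega>. Z (\<theta> \<omega>) \<omega>) \<omega>) \<le> (LINT \<omega>:A|M. Z t \<omega>)" .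
qed

text \<open>Stopping at a constant time \<open>s < T\<close> yields the inequality at
  \<open>s\<close> outside a null set depending on \<open>s\<close>. Countably many rational times
  share one null set, and right-continuity of both paths extends the inequality from them.\<close>

lemma AE_H_le_Z: "AE \<omega> in M. \<forall>s\<in>{0..<T}. H s \<omega> \<le> Z s \<omega>"
proof -
  have at: "AE \<omega> in M. H s \<omega> \<le> Z s \<omega>" if s: "s \<in> {0..<T}" for s
  proof -
    interpret sfs: sigma_finite_subalgebra M "F (ennreal s)" by (rule sigma_finite_subalgebra_F)
    have s': "s \<in> {0..T}" using s by simp
    have eq: "G (\<lambda>_. s) = H s" using s by (auto simp: stopped_payoff_def)
    have "AE \<omega> in M. ce s (H s) \<omega> = H s \<omega>"
      using regular_integrable[OF regular_H s'] regular_adapted[OF regular_H s']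
      by (rule sfs.real_cond_exp_F_meas)
    moreover have "AE \<omega> in M. ce s (H s) \<omega> \<le> Z s \<omega>"
      using dominates[OF s', of "\<lambda>_. s"] stime_const[of s s] s unfolding eq by simp
    ultimately show ?thesis by eventually_elim simp
  qed
  then have rat: "AE \<omega> in M. \<forall>q\<in>{0..<T} \<inter> \<rat>. H q \<omega> \<le> Z q \<omega>"
    by (subst AE_ball_countable) (auto intro: countable_Int2 countable_rat)
  have "AE \<omega> in M. \<forall>s\<in>{0..<T}. ((\<lambda>s. Z s \<omega>) \<longlongrightarrow> Z s \<omega>) (at_right s)"
    and "AE \<omega> in M. \<forall>s\<in>{0..<T}. ((\<lambda>s. H s \<omega>) \<longlongrightarrow> H s \<omega>) (at_right s)"
    using regular_Z regular_H unfolding regular_def by blast+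
  with rat show ?thesis
  proof eventually_elim
    case (elim \<omega>)
    show ?case
    proof (rule ballI, rule ccontr)
      fix s assume s: "s \<in> {0..<T}" and "\<not> H s \<omega> \<le> Z s \<omega>"
      then have neg: "Z s \<omega> - H s \<omega> < 0" by simp
      have "((\<lambda>s. Z s \<omega> - H s \<omega>) \<longlongrightarrow> Z s \<omega> - H s \<omega>) (at_right s)"
        using elim s by (intro tendsto_diff) auto
      then have "\<forall>\<^sub>F r in at_right s. Z r \<omega> - H r \<omega> < 0" using neg by (rule order_tendstoD(2))
      then obtain b where b: "b > s" "\<And>r. s < r \<Longrightarrow> r < b \<Longrightarrow> Z r \<omega> - H r \<omega> < 0"
        by (auto simp: eventually_at_right_field)
      obtain q where q: "q \<in> \<rat>" "s < q" "q < min b T"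
        using Rats_dense_in_real[of s "min b T"] b(1) s by auto
      then have "H q \<omega> \<le> Z q \<omega>" using elim s by auto
      then show False using b(2)[of q] q by auto
    qed
  qed
qed

end

section \<open>Optimality of the contact time\<close>

text \<open>Only rational times are inspected, so that the entrance time is a stopping time pointwise;
  right-continuity of the paths makes this harmless.\<close>

definition entrance_time ::
  "real \<Rightarrow> (real \<Rightarrow> 'a \<Rightarrow> real) \<Rightarrow> real \<Rightarrow> real \<Rightarrow> 'a \<Rightarrow> real" where
  "entrance_time T U t e \<omega> = Inf (insert T {q \<in> {t..<T} \<inter> \<rat>. U q \<omega> < e})"

lemma entrance_time_less_iff:
  "t \<le> T \<Longrightarrow> entrance_time T U t e \<omega> < x \<longleftrightarrow> T < x \<or> (\<exists>q\<in>{t..<T} \<inter> \<rat>. U q \<omega> < e \<and> q < x)"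
  unfolding entrance_time_def
  by (subst cInf_less_iff) (auto intro!: bdd_belowI[of _ t])

lemma entrance_time_range: "t \<le> T \<Longrightarrow> t \<le> entrance_time T U t e \<omega> \<and> entrance_time T U t e \<omega> \<le> T"
  unfolding entrance_time_def
  by (auto intro!: cInf_greatest cInf_lower bdd_belowI[of _ t])

lemma entrance_time_antimono:
  assumes "t \<le> T" "e' \<le> e" shows "entrance_time T U t e \<omega> \<le> entrance_time T U t e' \<omega>"
  unfolding entrance_time_def
  by (rule cInf_superset_mono) (use assms in \<open>auto intro!: bdd_belowI[of _ t]\<close>)

text \<open>Right-continuity carries the strict inequality at \<open>s\<close> over to rational
  times arbitrarily close to the right of \<open>s\<close>.\<close>

lemma entrance_time_le:
  assumes right_cont: "((\<lambda>s. U s \<omega>) \<longlongrightarrow> U s \<omega>) (at_right s)" and s: "t \<le> s" "s < T" and U: "U s \<omega> < e"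
  shows "entrance_time T U t e \<omega> \<le> s"
proof (rule ccontr)
  assume "\<not> entrance_time T U t e \<omega> \<le> s"
  then have less: "s < entrance_time T U t e \<omega>" by simp
  obtain b where b: "b > s" "\<And>r. s < r \<Longrightarrow> r < b \<Longrightarrow> U r \<omega> < e"
    using order_tendstoD(2)[OF right_cont U] by (auto simp: eventually_at_right_field)
  obtain q where q: "q \<in> \<rat>" "s < q" "q < min b (entrance_time T U t e \<omega>)"
    using Rats_dense_in_real[of s "min b (entrance_time T U t e \<omega>)"] b(1) less by auto
  then have "q < T" using entrance_time_range[of t T U e \<omega>] s by auto
  then have "entrance_time T U t e \<omega> \<le> q"
    unfolding entrance_time_def
    by (intro cInf_lower) (use q s b in \<open>auto intro!: bdd_belowI[of _ t]\<close>)
  then show False using q by simp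
qed

text \<open>If the value exceeded \<open>e\<close>, it would do so on an interval to the right, yet
  the infimum is attained or approached by rationals with value below \<open>e\<close>. In the limit
  the strict inequality becomes a weak one.\<close>

lemma entrance_time_value:
  assumes right_cont: "((\<lambda>s. U s \<omega>) \<longlongrightarrow> U (entrance_time T U t e \<omega>) \<omega>) (at_right (entrance_time T U t e \<omega>))"
    and t: "t \<le> T" and less: "entrance_time T U t e \<omega> < T"
  shows "U (entrance_time T U t e \<omega>) \<omega> \<le> e"
proof (rule ccontr)
  let ?D = "entrance_time T U t e \<omega>"
  assume "\<not> U ?D \<omega> \<le> e"
  then have gt: "e < U ?D \<omega>" by simp
  obtain b where b: "b > ?D" "\<And>r. ?D < r \<Longrightarrow> r < b \<Longrightarrow> e < U r \<omega>"
    using order_tendstoD(1)[OF right_cont gt] by (auto simp: eventually_at_right_field)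
  have "?D < min b T" using b(1) less by simp
  from iffD1[OF entrance_time_less_iff[OF t] this]
  obtain q where q: "q \<in> {t..<T} \<inter> \<rat>" "U q \<omega> < e" "q < min b T" by auto
  then have "?D \<le> q" unfolding entrance_time_def
    by (intro cInf_lower) (auto intro!: bdd_belowI[of _ t] simp: t)
  then show False using q b(2)[of q] gt by (cases "?D = q") auto
qed

text \<open>Entering strictly before \<open>x\<close> is a countable union of events at rational
  times below \<open>x\<close>. Being at most \<open>s\<close> is the intersection of such events
  with \<open>x\<close> decreasing to \<open>s\<close>, hence known at every later time, and
  right-continuity of the filtration brings it back to \<open>s\<close>.\<close>

lemma (in horizon) stime_entrance_time:
  assumes U: "\<And>s. s \<in> {0..T} \<Longrightarrow> U s \<in> borel_measurable (F (ennreal s))" and t: "t \<in> {0..T}"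
  shows "stime t (entrance_time T U t e)"
proof (rule stimeI)
  show "t \<le> entrance_time T U t e \<omega> \<and> entrance_time T U t e \<omega> \<le> T" for \<omega>
    using t by (intro entrance_time_range) simp
next
  fix s assume s: "t \<le> s" "s < T"
  have "{\<omega>\<in>space M. entrance_time T U t e \<omega> \<le> s} \<in> sets (F v)" if v: "ennreal s < v" for v
  proof -
    \<comment> \<open>The index \<open>v\<close> may be infinite; a real \<open>r\<close> strictly
      between \<open>s\<close> and \<open>v\<close> keeps the thresholds real.\<close>
    obtain w where w: "ennreal s < w" "w < v" using dense[OF v] by blast
    then obtain r where r: "w = ennreal r" "0 \<le> r" by (cases w) auto
    then have sr: "s < r" using w(1) s t by (simp add: ennreal_less_iff)
    have less: "{\<omega>\<in>space M. entrance_time T U t e \<omega> < x} \<in> sets (F (ennreal r))" if x: "x \<le> r" for x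
    proof -
      have "{\<omega>\<in>space M. entrance_time T U t e \<omega> < x} =
          (\<Union>q\<in>{t..<T} \<inter> {..<x} \<inter> \<rat>. {\<omega>\<in>space M. U q \<omega> < e}) \<union> (if T < x then space M else {})"
        using t by (auto simp: entrance_time_less_iff)
      also have "\<dots> \<in> sets (F (ennreal r))"
      proof (intro sets.Un sets.countable_UN'')
        show "countable ({t..<T} \<inter> {..<x} \<inter> \<rat>)" by (simp add: countable_Int2 countable_rat)
        show "(if T < x then space M else {}) \<in> sets (F (ennreal r))"
          using sets.top[of "F (ennreal r)"] by (auto simp: space_F)
        fix q assume q: "q \<in> {t..<T} \<inter> {..<x} \<inter> \<rat>"
        have [measurable]: "U q \<in> borel_measurable (F (ennreal q))" using U q t by auto
        have "{\<omega>\<in>space (F (ennreal q)). U q \<omega> < e} \<in> sets (F (ennreal q))" by measurable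
        then have "{\<omega>\<in>space M. U q \<omega> < e} \<in> sets (F (ennreal q))" by (simp add: space_F)
        moreover have "sets (F (ennreal q)) \<subseteq> sets (F (ennreal r))"
          using q x by (intro sets_F_mono ennreal_leI) auto
        ultimately show "{\<omega>\<in>space M. U q \<omega> < e} \<in> sets (F (ennreal r))" by blast
      qed
      finally show ?thesis .
    qed
    have "{\<omega>\<in>space M. entrance_time T U t e \<omega> \<le> s} =
        (\<Inter>m. {\<omega>\<in>space M. entrance_time T U t e \<omega> < s + (r - s) / real (Suc m)})" (is "?L = ?R")
    proof
      show "?L \<subseteq> ?R"
      proof (intro subsetI INT_I)
        fix \<omega> and m :: nat assume L: "\<omega> \<in> ?L"
        moreover have "0 < (r - s) / real (Suc m)" using sr by simp
        ultimately have "entrance_time T U t e \<omega> < s + (r - s) / real (Suc m)" by simp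
        then show "\<omega> \<in> {\<omega>\<in>space M. entrance_time T U t e \<omega> < s + (r - s) / real (Suc m)}"
          using L by blast
      qed
      show "?R \<subseteq> ?L"
      proof
        fix \<omega> assume w: "\<omega> \<in> ?R"
        have "(\<lambda>m. s + (r - s) * inverse (real (Suc m))) \<longlonglongrightarrow> s + (r - s) * 0"
          by (intro tendsto_intros LIMSEQ_inverse_real_of_nat)
        then have "entrance_time T U t e \<omega> \<le> s + (r - s) * 0"
          by (rule LIMSEQ_le_const) (use w in \<open>auto simp: divide_inverse intro!: less_imp_le\<close>)
        then show "\<omega> \<in> ?L" using w by simp
      qed
    qed
    also have "\<dots> \<in> sets (F (ennreal r))"
    proof (rule sets.countable_INT, safe)
      fix m :: nat
      have "(r - s) / real (Suc m) \<le> (r - s) / 1" using sr by (intro divide_left_mono) auto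
      then show "{\<omega>\<in>space M. entrance_time T U t e \<omega> < s + (r - s) / real (Suc m)} \<in> sets (F (ennreal r))"
        by (intro less) simp
    qed
    finally show ?thesis using sets_F_mono[OF less_imp_le[OF w(2)]] r(1) by auto
  qed
  then show "{\<omega>\<in>space M. entrance_time T U t e \<omega> \<le> s} \<in> sets (F (ennreal s))"
    using right_continuous[of "ennreal s"] by auto
qed

lemma (in horizon) regular_qlc:
  assumes X: "regular X" and \<tau>: "\<And>n. stime t (\<tau>n n)" "stime t \<tau>" and t: "0 \<le> t"
    and lim: "AE \<omega> in M. incseq (\<lambda>n. \<tau>n n \<omega>) \<and> (\<lambda>n. \<tau>n n \<omega>) \<longlonglongrightarrow> \<tau> \<omega>"
  shows "AE \<omega> in M. (\<lambda>n. X (\<tau>n n \<omega>) \<omega>) \<longlonglongrightarrow> X (\<tau> \<omega>) \<omega>"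
proof -
  have "\<tau>n n \<in> stopping_times M F 0 T" for n
    by (intro stime_stopping_times stime_mono[OF \<tau>(1)] t) simp_all
  moreover have "\<tau> \<in> stopping_times M F 0 T"
    by (intro stime_stopping_times stime_mono[OF \<tau>(2)] t) simp_all
  ultimately show ?thesis
    using X lim unfolding regular_def quasi_left_continuous_process_def by blast
qed

context snell_envelope
begin

abbreviation D :: "real \<Rightarrow> nat \<Rightarrow> 'a \<Rightarrow> real" where
  "D t k \<equiv> entrance_time T (\<lambda>s \<omega>. Z s \<omega> - H s \<omega>) t (inverse (real (Suc k)))"

lemma stime_D: "t \<in> {0..T} \<Longrightarrow> stime t (D t k)"
  by (intro stime_entrance_time borel_measurable_diff regular_adapted[OF regular_Z] regular_adapted[OF regular_H])

lemma AE_right_continuous: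
  "AE \<omega> in M. \<forall>s\<in>{0..<T}. ((\<lambda>s. Z s \<omega>) \<longlongrightarrow> Z s \<omega>) (at_right s) \<and> ((\<lambda>s. H s \<omega>) \<longlongrightarrow> H s \<omega>) (at_right s)"
proof -
  have "AE \<omega> in M. \<forall>s\<in>{0..<T}. ((\<lambda>s. Z s \<omega>) \<longlongrightarrow> Z s \<omega>) (at_right s)"
    and "AE \<omega> in M. \<forall>s\<in>{0..<T}. ((\<lambda>s. H s \<omega>) \<longlongrightarrow> H s \<omega>) (at_right s)"
    using regular_Z regular_H unfolding regular_def by blast+
  then show ?thesis by eventually_elim blast
qed

text \<open>For near-optimal \<open>\<theta> n\<close>, \<open>Z - G\<close> is nonnegative and its
  expectation is at most the optimality error, because sampling bounds the expectation of
  \<open>Z\<close> at \<open>\<theta> n\<close> by that of \<open>Z t\<close>. This is the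
  convergence in L1 from which the subsequence is drawn.\<close>

lemma integral_Z_le_D:
  assumes t: "t \<in> {0..T}"
  shows "(LINT \<omega>|M. Z t \<omega>) \<le> (LINT \<omega>|M. Z (D t k \<omega>) \<omega>)"
proof -
  have t': "0 \<le> t" "t \<le> T" using t by auto
  have "\<forall>n. \<exists>\<theta>. stime t \<theta> \<and> (LINT \<omega>|M. Z t \<omega>) \<le> (LINT \<omega>|M. G \<theta> \<omega>) + inverse (real (Suc n))"
    by (intro allI near_optimal[OF t]) simp
  then obtain \<theta> where \<theta>: "\<And>n. stime t (\<theta> n)"
    "\<And>n. (LINT \<omega>|M. Z t \<omega>) \<le> (LINT \<omega>|M. G (\<theta> n) \<omega>) + inverse (real (Suc n))" by metis
  have iZ: "integrable M (\<lambda>\<omega>. Z (\<theta> n \<omega>) \<omega>)" and iG: "integrable M (G (\<theta> n))" for n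
    using integrable_at_Z[OF \<theta>(1) t'(1)] integrable_payoff[OF \<theta>(1) t'(1)] .
  have nonneg: "AE \<omega> in M. 0 \<le> Z (\<theta> n \<omega>) \<omega> - G (\<theta> n) \<omega>" for n
    using AE_H_le_Z AE_space
  proof eventually_elim
    case (elim \<omega>)
    show ?case using elim(1) stime_range[OF \<theta>(1)[of n] elim(2)] t' by (auto simp: stopped_payoff_def)
  qed
  have samp: "(LINT \<omega>|M. Z (\<rho>' \<omega>) \<omega>) \<le> (LINT \<omega>|M. Z (\<rho> \<omega>) \<omega>)"
    if "stime t \<rho>" "stime t \<rho>'" "\<And>\<omega>. \<omega> \<in> space M \<Longrightarrow> \<rho> \<omega> \<le> \<rho>' \<omega>" for \<rho> \<rho>'
  proof -
    have "space M \<in> sets (F (ennreal t))" using sets.top[of "F (ennreal t)"] by (simp add: space_F)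
    from optional_sampling[OF that t'(1) this] show ?thesis
      by (simp add: set_integral_space integrable_at_Z[OF that(1) t'(1)] integrable_at_Z[OF that(2) t'(1)])
  qed
  have "(LINT \<omega>|M. norm (Z (\<theta> n \<omega>) \<omega> - G (\<theta> n) \<omega>)) \<le> inverse (real (Suc n))" for n
  proof -
    have "(LINT \<omega>|M. norm (Z (\<theta> n \<omega>) \<omega> - G (\<theta> n) \<omega>)) = (LINT \<omega>|M. Z (\<theta> n \<omega>) \<omega> - G (\<theta> n) \<omega>)"
      using iZ[of n] iG[of n] by (intro integral_cong_AE) (use nonneg[of n] in \<open>auto elim!: eventually_mono\<close>)
    also have "\<dots> = (LINT \<omega>|M. Z (\<theta> n \<omega>) \<omega>) - (LINT \<omega>|M. G (\<theta> n) \<omega>)"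
      by (rule Bochner_Integration.integral_diff[OF iZ iG])
    also have "(LINT \<omega>|M. Z (\<theta> n \<omega>) \<omega>) \<le> (LINT \<omega>|M. Z t \<omega>)"
      using samp[OF stime_const[of t t] \<theta>(1)] stime_range[OF \<theta>(1)] t' by simp
    finally show ?thesis using \<theta>(2)[of n] by simp
  qed
  then have "(\<lambda>n. LINT \<omega>|M. norm (Z (\<theta> n \<omega>) \<omega> - G (\<theta> n) \<omega>)) \<longlonglongrightarrow> 0"
    by (intro tendsto_sandwich[OF _ _ tendsto_const LIMSEQ_inverse_real_of_nat]) auto
  then obtain r :: "nat \<Rightarrow> nat" where r: "strict_mono r"
    "AE \<omega> in M. (\<lambda>n. Z (\<theta> (r n) \<omega>) \<omega> - G (\<theta> (r n)) \<omega>) \<longlonglongrightarrow> 0"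
    using tendsto_L1_AE_subseq[of M "\<lambda>n \<omega>. Z (\<theta> n \<omega>) \<omega> - G (\<theta> n) \<omega>"] iZ iG by auto
  \<comment> \<open>The minimum precedes \<open>\<theta> (r n)\<close>, so sampling keeps its
    expectation of \<open>Z\<close> nearly as large as that of \<open>Z t\<close>; and it eventually
    equals \<open>D t k\<close>, so this bound survives in the limit.\<close>
  define \<kappa> where "\<kappa> n \<omega> = min (D t k \<omega>) (\<theta> (r n) \<omega>)" for n \<omega>
  have \<kappa>: "stime t (\<kappa> n)" for n
    unfolding \<kappa>_def[abs_def] by (intro stime_min stime_D[OF t] \<theta>(1) t'(1))
  have "AE \<omega> in M. (\<lambda>n. Z (\<kappa> n \<omega>) \<omega>) \<longlonglongrightarrow> Z (D t k \<omega>) \<omega>"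
    using r(2) AE_right_continuous AE_space
  proof eventually_elim
    case (elim \<omega>)
    have "\<forall>\<^sub>F n in sequentially. Z (\<theta> (r n) \<omega>) \<omega> - G (\<theta> (r n)) \<omega> < inverse (real (Suc k))"
      by (rule order_tendstoD(2)[OF elim(1)]) simp
    then have "\<forall>\<^sub>F n in sequentially. Z (\<kappa> n \<omega>) \<omega> = Z (D t k \<omega>) \<omega>"
    proof eventually_elim
      case (elim n)
      note less = elim
      have "D t k \<omega> \<le> \<theta> (r n) \<omega>"
      proof (cases "\<theta> (r n) \<omega> < T")
        case True
        have range: "t \<le> \<theta> (r n) \<omega>" using stime_range[OF \<theta>(1) \<open>\<omega> \<in> space M\<close>] by blast
        have "((\<lambda>s. Z s \<omega> - H s \<omega>) \<longlongrightarrow> Z (\<theta> (r n) \<omega>) \<omega> - H (\<theta> (r n) \<omega>) \<omega>) (at_right (\<theta> (r n) \<omega>))"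
          using \<open>\<forall>s\<in>{0..<T}. _\<close> True range t' by (intro tendsto_diff) auto
        moreover have "Z (\<theta> (r n) \<omega>) \<omega> - H (\<theta> (r n) \<omega>) \<omega> < inverse (real (Suc k))"
          using less True by (simp add: stopped_payoff_def)
        ultimately show ?thesis
          using range True by (intro entrance_time_le)
      next
        \<comment> \<open>At \<open>T\<close> the vanishing gap says nothing about the obstacle,
          since the payoff there is \<open>Z T\<close>; but \<open>D t k\<close> never exceeds
          \<open>T\<close>.\<close>
        case False
        then show ?thesis using entrance_time_range[OF t'(2)] by (meson not_less order_trans)
      qed
      then show ?case by (simp add: \<kappa>_def)
    qed
    then show ?case by (rule tendsto_eventually)
  qed
  from at_time_tendsto[OF regular_Z stime_D[OF t] \<kappa> t'(1) this sets.top]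
  have lim: "(\<lambda>n. LINT \<omega>|M. Z (\<kappa> n \<omega>) \<omega>) \<longlonglongrightarrow> (LINT \<omega>|M. Z (D t k \<omega>) \<omega>)"
    by (simp add: set_integral_space integrable_at_Z[OF \<kappa> t'(1)] integrable_at_Z[OF stime_D[OF t] t'(1)]
      del: of_nat_Suc)
  have low: "(LINT \<omega>|M. Z t \<omega>) - inverse (real (Suc (r n))) \<le> (LINT \<omega>|M. Z (\<kappa> n \<omega>) \<omega>)" for n
  proof -
    have "(LINT \<omega>|M. Z t \<omega>) - inverse (real (Suc (r n))) \<le> (LINT \<omega>|M. G (\<theta> (r n)) \<omega>)"
      using \<theta>(2)[of "r n"] by simp
    also have "\<dots> \<le> (LINT \<omega>|M. Z (\<theta> (r n) \<omega>) \<omega>)"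
      using nonneg[of "r n"] by (intro integral_mono_AE iG iZ) auto
    also have "\<dots> \<le> (LINT \<omega>|M. Z (\<kappa> n \<omega>) \<omega>)"
      by (rule samp[OF \<kappa> \<theta>(1)]) (simp add: \<kappa>_def)
    finally show ?thesis .
  qed
  have "(\<lambda>n. (LINT \<omega>|M. Z t \<omega>) - inverse (real (Suc (r n)))) \<longlonglongrightarrow> (LINT \<omega>|M. Z t \<omega>) - 0"
    by (intro tendsto_diff tendsto_const LIMSEQ_subseq_LIMSEQ[OF LIMSEQ_inverse_real_of_nat r(1), unfolded o_def])
  then show ?thesis using LIMSEQ_le[OF _ lim] low by auto
qed

text \<open>With \<open>\<kappa>\<close> the supremum of the \<open>D t k\<close>, the gap at
  \<open>D t k\<close> is at most \<open>1 / (k + 1)\<close>, so before \<open>T\<close> it vanishes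
  at \<open>\<kappa>\<close> and contact occurs no later. Conversely a contact at \<open>s\<close>
  has gap zero, below every tolerance, so no \<open>D t k\<close> lies beyond
  \<open>s\<close>.\<close>

lemma contact_time:
  assumes t: "t \<in> {0..T}"
  shows "\<exists>\<kappa>. stime t \<kappa> \<and> (AE \<omega> in M. first_contact_time T Z H t \<omega> = \<kappa> \<omega>) \<and>
    (AE \<omega> in M. \<kappa> \<omega> < T \<longrightarrow> Z (\<kappa> \<omega>) \<omega> = H (\<kappa> \<omega>) \<omega>) \<and>
    (LINT \<omega>|M. Z t \<omega>) \<le> (LINT \<omega>|M. Z (\<kappa> \<omega>) \<omega>)"
proof -
  have t': "0 \<le> t" "t \<le> T" using t by auto
  define \<kappa> where "\<kappa> \<omega> = (SUP k. D t k \<omega>)" for \<omega>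
  have \<kappa>: "stime t \<kappa>" unfolding \<kappa>_def[abs_def] by (intro stime_SUP stime_D[OF t] t'(1))
  have inc: "incseq (\<lambda>k. D t k \<omega>)" for \<omega>
    by (intro incseq_SucI entrance_time_antimono t'(2) le_imp_inverse_le) auto
  have bdd: "bdd_above (range (\<lambda>k. D t k \<omega>))" for \<omega>
  proof (rule bdd_aboveI[of _ T])
    show "x \<le> T" if "x \<in> range (\<lambda>k. D t k \<omega>)" for x
      using that by (elim rangeE) (simp only: conjunct2[OF entrance_time_range[OF t'(2)]])
  qed
  have lim: "(\<lambda>k. D t k \<omega>) \<longlonglongrightarrow> \<kappa> \<omega>" for \<omega>
    unfolding \<kappa>_def by (rule LIMSEQ_incseq_SUP[OF bdd inc])
  have D_le: "D t k \<omega> \<le> \<kappa> \<omega>" for k \<omega> unfolding \<kappa>_def by (rule cSUP_upper[OF _ bdd]) simp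
  have qlc: "AE \<omega> in M. (\<lambda>k. X (D t k \<omega>) \<omega>) \<longlonglongrightarrow> X (\<kappa> \<omega>) \<omega>" if "regular X" for X
    by (rule regular_qlc[OF that stime_D[OF t] \<kappa> t'(1)]) (use inc lim in auto)
  have contact: "AE \<omega> in M. \<kappa> \<omega> < T \<longrightarrow> Z (\<kappa> \<omega>) \<omega> = H (\<kappa> \<omega>) \<omega>"
    using qlc[OF regular_Z] qlc[OF regular_H] AE_right_continuous AE_H_le_Z
  proof eventually_elim
    case (elim \<omega>)
    show ?case
    proof
      assume less: "\<kappa> \<omega> < T"
      have "(\<lambda>k. Z (D t k \<omega>) \<omega> - H (D t k \<omega>) \<omega>) \<longlonglongrightarrow> Z (\<kappa> \<omega>) \<omega> - H (\<kappa> \<omega>) \<omega>"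
        by (rule tendsto_diff[OF elim(1,2)])
      moreover have "Z (D t k \<omega>) \<omega> - H (D t k \<omega>) \<omega> \<le> inverse (real (Suc k))" for k
      proof -
        have "D t k \<omega> < T" using D_le less by (rule le_less_trans)
        moreover have "0 \<le> D t k \<omega>" using entrance_time_range[OF t'(2)] t'(1) by (meson order_trans)
        ultimately show ?thesis
          using elim(3) by (intro entrance_time_value[where U="\<lambda>s \<omega>. Z s \<omega> - H s \<omega>"] tendsto_diff t'(2)) auto
      qed
      ultimately have "Z (\<kappa> \<omega>) \<omega> - H (\<kappa> \<omega>) \<omega> \<le> 0"
        by (intro LIMSEQ_le[OF _ LIMSEQ_inverse_real_of_nat]) auto
      moreover have "0 \<le> \<kappa> \<omega>" using D_le[of 0 \<omega>] entrance_time_range[OF t'(2)] t'(1) by (meson order_trans)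
      ultimately show "Z (\<kappa> \<omega>) \<omega> = H (\<kappa> \<omega>) \<omega>" using elim(4) less by force
    qed
  qed
  have "AE \<omega> in M. first_contact_time T Z H t \<omega> = \<kappa> \<omega>"
    using contact AE_right_continuous AE_space
  proof eventually_elim
    case (elim \<omega>)
    have range: "t \<le> \<kappa> \<omega>" "\<kappa> \<omega> \<le> T" using stime_range[OF \<kappa> elim(3)] by auto
    have "\<kappa> \<omega> \<le> s" if s: "s \<in> {t..T}" "Z s \<omega> = H s \<omega>" for s
    proof (cases "s < T")
      case True
      have "((\<lambda>s. Z s \<omega>) \<longlongrightarrow> Z s \<omega>) (at_right s)" "((\<lambda>s. H s \<omega>) \<longlongrightarrow> H s \<omega>) (at_right s)"
        using elim(2) s(1) t' True by auto
      then have "D t k \<omega> \<le> s" for k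
        using s True by (intro entrance_time_le[where U="\<lambda>s \<omega>. Z s \<omega> - H s \<omega>"] tendsto_diff) auto
      then show ?thesis by (intro LIMSEQ_le_const2[OF lim]) auto
    qed (use s range in auto)
    then have "\<kappa> \<omega> \<le> first_contact_time T Z H t \<omega>"
      unfolding first_contact_time_def using range by (intro cInf_greatest) auto
    moreover have "\<kappa> \<omega> = T \<or> Z (\<kappa> \<omega>) \<omega> = H (\<kappa> \<omega>) \<omega>" using elim(1) range by linarith
    then have "first_contact_time T Z H t \<omega> \<le> \<kappa> \<omega>"
      unfolding first_contact_time_def using range t' by (intro cInf_lower) (auto intro!: bdd_belowI[of _ t])
    ultimately show ?case by simp
  qed
  moreover have "(LINT \<omega>|M. Z t \<omega>) \<le> (LINT \<omega>|M. Z (\<kappa> \<omega>) \<omega>)"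
  proof -
    have "(\<lambda>k. LINT \<omega>|M. Z (D t k \<omega>) \<omega>) \<longlonglongrightarrow> (LINT \<omega>|M. Z (\<kappa> \<omega>) \<omega>)"
      using at_time_tendsto[OF regular_Z \<kappa> stime_D[OF t] t'(1) qlc[OF regular_Z] sets.top]
      by (simp add: set_integral_space integrable_at_Z[OF \<kappa> t'(1)] integrable_at_Z[OF stime_D[OF t] t'(1)]
      del: of_nat_Suc)
    then show ?thesis by (rule LIMSEQ_le_const) (use integral_Z_le_D[OF t] in auto)
  qed
  ultimately show ?thesis using \<kappa> contact by blast
qed

text \<open>Sampling sandwiches the expectation at \<open>\<theta>\<close> between those at
  \<open>\<kappa>\<close> and at \<open>t\<close>, which the assumption on \<open>\<kappa>\<close>
  forces together. The nonnegative defect in the supermartingale inequality then has integral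
  zero.\<close>

lemma ce_at_stime_before_contact:
  assumes \<kappa>: "stime t \<kappa>" "(LINT \<omega>|M. Z t \<omega>) \<le> (LINT \<omega>|M. Z (\<kappa> \<omega>) \<omega>)"
    and \<theta>: "stime t \<theta>" and le: "\<And>\<omega>. \<omega> \<in> space M \<Longrightarrow> \<theta> \<omega> \<le> \<kappa> \<omega>" and t: "t \<in> {0..T}"
  shows "AE \<omega> in M. ce t (\<lambda>\<omega>. Z (\<theta> \<omega>) \<omega>) \<omega> = Z t \<omega>"
proof -
  have t': "0 \<le> t" using t by simp
  have i: "integrable M (\<lambda>\<omega>. Z (\<theta> \<omega>) \<omega>)" using integrable_at_Z[OF \<theta> t'] .
  have "space M \<in> sets (F (ennreal t))" using sets.top[of "F (ennreal t)"] by (simp add: space_F)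
  from optional_sampling[OF \<theta> \<kappa>(1) le t' this]
  have "(LINT \<omega>|M. Z (\<kappa> \<omega>) \<omega>) \<le> (LINT \<omega>|M. Z (\<theta> \<omega>) \<omega>)"
    by (simp add: set_integral_space i integrable_at_Z[OF \<kappa>(1) t'])
  moreover have iD: "integrable M (\<lambda>\<omega>. Z t \<omega> - ce t (\<lambda>\<omega>. Z (\<theta> \<omega>) \<omega>) \<omega>)"
    by (intro Bochner_Integration.integrable_diff integrable_Z[OF t] ce_integrable[OF i])
  moreover have "(LINT \<omega>|M. Z t \<omega> - ce t (\<lambda>\<omega>. Z (\<theta> \<omega>) \<omega>) \<omega>) = (LINT \<omega>|M. Z t \<omega>) - (LINT \<omega>|M. Z (\<theta> \<omega>) \<omega>)"
    using integrable_Z[OF t] ce_integrable[OF i] ce_integral[OF i, of t] by simp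
  ultimately have "AE \<omega> in M. Z t \<omega> - ce t (\<lambda>\<omega>. Z (\<theta> \<omega>) \<omega>) \<omega> = 0"
    using \<kappa>(2) ce_at_stime_le[OF \<theta> t] by (intro AE_eq_0_if_integral_nonpos[OF iD]) auto
  then show ?thesis by eventually_elim simp
qed

end

section \<open>Integral processes and the spaces of the statement\<close>

text \<open>The closed intervals overlap at \<open>s\<close>; additivity is taken from the gauge
  integral, with which all three Lebesgue integrals agree.\<close>

lemma set_lborel_integral_diff:
  fixes f :: "real \<Rightarrow> real"
  assumes f: "set_integrable lborel {a..b} f" and s: "a \<le> s" "s \<le> r" "r \<le> b"
  shows "(LBINT u:{s..r}. f u) = (LBINT u:{a..r}. f u) - (LBINT u:{a..s}. f u)"
proof -
  have sub: "set_integrable lborel {a..r} f" "set_integrable lborel {a..s} f" "set_integrable lborel {s..r} f"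
    using s by (auto intro!: set_integrable_subset[OF f])
  have "integral {a..s} f + integral {s..r} f = integral {a..r} f"
    by (rule Henstock_Kurzweil_Integration.integral_combine[OF s(1,2)])
      (rule set_borel_integral_eq_integral(1)[OF sub(1)])
  then show ?thesis by (simp add: set_borel_integral_eq_integral(2)[OF sub(1)]
      set_borel_integral_eq_integral(2)[OF sub(2)] set_borel_integral_eq_integral(2)[OF sub(3)])
qed

lemma continuous_on_set_lborel_integral:
  fixes f :: "real \<Rightarrow> real"
  assumes f: "set_integrable lborel {a..b} f"
  shows "continuous_on {a..b} (\<lambda>s. LBINT u:{a..s}. f u)"
proof -
  have "continuous_on {a..b} (\<lambda>s. integral {a..s} f)"
    by (intro indefinite_integral_continuous_1 set_borel_integral_eq_integral(1)[OF f])
  moreover have "integral {a..s} f = (LBINT u:{a..s}. f u)" if "s \<in> {a..b}" for s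
    using that by (intro set_borel_integral_eq_integral(2)[symmetric] set_integrable_subset[OF f]) auto
  ultimately show ?thesis by (rule continuous_on_eq)
qed

text \<open>On a finite measure this crude bound is enough to pass from square integrability to
  integrability, and it covers infinite values.\<close>

lemma ennreal_le_one_plus_square: "(x::ennreal) \<le> 1 + x\<^sup>2"
proof (cases "x \<le> 1")
  case True then show ?thesis by (metis add_increasing2 zero_le)
next
  case False
  then have "1 * x \<le> x * x" by (intro mult_right_mono) auto
  then show ?thesis by (metis add_increasing mult_1 power2_eq_square zero_le)
qed

context horizon
begin

text \<open>The bound is required only where \<open>P\<close> is finite, which is almost everywhere,
  so the default value of \<open>enn2real\<close> at infinity is confined to a null set.\<close>

lemma dominatedI:
  fixes P :: "'a \<Rightarrow> ennreal"
  assumes P: "P \<in> borel_measurable M" "(\<integral>\<^sup>+\<omega>. P \<omega> \<partial>M) < \<infinity>"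
    and le: "AE \<omega> in M. P \<omega> < \<infinity> \<longrightarrow> (\<forall>s\<in>{0..T}. ennreal \<bar>X s \<omega>\<bar> \<le> P \<omega>)"
  shows "dominated X"
  unfolding dominated_def
proof (intro exI conjI)
  have fin: "AE \<omega> in M. P \<omega> \<noteq> \<infinity>" using P by (intro nn_integral_PInf_AE) auto
  show "integrable M (\<lambda>\<omega>. enn2real (P \<omega>))"
  proof (rule integrableI_bounded)
    have "(\<integral>\<^sup>+\<omega>. ennreal (norm (enn2real (P \<omega>))) \<partial>M) \<le> (\<integral>\<^sup>+\<omega>. P \<omega> \<partial>M)"
      by (rule nn_integral_mono) (simp add: ennreal_enn2real_if)
    then show "(\<integral>\<^sup>+\<omega>. ennreal (norm (enn2real (P \<omega>))) \<partial>M) < \<infinity>" using P(2) by (rule le_less_trans)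
  qed (use P(1) in measurable)
  show "AE \<omega> in M. \<forall>s\<in>{0..T}. \<bar>X s \<omega>\<bar> \<le> enn2real (P \<omega>)"
    using fin le
  proof eventually_elim
    case (elim \<omega>)
    then have fin: "P \<omega> < \<infinity>" by (simp add: top.not_eq_extremum)
    then have "P \<omega> = ennreal (enn2real (P \<omega>))" by (simp add: ennreal_enn2real_if)
    moreover have "\<forall>s\<in>{0..T}. ennreal \<bar>X s \<omega>\<bar> \<le> P \<omega>" using elim(2) fin by blast
    ultimately show ?case by (metis ennreal_le_iff enn2real_nonneg)
  qed
qed

lemma nn_integral_finite_if_square:
  assumes "P \<in> borel_measurable M" "(\<integral>\<^sup>+\<omega>. (P \<omega>)\<^sup>2 \<partial>M) < \<infinity>"
  shows "(\<integral>\<^sup>+\<omega>. P \<omega> \<partial>M) < \<infinity>"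
proof -
  note [measurable] = assms(1)
  have "(\<integral>\<^sup>+\<omega>. P \<omega> \<partial>M) \<le> (\<integral>\<^sup>+\<omega>. 1 + (P \<omega>)\<^sup>2 \<partial>M)"
    by (intro nn_integral_mono ennreal_le_one_plus_square)
  also have "\<dots> = (\<integral>\<^sup>+\<omega>. 1 \<partial>M) + (\<integral>\<^sup>+\<omega>. (P \<omega>)\<^sup>2 \<partial>M)" by (rule nn_integral_add) measurable
  also have "\<dots> < \<infinity>" using assms(2) by (simp add: emeasure_space_1)
  finally show ?thesis .
qed

lemma S2_Q_regular:
  assumes X: "X \<in> S2_space M F T \<inter> Q_space M F T" shows "regular X"
  unfolding regular_def
proof (intro conjI)
  show prog: "progressively_measurable F T X" using X by (simp add: S2_space_def)
  show "quasi_left_continuous_process M F T X" using X by (simp add: Q_space_def)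
  have cadlag: "AE \<omega> in M. cadlag_on T (\<lambda>t. X t \<omega>)" using X by (simp add: Q_space_def)
  then show right: "AE \<omega> in M. \<forall>s\<in>{0..<T}. ((\<lambda>s. X s \<omega>) \<longlongrightarrow> X s \<omega>) (at_right s)"
    by eventually_elim (simp add: cadlag_on_def)
  \<comment> \<open>A countable index set makes the supremum measurable. Rational times suffice
    before \<open>T\<close> by right-continuity; \<open>T\<close> has to be added because it cannot
    be approached from the right.\<close>
  define Q where "Q = insert T ({0..T} \<inter> \<rat>)"
  have Q: "countable Q" "Q \<subseteq> {0..T}" "T \<in> Q"
    unfolding Q_def using T_pos by (auto simp: countable_Int2 countable_rat)
  define P where "P \<omega> = (SUP q\<in>Q. ennreal \<bar>X q \<omega>\<bar>)" for \<omega>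
  have meas: "X q \<in> borel_measurable M" if "q \<in> Q" for q
    using progressively_measurable_adapted[OF prog] Q(2) that measurable_F_imp_M by blast
  have P: "P \<in> borel_measurable M"
    unfolding P_def[abs_def] using meas by (intro borel_measurable_SUP Q(1)) measurable
  show "dominated X"
  proof (rule dominatedI[OF P nn_integral_finite_if_square[OF P]])
    \<comment> \<open>Monotonicity of \<open>nn_integral\<close> holds without measurability of the
      uncountable supremum on the right.\<close>
    have "(\<integral>\<^sup>+\<omega>. (P \<omega>)\<^sup>2 \<partial>M) \<le> (\<integral>\<^sup>+\<omega>. (SUP t\<in>{0..T}. ennreal \<bar>X t \<omega>\<bar>)\<^sup>2 \<partial>M)"
      unfolding P_def using Q(2) by (intro nn_integral_mono power_mono SUP_subset_mono) auto
    then show "(\<integral>\<^sup>+\<omega>. (P \<omega>)\<^sup>2 \<partial>M) < \<infinity>"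
      using X by (auto simp: S2_space_def)
    show "AE \<omega> in M. P \<omega> < \<infinity> \<longrightarrow> (\<forall>s\<in>{0..T}. ennreal \<bar>X s \<omega>\<bar> \<le> P \<omega>)"
      using right
    proof eventually_elim
      case (elim \<omega>)
      have PQ: "ennreal \<bar>X q \<omega>\<bar> \<le> P \<omega>" if "q \<in> Q" for q unfolding P_def by (rule SUP_upper[OF that])
      have "ennreal \<bar>X s \<omega>\<bar> \<le> P \<omega>" if s: "s \<in> {0..T}" and fin: "P \<omega> < \<infinity>" for s
      proof (cases "s = T")
        case False
        then have s': "s \<in> {0..<T}" using s by auto
        define p where "p = enn2real (P \<omega>)"
        have p: "P \<omega> = ennreal p" "0 \<le> p" using fin by (auto simp: p_def ennreal_enn2real_if)
        have "\<bar>X s \<omega>\<bar> \<le> p"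
        proof (rule ccontr)
          assume "\<not> \<bar>X s \<omega>\<bar> \<le> p"
          then have gt: "p < \<bar>X s \<omega>\<bar>" by simp
          have "((\<lambda>s. \<bar>X s \<omega>\<bar>) \<longlongrightarrow> \<bar>X s \<omega>\<bar>) (at_right s)"
            using elim s' by (intro tendsto_rabs) auto
          from order_tendstoD(1)[OF this gt]
          obtain b where b: "b > s" "\<And>r. s < r \<Longrightarrow> r < b \<Longrightarrow> p < \<bar>X r \<omega>\<bar>"
            by (auto simp: eventually_at_right_field)
          obtain q where q: "q \<in> \<rat>" "s < q" "q < min b T"
            using Rats_dense_in_real[of s "min b T"] b(1) s' by auto
          have "q \<in> Q" unfolding Q_def using q s' by auto
          then have "\<bar>X q \<omega>\<bar> \<le> p" using PQ[of q] p by (simp add: ennreal_le_iff)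
          then show False using b(2)[of q] q by auto
        qed
        then show ?thesis using p by (simp add: ennreal_leI)
      qed (use PQ Q(3) in auto)
      then show ?case by blast
    qed
  qed
qed

section \<open>Stability under sums and differences\<close>

lemma regular_add_diff:
  assumes X: "regular X" and Y: "regular Y"
  shows regular_add: "regular (\<lambda>s \<omega>. X s \<omega> + Y s \<omega>)"
    and regular_diff: "regular (\<lambda>s \<omega>. X s \<omega> - Y s \<omega>)"
proof -
  have pm: "(\<lambda>(s, \<omega>). W s \<omega>) \<in> borel_measurable (restrict_space borel {0..t} \<Otimes>\<^sub>M F (ennreal t))"
    if "regular W" "t \<in> {0..T}" for W t
    using that unfolding regular_def progressively_measurable_def by blast
  have rc: "AE \<omega> in M. \<forall>s\<in>{0..<T}. ((\<lambda>s. X s \<omega>) \<longlongrightarrow> X s \<omega>) (at_right s) \<and> ((\<lambda>s. Y s \<omega>) \<longlongrightarrow> Y s \<omega>) (at_right s)"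
  proof -
    have "AE \<omega> in M. \<forall>s\<in>{0..<T}. ((\<lambda>s. X s \<omega>) \<longlongrightarrow> X s \<omega>) (at_right s)"
      "AE \<omega> in M. \<forall>s\<in>{0..<T}. ((\<lambda>s. Y s \<omega>) \<longlongrightarrow> Y s \<omega>) (at_right s)"
      using X Y unfolding regular_def by blast+
    then show ?thesis by eventually_elim blast
  qed
  have qlc: "AE \<omega> in M. (\<lambda>n. X (\<tau>n n \<omega>) \<omega>) \<longlonglongrightarrow> X (\<tau> \<omega>) \<omega> \<and> (\<lambda>n. Y (\<tau>n n \<omega>) \<omega>) \<longlonglongrightarrow> Y (\<tau> \<omega>) \<omega>"
    if "\<forall>n. \<tau>n n \<in> stopping_times M F 0 T" "\<tau> \<in> stopping_times M F 0 T"
      "AE \<omega> in M. incseq (\<lambda>n. \<tau>n n \<omega>) \<and> (\<lambda>n. \<tau>n n \<omega>) \<longlonglongrightarrow> \<tau> \<omega>" for \<tau>n :: "nat \<Rightarrow> 'a \<Rightarrow> real" and \<tau>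
  proof -
    have "AE \<omega> in M. (\<lambda>n. X (\<tau>n n \<omega>) \<omega>) \<longlonglongrightarrow> X (\<tau> \<omega>) \<omega>"
      using X that unfolding regular_def quasi_left_continuous_process_def by blast
    moreover have "AE \<omega> in M. (\<lambda>n. Y (\<tau>n n \<omega>) \<omega>) \<longlonglongrightarrow> Y (\<tau> \<omega>) \<omega>"
      using Y that unfolding regular_def quasi_left_continuous_process_def by blast
    ultimately show ?thesis by eventually_elim blast
  qed
  obtain B where B: "integrable M B" "AE \<omega> in M. \<forall>s\<in>{0..T}. \<bar>X s \<omega>\<bar> \<le> B \<omega>"
    using X by (rule regular_bound)
  obtain C where C: "integrable M C" "AE \<omega> in M. \<forall>s\<in>{0..T}. \<bar>Y s \<omega>\<bar> \<le> C \<omega>"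
    using Y by (rule regular_bound)
  have dom: "AE \<omega> in M. \<forall>s\<in>{0..T}. \<bar>X s \<omega> + Y s \<omega>\<bar> \<le> B \<omega> + C \<omega> \<and> \<bar>X s \<omega> - Y s \<omega>\<bar> \<le> B \<omega> + C \<omega>"
    using B(2) C(2)
  proof eventually_elim
    case (elim \<omega>)
    show ?case
    proof
      fix s assume "s \<in> {0..T}"
      then have "\<bar>X s \<omega>\<bar> \<le> B \<omega>" "\<bar>Y s \<omega>\<bar> \<le> C \<omega>" using elim by auto
      then show "\<bar>X s \<omega> + Y s \<omega>\<bar> \<le> B \<omega> + C \<omega> \<and> \<bar>X s \<omega> - Y s \<omega>\<bar> \<le> B \<omega> + C \<omega>" by linarith
    qed
  qed
  show "regular (\<lambda>s \<omega>. X s \<omega> + Y s \<omega>)"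
    unfolding regular_def
  proof (intro conjI)
    show "progressively_measurable F T (\<lambda>s \<omega>. X s \<omega> + Y s \<omega>)"
      unfolding progressively_measurable_def
    proof
      fix t assume t: "t \<in> {0..T}"
      show "(\<lambda>(s, \<omega>). X s \<omega> + Y s \<omega>) \<in> borel_measurable (restrict_space borel {0..t} \<Otimes>\<^sub>M F (ennreal t))"
        using borel_measurable_add[OF pm[OF X t] pm[OF Y t]] by (simp add: split_beta')
    qed
    show "dominated (\<lambda>s \<omega>. X s \<omega> + Y s \<omega>)" unfolding dominated_def
      by (rule exI[of _ "\<lambda>\<omega>. B \<omega> + C \<omega>"]) (use B(1) C(1) dom in \<open>auto elim: eventually_mono\<close>)
    show "AE \<omega> in M. \<forall>s\<in>{0..<T}. ((\<lambda>s. X s \<omega> + Y s \<omega>) \<longlongrightarrow> X s \<omega> + Y s \<omega>) (at_right s)"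
      using rc by eventually_elim (auto intro: tendsto_add)
    show "quasi_left_continuous_process M F T (\<lambda>s \<omega>. X s \<omega> + Y s \<omega>)"
      unfolding quasi_left_continuous_process_def
    proof (intro allI impI)
      fix \<tau>n :: "nat \<Rightarrow> 'a \<Rightarrow> real" and \<tau>
      assume *: "\<forall>n. \<tau>n n \<in> stopping_times M F 0 T" "\<tau> \<in> stopping_times M F 0 T"
        "AE \<omega> in M. incseq (\<lambda>n. \<tau>n n \<omega>) \<and> (\<lambda>n. \<tau>n n \<omega>) \<longlonglongrightarrow> \<tau> \<omega>"
      show "AE \<omega> in M. (\<lambda>n. X (\<tau>n n \<omega>) \<omega> + Y (\<tau>n n \<omega>) \<omega>) \<longlonglongrightarrow> X (\<tau> \<omega>) \<omega> + Y (\<tau> \<omega>) \<omega>"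
        using qlc[OF *] by eventually_elim (auto intro: tendsto_add)
    qed
  qed
  show "regular (\<lambda>s \<omega>. X s \<omega> - Y s \<omega>)"
    unfolding regular_def
  proof (intro conjI)
    show "progressively_measurable F T (\<lambda>s \<omega>. X s \<omega> - Y s \<omega>)"
      unfolding progressively_measurable_def
    proof
      fix t assume t: "t \<in> {0..T}"
      show "(\<lambda>(s, \<omega>). X s \<omega> - Y s \<omega>) \<in> borel_measurable (restrict_space borel {0..t} \<Otimes>\<^sub>M F (ennreal t))"
        using borel_measurable_diff[OF pm[OF X t] pm[OF Y t]] by (simp add: split_beta')
    qed
    show "dominated (\<lambda>s \<omega>. X s \<omega> - Y s \<omega>)" unfolding dominated_def
      by (rule exI[of _ "\<lambda>\<omega>. B \<omega> + C \<omega>"]) (use B(1) C(1) dom in \<open>auto elim: eventually_mono\<close>)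
    show "AE \<omega> in M. \<forall>s\<in>{0..<T}. ((\<lambda>s. X s \<omega> - Y s \<omega>) \<longlongrightarrow> X s \<omega> - Y s \<omega>) (at_right s)"
      using rc by eventually_elim (auto intro: tendsto_diff)
    show "quasi_left_continuous_process M F T (\<lambda>s \<omega>. X s \<omega> - Y s \<omega>)"
      unfolding quasi_left_continuous_process_def
    proof (intro allI impI)
      fix \<tau>n :: "nat \<Rightarrow> 'a \<Rightarrow> real" and \<tau>
      assume *: "\<forall>n. \<tau>n n \<in> stopping_times M F 0 T" "\<tau> \<in> stopping_times M F 0 T"
        "AE \<omega> in M. incseq (\<lambda>n. \<tau>n n \<omega>) \<and> (\<lambda>n. \<tau>n n \<omega>) \<longlonglongrightarrow> \<tau> \<omega>"
      show "AE \<omega> in M. (\<lambda>n. X (\<tau>n n \<omega>) \<omega> - Y (\<tau>n n \<omega>) \<omega>) \<longlonglongrightarrow> X (\<tau> \<omega>) \<omega> - Y (\<tau> \<omega>) \<omega>"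
        using qlc[OF *] by eventually_elim (auto intro: tendsto_diff)
    qed
  qed
qed

section \<open>Running integrals of progressively measurable processes\<close>

lemma progressively_measurable_extend:
  assumes \<psi>: "progressively_measurable F T \<psi>" and t: "t \<in> {0..T}"
  shows "(\<lambda>(u, \<omega>). indicator {0..t} u * \<psi> u \<omega> :: real) \<in> borel_measurable (borel \<Otimes>\<^sub>M F (ennreal t))"
proof -
  \<comment> \<open>Clamping maps the whole line measurably into \<open>[0, t]\<close>, where
    progressive measurability applies; the indicator erases its effect outside.\<close>
  have c: "(\<lambda>u. max 0 (min t u)) \<in> borel \<rightarrow>\<^sub>M restrict_space borel {0..t}"
    using t by (intro measurable_restrict_space2) auto
  have "(\<lambda>x. (max 0 (min t (fst x)), snd x)) \<in>
      borel \<Otimes>\<^sub>M F (ennreal t) \<rightarrow>\<^sub>M restrict_space borel {0..t} \<Otimes>\<^sub>M F (ennreal t)"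
    by (intro measurable_Pair measurable_compose[OF measurable_fst c] measurable_snd)
  moreover have "(\<lambda>(s, \<omega>). \<psi> s \<omega>) \<in> borel_measurable (restrict_space borel {0..t} \<Otimes>\<^sub>M F (ennreal t))"
    using \<psi> t by (simp add: progressively_measurable_def)
  ultimately have "(\<lambda>x. (\<lambda>(s, \<omega>). \<psi> s \<omega>) (max 0 (min t (fst x)), snd x)) \<in> borel_measurable (borel \<Otimes>\<^sub>M F (ennreal t))"
    by (rule measurable_compose)
  then have [measurable]: "(\<lambda>x. \<psi> (max 0 (min t (fst x))) (snd x)) \<in> borel_measurable (borel \<Otimes>\<^sub>M F (ennreal t))"
    by simp
  have "(\<lambda>x. indicator {0..t} (fst x) * \<psi> (max 0 (min t (fst x))) (snd x)) \<in> borel_measurable (borel \<Otimes>\<^sub>M F (ennreal t))"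
    by measurable
  also have "(\<lambda>x. indicator {0..t} (fst x) * \<psi> (max 0 (min t (fst x))) (snd x)) =
      (\<lambda>(u, \<omega>). indicator {0..t} u * \<psi> u \<omega>)"
    by (auto simp: indicator_def fun_eq_iff)
  finally show ?thesis .
qed

text \<open>Starting at \<open>0\<close> rather than at \<open>t\<close> gives one process for all
  \<open>t\<close>; the part up to \<open>t\<close> is known at \<open>t\<close> and leaves the
  conditional expectation.\<close>

definition integral_process :: "(real \<Rightarrow> 'a \<Rightarrow> real) \<Rightarrow> real \<Rightarrow> 'a \<Rightarrow> real" where
  "integral_process \<psi> s \<omega> = (LBINT u:{0..s}. \<psi> u \<omega>)"

text \<open>\<open>P\<close> majorises the running integral at all times simultaneously. It is
  measurable by Tonelli, and \<open>x \<le> 1 + x\<^sup>2\<close> integrated over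
  \<open>[0, T]\<close> bounds it by \<open>T\<close> plus the integral of the square.\<close>

lemma M2_abs_integral:
  assumes \<psi>: "\<psi> \<in> M2_space M F T"
  defines "P \<equiv> \<lambda>\<omega>. \<integral>\<^sup>+u\<in>{0..T}. ennreal \<bar>\<psi> u \<omega>\<bar> \<partial>lborel"
  shows "P \<in> borel_measurable M" "(\<integral>\<^sup>+\<omega>. P \<omega> \<partial>M) < \<infinity>"
    and "\<And>\<omega>. \<omega> \<in> space M \<Longrightarrow> P \<omega> < \<infinity> \<Longrightarrow> set_integrable lborel {0..T} (\<lambda>u. \<psi> u \<omega>)"
    and "\<And>\<omega> s. \<omega> \<in> space M \<Longrightarrow> P \<omega> < \<infinity> \<Longrightarrow> s \<in> {0..T} \<Longrightarrow> ennreal \<bar>integral_process \<psi> s \<omega>\<bar> \<le> P \<omega>"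
proof -
  have prog: "progressively_measurable F T \<psi>" using \<psi> by (simp add: M2_space_def)
  define f where "f u \<omega> = indicator {0..T} u * \<psi> u \<omega>" for u \<omega>
  have f0: "(\<lambda>(u, \<omega>). f u \<omega>) \<in> borel_measurable (borel \<Otimes>\<^sub>M F (ennreal T))"
    using progressively_measurable_extend[OF prog, of T] T_pos by (simp add: f_def)
  have swap: "(\<lambda>(\<omega>, u). (u, \<omega>)) \<in> M \<Otimes>\<^sub>M (lborel :: real measure) \<rightarrow>\<^sub>M borel \<Otimes>\<^sub>M F (ennreal T)"
  proof -
    have id: "(\<lambda>\<omega>. \<omega>) \<in> M \<rightarrow>\<^sub>M F (ennreal T)"
      using sets_F_subset[of "ennreal T"] by (intro measurableI) (auto simp: space_F)
    have "fst \<in> M \<Otimes>\<^sub>M (lborel :: real measure) \<rightarrow>\<^sub>M F (ennreal T)"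
      using measurable_compose[OF measurable_fst[of M "lborel :: real measure"] id] by simp
    moreover have "snd \<in> borel_measurable (M \<Otimes>\<^sub>M (lborel :: real measure))" by measurable
    ultimately have "(\<lambda>x. (snd x, fst x)) \<in> M \<Otimes>\<^sub>M (lborel :: real measure) \<rightarrow>\<^sub>M borel \<Otimes>\<^sub>M F (ennreal T)"
      by (intro measurable_Pair)
    then show ?thesis by (simp add: split_beta')
  qed
  have f: "(\<lambda>(\<omega>, u). f u \<omega>) \<in> borel_measurable (M \<Otimes>\<^sub>M lborel)"
    using measurable_compose[OF swap f0] by (simp add: split_beta')
  have P_eq: "P \<omega> = (\<integral>\<^sup>+u. ennreal \<bar>f u \<omega>\<bar> \<partial>lborel)" for \<omega>
    unfolding P_def f_def by (intro nn_integral_cong) (auto simp: indicator_def)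
  have f_abs: "(\<lambda>(\<omega>, u). ennreal \<bar>f u \<omega>\<bar>) \<in> borel_measurable (M \<Otimes>\<^sub>M lborel)"
    using f by (simp add: split_beta')
  show P: "P \<in> borel_measurable M"
    unfolding P_eq[abs_def] by (rule lborel.borel_measurable_nn_integral[OF f_abs])
  have fw: "(\<lambda>u. f u \<omega>) \<in> borel_measurable lborel" if "\<omega> \<in> space M" for \<omega>
    using measurable_compose[OF measurable_Pair1'[OF that] f] by simp
  define P2 where "P2 \<omega> = (\<integral>\<^sup>+u\<in>{0..T}. ennreal (\<bar>\<psi> u \<omega>\<bar>\<^sup>2) \<partial>lborel)" for \<omega>
  have P2_eq: "P2 \<omega> = (\<integral>\<^sup>+u. (ennreal \<bar>f u \<omega>\<bar>)\<^sup>2 \<partial>lborel)" for \<omega>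
    unfolding P2_def f_def by (intro nn_integral_cong) (auto simp: indicator_def ennreal_power)
  have P2: "P2 \<in> borel_measurable M"
    unfolding P2_eq[abs_def] using f
    by (intro lborel.borel_measurable_nn_integral) (simp add: split_beta')
  have P_le: "P \<omega> \<le> ennreal T + P2 \<omega>" if w: "\<omega> \<in> space M" for \<omega>
  proof -
    note [measurable] = fw[OF w]
    have "P \<omega> \<le> (\<integral>\<^sup>+u. indicator {0..T} u + (ennreal \<bar>f u \<omega>\<bar>)\<^sup>2 \<partial>lborel)"
      unfolding P_eq
    proof (rule nn_integral_mono)
      fix u :: real
      show "ennreal \<bar>f u \<omega>\<bar> \<le> indicator {0..T} u + (ennreal \<bar>f u \<omega>\<bar>)\<^sup>2"
        using ennreal_le_one_plus_square[of "ennreal \<bar>f u \<omega>\<bar>"] by (auto simp: f_def indicator_def)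
    qed
    also have "\<dots> = (\<integral>\<^sup>+u. indicator {0..T} u \<partial>lborel) + P2 \<omega>"
      unfolding P2_eq by (rule nn_integral_add) measurable
    finally show ?thesis using T_pos by simp
  qed
  have "(\<integral>\<^sup>+\<omega>. P \<omega> \<partial>M) \<le> (\<integral>\<^sup>+\<omega>. ennreal T + P2 \<omega> \<partial>M)" using P_le by (rule nn_integral_mono)
  also have "\<dots> = (\<integral>\<^sup>+\<omega>. ennreal T \<partial>M) + (\<integral>\<^sup>+\<omega>. P2 \<omega> \<partial>M)" by (rule nn_integral_add) (use P2 in auto)
  also have "\<dots> < \<infinity>" using \<psi> by (simp add: M2_space_def P2_def emeasure_space_1)
  finally show "(\<integral>\<^sup>+\<omega>. P \<omega> \<partial>M) < \<infinity>" .
  show si: "set_integrable lborel {0..T} (\<lambda>u. \<psi> u \<omega>)" if "\<omega> \<in> space M" "P \<omega> < \<infinity>" for \<omega>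
  proof -
    have "integrable lborel (\<lambda>u. f u \<omega>)"
      using that(2) by (intro integrableI_bounded fw[OF that(1)]) (simp add: P_eq)
    then show ?thesis by (simp add: set_integrable_def f_def)
  qed
  show "ennreal \<bar>integral_process \<psi> s \<omega>\<bar> \<le> P \<omega>" if w: "\<omega> \<in> space M" "P \<omega> < \<infinity>" and s: "s \<in> {0..T}" for \<omega> s
  proof -
    have int: "integrable lborel (\<lambda>u. f u \<omega>)" using si[OF w] by (simp add: set_integrable_def f_def)
    have "integrable lborel (\<lambda>u. indicator {0..s} u *\<^sub>R f u \<omega>)"
      by (rule integrable_mult_indicator[OF _ int]) simp
    moreover have eq: "(\<lambda>u. indicator {0..s} u *\<^sub>R f u \<omega>) = (\<lambda>u. indicator {0..s} u *\<^sub>R \<psi> u \<omega>)"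
      using s by (auto simp: f_def indicator_def fun_eq_iff)
    ultimately have "ennreal (norm (integral_process \<psi> s \<omega>)) \<le> (\<integral>\<^sup>+u. norm (indicator {0..s} u *\<^sub>R \<psi> u \<omega>) \<partial>lborel)"
      unfolding integral_process_def set_lebesgue_integral_def by (intro integral_norm_bound_ennreal) simp
    also have "\<dots> \<le> P \<omega>"
      unfolding P_eq using s by (intro nn_integral_mono) (auto simp: f_def indicator_def)
    finally show ?thesis by simp
  qed
qed

lemma AE_set_integrable_M2:
  assumes \<psi>: "\<psi> \<in> M2_space M F T"
  shows "AE \<omega> in M. set_integrable lborel {0..T} (\<lambda>u. \<psi> u \<omega>)"
proof -
  have "AE \<omega> in M. (\<integral>\<^sup>+u\<in>{0..T}. ennreal \<bar>\<psi> u \<omega>\<bar> \<partial>lborel) \<noteq> \<infinity>"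
    using M2_abs_integral(1,2)[OF \<psi>] by (intro nn_integral_PInf_AE) auto
  then show ?thesis using AE_space
    by eventually_elim (use M2_abs_integral(3)[OF \<psi>] in \<open>simp add: top.not_eq_extremum\<close>)
qed

text \<open>Almost all paths are continuous, which settles right-continuity and
  quasi-left-continuity together; joint measurability comes from integrating out one variable of a
  measurable function.\<close>

lemma regular_integral_process:
  assumes \<psi>: "\<psi> \<in> M2_space M F T"
  shows "regular (integral_process \<psi>)"
  unfolding regular_def
proof (intro conjI)
  have prog: "progressively_measurable F T \<psi>" using \<psi> by (simp add: M2_space_def)
  have cont: "AE \<omega> in M. continuous_on {0..T} (\<lambda>s. integral_process \<psi> s \<omega>)"
    using AE_set_integrable_M2[OF \<psi>] unfolding integral_process_def
    by eventually_elim (rule continuous_on_set_lborel_integral)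
  show "progressively_measurable F T (integral_process \<psi>)"
    unfolding progressively_measurable_def
  proof
    fix t assume t: "t \<in> {0..T}"
    let ?N = "restrict_space borel {0..t} \<Otimes>\<^sub>M F (ennreal t)"
    have f: "(\<lambda>(u, \<omega>). indicator {0..t} u * \<psi> u \<omega> :: real) \<in> borel_measurable (borel \<Otimes>\<^sub>M F (ennreal t))"
      by (rule progressively_measurable_extend[OF prog t])
    have id: "(\<lambda>s::real. s) \<in> restrict_space borel {0..t} \<rightarrow>\<^sub>M borel"
      by (rule measurable_restrict_space1) simp
    have "(\<lambda>x. (snd x, snd (fst x))) \<in> ?N \<Otimes>\<^sub>M lborel \<rightarrow>\<^sub>M borel \<Otimes>\<^sub>M F (ennreal t)" by measurable
    from measurable_compose[OF this f]
    have [measurable]: "(\<lambda>x. indicator {0..t} (snd x) * \<psi> (snd x) (snd (fst x)) :: real) \<in> borel_measurable (?N \<Otimes>\<^sub>M lborel)"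
      by simp
    have [measurable]: "(\<lambda>x. fst (fst x)) \<in> borel_measurable (?N \<Otimes>\<^sub>M lborel)"
      using measurable_compose[OF measurable_compose[OF measurable_fst measurable_fst] id] .
    \<comment> \<open>The variable upper limit is moved into the integrand, so that the domain of
      integration no longer depends on the parameter.\<close>
    have "(\<lambda>x. if snd x \<le> fst (fst x) then indicator {0..t} (snd x) * \<psi> (snd x) (snd (fst x)) else 0 :: real)
        \<in> borel_measurable (?N \<Otimes>\<^sub>M lborel)" by measurable
    then have "(\<lambda>(y, u). if u \<le> fst y then indicator {0..t} u * \<psi> u (snd y) else 0 :: real)
        \<in> borel_measurable (?N \<Otimes>\<^sub>M lborel)" by (simp add: split_beta')
    from lborel.borel_measurable_lebesgue_integral[OF this]
    have "(\<lambda>y. LBINT u. if u \<le> fst y then indicator {0..t} u * \<psi> u (snd y) else 0) \<in> borel_measurable ?N" .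
    moreover have eq: "(LBINT u. if u \<le> fst y then indicator {0..t} u * \<psi> u (snd y) else 0) = integral_process \<psi> (fst y) (snd y)"
      if "y \<in> space ?N" for y
      unfolding integral_process_def set_lebesgue_integral_def
      using that by (intro Bochner_Integration.integral_cong)
        (auto simp: space_pair_measure space_restrict_space indicator_def)
    ultimately have "(\<lambda>y. integral_process \<psi> (fst y) (snd y)) \<in> borel_measurable ?N"
      by (subst measurable_cong[OF eq[symmetric]])
    then show "(\<lambda>(s, \<omega>). integral_process \<psi> s \<omega>) \<in> borel_measurable ?N"
      by (simp add: split_beta')
  qed
  show "dominated (integral_process \<psi>)"
    by (rule dominatedI[OF M2_abs_integral(1,2)[OF \<psi>]])
      (use AE_space in eventually_elim, use M2_abs_integral(4)[OF \<psi>] in blast)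
  show "AE \<omega> in M. \<forall>s\<in>{0..<T}. ((\<lambda>s. integral_process \<psi> s \<omega>) \<longlongrightarrow> integral_process \<psi> s \<omega>) (at_right s)"
    using cont
  proof eventually_elim
    case (elim \<omega>)
    show ?case
    proof
      fix s assume s: "s \<in> {0..<T}"
      then have "((\<lambda>s. integral_process \<psi> s \<omega>) \<longlongrightarrow> integral_process \<psi> s \<omega>) (at s within {s..T})"
        using continuous_on_subset[OF elim, of "{s..T}"] by (auto simp: continuous_on_def)
      then show "((\<lambda>s. integral_process \<psi> s \<omega>) \<longlongrightarrow> integral_process \<psi> s \<omega>) (at_right s)"
        using s by (simp add: at_within_Icc_at_right)
    qed
  qed
  show "quasi_left_continuous_process M F T (integral_process \<psi>)"
    unfolding quasi_left_continuous_process_def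
  proof (intro allI impI)
    fix \<tau>n :: "nat \<Rightarrow> 'a \<Rightarrow> real" and \<tau>
    assume *: "\<forall>n. \<tau>n n \<in> stopping_times M F 0 T" "\<tau> \<in> stopping_times M F 0 T"
      "AE \<omega> in M. incseq (\<lambda>n. \<tau>n n \<omega>) \<and> (\<lambda>n. \<tau>n n \<omega>) \<longlonglongrightarrow> \<tau> \<omega>"
    have "AE \<omega> in M. \<forall>n. \<tau>n n \<omega> \<in> {0..T}" "AE \<omega> in M. \<tau> \<omega> \<in> {0..T}"
      using *(1,2) by (auto simp: stopping_times_def AE_all_countable)
    with cont *(3)
    show "AE \<omega> in M. (\<lambda>n. integral_process \<psi> (\<tau>n n \<omega>) \<omega>) \<longlonglongrightarrow> integral_process \<psi> (\<tau> \<omega>) \<omega>"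
      by eventually_elim (rule continuous_on_tendsto_compose, auto)
  qed
qed

text \<open>The exceptional null set does not depend on \<open>t\<close> and \<open>s\<close>, so
  random times may be inserted.\<close>

lemma AE_integral_process_diff:
  assumes "\<psi> \<in> M2_space M F T"
  shows "AE \<omega> in M. \<forall>t s. 0 \<le> t \<longrightarrow> t \<le> s \<longrightarrow> s \<le> T \<longrightarrow>
    (LBINT u:{t..s}. \<psi> u \<omega>) = integral_process \<psi> s \<omega> - integral_process \<psi> t \<omega>"
  using AE_set_integrable_M2[OF assms] unfolding integral_process_def
  by eventually_elim (auto intro: set_lborel_integral_diff)

end

section \<open>Switching systems and Dynkin games\<close>

lemma zero_in_M2_space: "(\<lambda>s \<omega>. 0) \<in> M2_space M F T"
  by (simp add: M2_space_def progressively_measurable_def)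

lemma integrable_mult_of_bool:
  fixes f :: "'a \<Rightarrow> real"
  assumes f: "integrable M f" and [measurable]: "Measurable.pred M P"
  shows "integrable M (\<lambda>\<omega>. f \<omega> * of_bool (P \<omega>))"
proof (rule Bochner_Integration.integrable_bound[OF f])
  note [measurable] = borel_measurable_integrable[OF f]
  show "(\<lambda>\<omega>. f \<omega> * of_bool (P \<omega>)) \<in> borel_measurable M" by measurable
qed (auto simp: abs_mult)

definition dynkin_integrand ::
  "real \<Rightarrow> (real \<Rightarrow> 'a \<Rightarrow> real) \<Rightarrow> (real \<Rightarrow> 'a \<Rightarrow> real) \<Rightarrow> (real \<Rightarrow> 'a \<Rightarrow> real) \<Rightarrow> ('a \<Rightarrow> real) \<Rightarrow>
   real \<Rightarrow> ('a \<Rightarrow> real) \<Rightarrow> ('a \<Rightarrow> real) \<Rightarrow> 'a \<Rightarrow> real" where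
  "dynkin_integrand T \<psi> \<gamma>m \<gamma>p \<Gamma> t \<sigma> \<tau> \<omega> =
     (LBINT s:{t..min (\<sigma> \<omega>) (\<tau> \<omega>)}. \<psi> s \<omega>)
       + \<gamma>m (\<sigma> \<omega>) \<omega> * of_bool (\<sigma> \<omega> \<le> \<tau> \<omega>) * of_bool (\<sigma> \<omega> < T)
       - \<gamma>p (\<tau> \<omega>) \<omega> * of_bool (\<tau> \<omega> < \<sigma> \<omega>)
       + \<Gamma> \<omega> * of_bool (\<sigma> \<omega> = T \<and> \<tau> \<omega> = T)"

lemma dynkin_payoff_eq:
  "dynkin_payoff M F T \<psi> \<gamma>m \<gamma>p \<Gamma> t \<sigma> \<tau> =
     real_cond_exp M (F (ennreal t)) (dynkin_integrand T \<psi> \<gamma>m \<gamma>p \<Gamma> t \<sigma> \<tau>)"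
  unfolding dynkin_payoff_def dynkin_integrand_def[abs_def] ..

context horizon
begin

text \<open>Measurability of \<open>f\<close> is inherited from \<open>g\<close> by completeness;
  payoffs at almost surely modified stopping times rely on this.\<close>

lemma ce_cong:
  assumes "AE \<omega> in M. f \<omega> = g \<omega>" "g \<in> borel_measurable M"
  shows "AE \<omega> in M. ce t f \<omega> = ce t g \<omega>"
  by (rule sigma_finite_subalgebra.real_cond_exp_cong[OF sigma_finite_subalgebra_F assms(1)
        borel_measurable_AE_eq[OF assms(2,1)] assms(2)])

lemma ce_diff_adapted:
  assumes "integrable M f" "integrable M g" "g \<in> borel_measurable (F (ennreal t))"
  shows "AE \<omega> in M. ce t (\<lambda>\<omega>. f \<omega> - g \<omega>) \<omega> = ce t f \<omega> - g \<omega>"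
proof -
  interpret sfs: sigma_finite_subalgebra M "F (ennreal t)" by (rule sigma_finite_subalgebra_F)
  show ?thesis
    using sfs.real_cond_exp_diff[OF assms(1,2)] sfs.real_cond_exp_F_meas[OF assms(2,3)]
    by eventually_elim simp
qed

text \<open>Adding the running reward turns \<open>Yi\<close> into the Snell envelope of an obstacle which jumps at
  time \<open>T\<close> to the terminal value of \<open>Yi\<close> itself.\<close>

lemma snell_envelope_switching:
  assumes \<psi>: "\<psi> \<in> M2_space M F T" and \<gamma>: "\<gamma> \<in> S2_space M F T \<inter> Q_space M F T"
    and Yi: "Yi \<in> S2_space M F T \<inter> Q_space M F T" and Yo: "Yo \<in> S2_space M F T \<inter> Q_space M F T"
    and ess: "\<And>t. t \<in> {0..T} \<Longrightarrow>
      is_ess_sup M (stopping_times M F t T) (switching_payoff M F T \<psi> \<gamma> \<Gamma> Yo t) (Yi t)"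
    and terminal: "AE \<omega> in M. Yi T \<omega> = \<Gamma> \<omega>"
  shows "snell_envelope M F T (\<lambda>s \<omega>. Yi s \<omega> + integral_process \<psi> s \<omega>)
    (\<lambda>s \<omega>. Yo s \<omega> - \<gamma> s \<omega> + integral_process \<psi> s \<omega>)"
proof -
  define I where "I = integral_process \<psi>"
  define Z where "Z = (\<lambda>s \<omega>. Yi s \<omega> + I s \<omega>)"
  define H where "H = (\<lambda>s \<omega>. Yo s \<omega> - \<gamma> s \<omega> + I s \<omega>)"
  have rI: "regular I" unfolding I_def by (rule regular_integral_process[OF \<psi>])
  have rZ: "regular Z" unfolding Z_def by (intro regular_add S2_Q_regular[OF Yi] rI)
  have rH: "regular H" unfolding H_def
    by (intro regular_add regular_diff S2_Q_regular[OF Yo] S2_Q_regular[OF \<gamma>] rI)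
  have iZT: "integrable M (Z T)" using regular_integrable[OF rZ, of T] T_pos by simp
  \<comment> \<open>Formulated for a time \<open>\<nu>\<close> and a version \<open>\<theta>\<close>
    bounded everywhere: \<open>dominates\<close> takes the two equal, \<open>least\<close> has to
    treat an arbitrary member of \<open>stopping_times\<close>.\<close>
  have payoff: "AE \<omega> in M. switching_payoff M F T \<psi> \<gamma> \<Gamma> Yo t \<nu> \<omega> =
      ce t (stopped_payoff T H (Z T) \<theta>) \<omega> - I t \<omega>"
    if t: "t \<in> {0..T}" and \<theta>: "stime t \<theta>" and \<nu>: "AE \<omega> in M. \<nu> \<omega> = \<theta> \<omega>" for t \<nu> \<theta>
  proof -
    have t': "0 \<le> t" using t by simp
    have iG: "integrable M (stopped_payoff T H (Z T) \<theta>)"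
      by (rule integrable_stopped_payoff[OF rH iZT \<theta> t'])
    have iI: "integrable M (I t)" by (rule regular_integrable[OF rI t])
    have "AE \<omega> in M. (LBINT s:{t..\<nu> \<omega>}. \<psi> s \<omega>) + \<Gamma> \<omega> * of_bool (\<nu> \<omega> = T) +
        (Yo (\<nu> \<omega>) \<omega> - \<gamma> (\<nu> \<omega>) \<omega>) * of_bool (\<nu> \<omega> < T) = stopped_payoff T H (Z T) \<theta> \<omega> - I t \<omega>"
      using \<nu> terminal AE_integral_process_diff[OF \<psi>] AE_space
    proof eventually_elim
      case (elim \<omega>)
      have r: "t \<le> \<theta> \<omega>" "\<theta> \<omega> \<le> T" using stime_range[OF \<theta> elim(4)] by auto
      then have "(LBINT s:{t..\<theta> \<omega>}. \<psi> s \<omega>) = I (\<theta> \<omega>) \<omega> - I t \<omega>"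
        using elim(3) t' unfolding I_def by blast
      \<comment> \<open>At \<open>\<theta> \<omega> = T\<close> the reward \<open>\<Gamma>\<close>
        is the terminal value of \<open>Yi\<close>; in both cases the difference is exactly the
        reward \<open>I t\<close> accumulated before \<open>t\<close>.\<close>
      then show ?case
        using r elim(1,2) by (cases "\<theta> \<omega> = T") (auto simp: stopped_payoff_def H_def Z_def)
    qed
    then have "AE \<omega> in M. switching_payoff M F T \<psi> \<gamma> \<Gamma> Yo t \<nu> \<omega> =
        ce t (\<lambda>\<omega>. stopped_payoff T H (Z T) \<theta> \<omega> - I t \<omega>) \<omega>"
      unfolding switching_payoff_def using iG iI by (intro ce_cong) auto
    with ce_diff_adapted[OF iG iI regular_adapted[OF rI t]] show ?thesis
      by eventually_elim simp
  qed
  have "snell_envelope M F T Z H"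
  proof unfold_locales
    fix t \<theta> assume t: "t \<in> {0..T}" and \<theta>: "stime t \<theta>"
    have "\<theta> \<in> stopping_times M F t T" using stime_stopping_times[OF \<theta>] t by simp
    then have "AE \<omega> in M. switching_payoff M F T \<psi> \<gamma> \<Gamma> Yo t \<theta> \<omega> \<le> Yi t \<omega>"
      using ess[OF t] by (simp add: is_ess_sup_def)
    with payoff[OF t \<theta>, of \<theta>] show "AE \<omega> in M. ce t (stopped_payoff T H (Z T) \<theta>) \<omega> \<le> Z t \<omega>"
      by (auto elim!: eventually_elim2 simp: Z_def)
  next
    fix t and Z' :: "'a \<Rightarrow> real"
    assume t: "t \<in> {0..T}" and Z': "Z' \<in> borel_measurable M"
      and le: "\<And>\<theta>. stime t \<theta> \<Longrightarrow> AE \<omega> in M. ce t (stopped_payoff T H (Z T) \<theta>) \<omega> \<le> Z' \<omega>"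
    have "AE \<omega> in M. switching_payoff M F T \<psi> \<gamma> \<Gamma> Yo t \<nu> \<omega> \<le> Z' \<omega> - I t \<omega>"
      if \<nu>: "\<nu> \<in> stopping_times M F t T" for \<nu>
    proof -
      obtain \<theta> where \<theta>: "stime t \<theta>" "AE \<omega> in M. \<nu> \<omega> = \<theta> \<omega>" by (rule stopping_times_stime[OF \<nu> t])
      show ?thesis using payoff[OF t \<theta>] le[OF \<theta>(1)] by eventually_elim simp
    qed
    moreover have "(\<lambda>\<omega>. Z' \<omega> - I t \<omega>) \<in> borel_measurable M"
      using Z' regular_integrable[OF rI t] by auto
    ultimately have "AE \<omega> in M. Yi t \<omega> \<le> Z' \<omega> - I t \<omega>"
      using ess[OF t] by (simp add: is_ess_sup_def)
    then show "AE \<omega> in M. Z t \<omega> \<le> Z' \<omega>" by eventually_elim (simp add: Z_def)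
  qed (rule rZ rH)+
  then show ?thesis by (simp only: Z_def H_def I_def)
qed

section \<open>The random payoff inside the conditional expectation\<close>

lemma dynkin_integrand_AE_eq:
  assumes \<psi>: "\<psi> \<in> M2_space M F T" and t: "t \<in> {0..T}" and \<theta>: "stime t \<theta>1" "stime t \<theta>2"
  shows "AE \<omega> in M. dynkin_integrand T \<psi> \<gamma>m \<gamma>p \<Gamma> t \<theta>1 \<theta>2 \<omega> =
     integral_process \<psi> (min (\<theta>1 \<omega>) (\<theta>2 \<omega>)) \<omega> - integral_process \<psi> t \<omega>
       + \<gamma>m (\<theta>1 \<omega>) \<omega> * of_bool (\<theta>1 \<omega> \<le> \<theta>2 \<omega>) * of_bool (\<theta>1 \<omega> < T)
       - \<gamma>p (\<theta>2 \<omega>) \<omega> * of_bool (\<theta>2 \<omega> < \<theta>1 \<omega>)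
       + \<Gamma> \<omega> * of_bool (\<theta>1 \<omega> = T \<and> \<theta>2 \<omega> = T)"
  using AE_integral_process_diff[OF \<psi>] AE_space
proof eventually_elim
  case (elim \<omega>)
  have "t \<le> min (\<theta>1 \<omega>) (\<theta>2 \<omega>)" "min (\<theta>1 \<omega>) (\<theta>2 \<omega>) \<le> T"
    using stime_range[OF \<theta>(1) elim(2)] stime_range[OF \<theta>(2) elim(2)] by auto
  then have "(LBINT s:{t..min (\<theta>1 \<omega>) (\<theta>2 \<omega>)}. \<psi> s \<omega>) =
      integral_process \<psi> (min (\<theta>1 \<omega>) (\<theta>2 \<omega>)) \<omega> - integral_process \<psi> t \<omega>"
    using elim(1) t by simp
  then show ?case by (simp add: dynkin_integrand_def)
qed

text \<open>The pathwise integral up to a random time is not visibly measurable. Its almost sure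
  form consists of regular processes evaluated at stopping times, and completeness carries
  measurability back.\<close>

lemma integrable_dynkin_integrand:
  assumes \<psi>: "\<psi> \<in> M2_space M F T" and \<gamma>: "regular \<gamma>m" "regular \<gamma>p" and \<Gamma>: "integrable M \<Gamma>"
    and t: "t \<in> {0..T}" and \<theta>: "stime t \<theta>1" "stime t \<theta>2"
  shows "integrable M (dynkin_integrand T \<psi> \<gamma>m \<gamma>p \<Gamma> t \<theta>1 \<theta>2)"
proof -
  have t': "0 \<le> t" using t by simp
  note [measurable] = stime_measurable[OF \<theta>(1)] stime_measurable[OF \<theta>(2)]
  have rI: "regular (integral_process \<psi>)" by (rule regular_integral_process[OF \<psi>])
  have "integrable M (\<lambda>\<omega>. integral_process \<psi> (min (\<theta>1 \<omega>) (\<theta>2 \<omega>)) \<omega> - integral_process \<psi> t \<omega>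
       + \<gamma>m (\<theta>1 \<omega>) \<omega> * of_bool (\<theta>1 \<omega> \<le> \<theta>2 \<omega>) * of_bool (\<theta>1 \<omega> < T)
       - \<gamma>p (\<theta>2 \<omega>) \<omega> * of_bool (\<theta>2 \<omega> < \<theta>1 \<omega>)
       + \<Gamma> \<omega> * of_bool (\<theta>1 \<omega> = T \<and> \<theta>2 \<omega> = T))" (is "integrable M ?R")
    by (intro Bochner_Integration.integrable_add Bochner_Integration.integrable_diff integrable_mult_of_bool
        at_time_integrable[OF rI stime_min[OF \<theta> t'] t'] regular_integrable[OF rI t]
        at_time_integrable[OF \<gamma>(1) \<theta>(1) t'] at_time_integrable[OF \<gamma>(2) \<theta>(2) t'] \<Gamma>) measurable
  moreover have ae: "AE \<omega> in M. dynkin_integrand T \<psi> \<gamma>m \<gamma>p \<Gamma> t \<theta>1 \<theta>2 \<omega> = ?R \<omega>"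
    by (rule dynkin_integrand_AE_eq[OF \<psi> t \<theta>])
  moreover have "dynkin_integrand T \<psi> \<gamma>m \<gamma>p \<Gamma> t \<theta>1 \<theta>2 \<in> borel_measurable M"
    by (rule borel_measurable_AE_eq[OF _ ae]) (rule borel_measurable_integrable, fact)
  ultimately show ?thesis using integrable_cong_AE by blast
qed

lemma dynkin_payoff_cong:
  assumes \<psi>: "\<psi> \<in> M2_space M F T" and \<gamma>: "regular \<gamma>m" "regular \<gamma>p" and \<Gamma>: "integrable M \<Gamma>"
    and t: "t \<in> {0..T}" and \<theta>: "stime t \<theta>1" "stime t \<theta>2"
    and ae: "AE \<omega> in M. \<sigma> \<omega> = \<theta>1 \<omega>" "AE \<omega> in M. \<tau> \<omega> = \<theta>2 \<omega>"
  shows "AE \<omega> in M. dynkin_payoff M F T \<psi> \<gamma>m \<gamma>p \<Gamma> t \<sigma> \<tau> \<omega> = dynkin_payoff M F T \<psi> \<gamma>m \<gamma>p \<Gamma> t \<theta>1 \<theta>2 \<omega>"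
  unfolding dynkin_payoff_eq
proof (rule ce_cong)
  show "AE \<omega> in M. dynkin_integrand T \<psi> \<gamma>m \<gamma>p \<Gamma> t \<sigma> \<tau> \<omega> = dynkin_integrand T \<psi> \<gamma>m \<gamma>p \<Gamma> t \<theta>1 \<theta>2 \<omega>"
    using ae by eventually_elim (simp add: dynkin_integrand_def)
  show "dynkin_integrand T \<psi> \<gamma>m \<gamma>p \<Gamma> t \<theta>1 \<theta>2 \<in> borel_measurable M"
    using integrable_dynkin_integrand[OF \<psi> \<gamma> \<Gamma> t \<theta>] by simp
qed

lemma ce_mono:
  "AE \<omega> in M. f \<omega> \<le> g \<omega> \<Longrightarrow> integrable M f \<Longrightarrow> integrable M g \<Longrightarrow> AE \<omega> in M. ce t f \<omega> \<le> ce t g \<omega>"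
  by (rule sigma_finite_subalgebra.real_cond_exp_mono[OF sigma_finite_subalgebra_F])

end

theorem theorem4p4:
  fixes M :: "'a measure" and F :: "ennreal \<Rightarrow> 'a measure" and T :: real
    and \<psi> \<gamma>m \<gamma>p :: "real \<Rightarrow> 'a \<Rightarrow> real" and \<Gamma> :: "'a \<Rightarrow> real"
    and Y :: "nat \<Rightarrow> real \<Rightarrow> 'a \<Rightarrow> real"
    and \<sigma>s \<tau>s :: "real \<Rightarrow> 'a \<Rightarrow> real"
  assumes "quasi_left_continuous_filtration M F"
    and "0 < T"
    and "\<psi> \<in> M2_space M F T"
    and "\<gamma>m \<in> S2_space M F T \<inter> Q_space M F T"
    and "\<gamma>p \<in> S2_space M F T \<inter> Q_space M F T"
    and "\<Gamma> \<in> borel_measurable (F (ennreal T))"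
    and "integrable M (\<lambda>\<omega>. \<bar>\<Gamma> \<omega>\<bar>\<^sup>2)"
    and "AE \<omega> in M. - \<gamma>p T \<omega> \<le> \<Gamma> \<omega> \<and> \<Gamma> \<omega> \<le> \<gamma>m T \<omega>"
    and "\<And>t. t \<in> {0..T} \<Longrightarrow> AE \<omega> in M. \<gamma>m t \<omega> + \<gamma>p t \<omega> > 0"
    and "switching_system M F T \<psi> \<gamma>m \<gamma>p \<Gamma> Y"
    and "\<And>t. \<sigma>s t = first_contact_time T (Y 0) (\<lambda>s \<omega>. Y 1 s \<omega> - \<gamma>m s \<omega>) t"
    and "\<And>t. \<tau>s t = first_contact_time T (Y 1) (\<lambda>s \<omega>. Y 0 s \<omega> - \<gamma>p s \<omega>) t"
  shows "\<forall>t\<in>{0..T}.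
    \<sigma>s t \<in> stopping_times M F t T \<and> \<tau>s t \<in> stopping_times M F t T \<and>
    (AE \<omega> in M. Y 1 t \<omega> - Y 0 t \<omega> = dynkin_payoff M F T \<psi> \<gamma>m \<gamma>p \<Gamma> t (\<sigma>s t) (\<tau>s t) \<omega>) \<and>
    (\<forall>\<sigma>\<in>stopping_times M F t T. \<forall>\<tau>\<in>stopping_times M F t T.
       (AE \<omega> in M. dynkin_payoff M F T \<psi> \<gamma>m \<gamma>p \<Gamma> t (\<sigma>s t) \<tau> \<omega>
                    \<le> dynkin_payoff M F T \<psi> \<gamma>m \<gamma>p \<Gamma> t (\<sigma>s t) (\<tau>s t) \<omega>) \<and>
       (AE \<omega> in M. dynkin_payoff M F T \<psi> \<gamma>m \<gamma>p \<Gamma> t (\<sigma>s t) (\<tau>s t) \<omega>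
                    \<le> dynkin_payoff M F T \<psi> \<gamma>m \<gamma>p \<Gamma> t \<sigma> (\<tau>s t) \<omega>))"
proof
  fix t assume t: "t \<in> {0..T}"
  interpret quasi_left_continuous_filtration M F by fact
  interpret horizon M F T by unfold_locales fact
  have t': "0 \<le> t" "t \<le> T" using t by auto
  note \<psi> = assms(3)
  have \<gamma>: "regular \<gamma>m" "regular \<gamma>p" using S2_Q_regular assms(4,5) by blast+
  have Y: "Y 0 \<in> S2_space M F T \<inter> Q_space M F T" "Y 1 \<in> S2_space M F T \<inter> Q_space M F T"
    and Y_T: "AE \<omega> in M. Y 0 T \<omega> = 0" "AE \<omega> in M. Y 1 T \<omega> = \<Gamma> \<omega>"
    and ess0: "\<And>t. t \<in> {0..T} \<Longrightarrow> is_ess_sup M (stopping_times M F t T)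
      (switching_payoff M F T (\<lambda>s \<omega>. 0) \<gamma>m (\<lambda>\<omega>. 0) (Y 1) t) (Y 0 t)"
    and ess1: "\<And>t. t \<in> {0..T} \<Longrightarrow> is_ess_sup M (stopping_times M F t T)
      (switching_payoff M F T \<psi> \<gamma>p \<Gamma> (Y 0) t) (Y 1 t)"
    using assms(10) by (simp_all add: switching_system_def)
  have rY: "regular (Y 0)" "regular (Y 1)" using S2_Q_regular Y by blast+
  define I where "I = integral_process \<psi>"
  have rI: "regular I" unfolding I_def by (rule regular_integral_process[OF \<psi>])
  \<comment> \<open>Mode 0 earns no running reward, so \<open>Y 0\<close> is an envelope without any
    correction.\<close>
  have I0: "integral_process (\<lambda>s \<omega>. 0) = (\<lambda>s \<omega>. 0)"
    by (simp add: integral_process_def[abs_def])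
  define Z where "Z = (\<lambda>s \<omega>. Y 1 s \<omega> + I s \<omega>)"
  interpret E0: snell_envelope M F T "Y 0" "\<lambda>s \<omega>. Y 1 s \<omega> - \<gamma>m s \<omega>"
    using snell_envelope_switching[OF zero_in_M2_space assms(4) Y(1,2) ess0 Y_T(1)] by (simp add: I0)
  interpret E1: snell_envelope M F T Z "\<lambda>s \<omega>. Y 0 s \<omega> - \<gamma>p s \<omega> + I s \<omega>"
    using snell_envelope_switching[OF \<psi> assms(5) Y(2,1) ess1 Y_T(2)] by (simp only: I_def Z_def)
  have "integrable M (Y 1 T)" using regular_integrable[OF rY(2), of T] T_pos by simp
  moreover have "\<Gamma> \<in> borel_measurable M" using assms(6) by (rule measurable_F_imp_M)
  ultimately have \<Gamma>: "integrable M \<Gamma>"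
    using integrable_cong_AE[OF _ _ Y_T(2)] by blast
  \<comment> \<open>The reward \<open>I\<close> is added to envelope and obstacle alike and cancels
    in the contact equation.\<close>
  have contact1: "first_contact_time T Z (\<lambda>s \<omega>. Y 0 s \<omega> - \<gamma>p s \<omega> + I s \<omega>) t = \<tau>s t"
    by (simp add: assms(12) Z_def first_contact_time_def[abs_def])
  obtain \<kappa>0 where \<kappa>0: "stime t \<kappa>0" "AE \<omega> in M. \<sigma>s t \<omega> = \<kappa>0 \<omega>"
    "AE \<omega> in M. \<kappa>0 \<omega> < T \<longrightarrow> Y 0 (\<kappa>0 \<omega>) \<omega> = Y 1 (\<kappa>0 \<omega>) \<omega> - \<gamma>m (\<kappa>0 \<omega>) \<omega>"
    "(LINT \<omega>|M. Y 0 t \<omega>) \<le> (LINT \<omega>|M. Y 0 (\<kappa>0 \<omega>) \<omega>)"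
    using E0.contact_time[OF t] unfolding assms(11)[symmetric] by blast
  obtain \<kappa>1 where \<kappa>1: "stime t \<kappa>1" "AE \<omega> in M. \<tau>s t \<omega> = \<kappa>1 \<omega>"
    "AE \<omega> in M. \<kappa>1 \<omega> < T \<longrightarrow> Z (\<kappa>1 \<omega>) \<omega> = Y 0 (\<kappa>1 \<omega>) \<omega> - \<gamma>p (\<kappa>1 \<omega>) \<omega> + I (\<kappa>1 \<omega>) \<omega>"
    "(LINT \<omega>|M. Z t \<omega>) \<le> (LINT \<omega>|M. Z (\<kappa>1 \<omega>) \<omega>)"
    using E1.contact_time[OF t] unfolding contact1 by blast
  let ?D = "dynkin_payoff M F T \<psi> \<gamma>m \<gamma>p \<Gamma> t" and ?R = "dynkin_integrand T \<psi> \<gamma>m \<gamma>p \<Gamma> t"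
  let ?V = "\<lambda>\<omega>. Y 1 t \<omega> - Y 0 t \<omega>"
  \<comment> \<open>The difference of the two values at \<open>\<theta>\<close> plus the reward
    earned between \<open>t\<close> and \<open>\<theta>\<close>; \<open>Z\<close> carries the reward
    from \<open>0\<close> on, hence the subtraction of \<open>I t\<close>.\<close>
  define W where "W \<theta> \<omega> = Z (\<theta> \<omega>) \<omega> - Y 0 (\<theta> \<omega>) \<omega> - I t \<omega>" for \<theta> \<omega>
  have iW: "integrable M (W \<theta>)" if "stime t \<theta>" for \<theta>
    unfolding W_def[abs_def]
    by (intro Bochner_Integration.integrable_diff E1.integrable_at_Z[OF that t'(1)]
        E0.integrable_at_Z[OF that t'(1)] regular_integrable[OF rI t])
  have iR: "integrable M (?R \<theta> \<theta>')" if "stime t \<theta>" "stime t \<theta>'" for \<theta> \<theta>'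
    by (rule integrable_dynkin_integrand[OF \<psi> \<gamma> \<Gamma> t that])
  have ceW: "AE \<omega> in M. ce t (W \<theta>) \<omega> = ce t (\<lambda>\<omega>. Z (\<theta> \<omega>) \<omega>) \<omega> - ce t (\<lambda>\<omega>. Y 0 (\<theta> \<omega>) \<omega>) \<omega> - I t \<omega>"
    if \<theta>: "stime t \<theta>" for \<theta>
  proof -
    note i = E1.integrable_at_Z[OF \<theta> t'(1)] E0.integrable_at_Z[OF \<theta> t'(1)]
    have "AE \<omega> in M. ce t (W \<theta>) \<omega> = ce t (\<lambda>\<omega>. Z (\<theta> \<omega>) \<omega> - Y 0 (\<theta> \<omega>) \<omega>) \<omega> - I t \<omega>"
      unfolding W_def[abs_def]
      by (intro ce_diff_adapted Bochner_Integration.integrable_diff i regular_integrable[OF rI t] regular_adapted[OF rI t])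
    with sigma_finite_subalgebra.real_cond_exp_diff[OF sigma_finite_subalgebra_F i, of "ennreal t"]
    show ?thesis by eventually_elim simp
  qed
  have obstacle: "AE \<omega> in M. \<forall>s\<in>{0..<T}. Y 1 s \<omega> - \<gamma>m s \<omega> \<le> Y 0 s \<omega> \<and> Y 0 s \<omega> - \<gamma>p s \<omega> \<le> Y 1 s \<omega>"
    using E0.AE_H_le_Z E1.AE_H_le_Z by eventually_elim (simp add: Z_def)
  note R_eq = dynkin_integrand_AE_eq[OF \<psi> t, of _ _ \<gamma>m \<gamma>p \<Gamma>, folded I_def]
  have below: "AE \<omega> in M. ?D \<kappa>0 \<theta> \<omega> \<le> ?V \<omega>" if \<theta>: "stime t \<theta>" for \<theta>
  proof -
    have m: "stime t (\<lambda>\<omega>. min (\<kappa>0 \<omega>) (\<theta> \<omega>))" by (rule stime_min[OF \<kappa>0(1) \<theta> t'(1)])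
    have "AE \<omega> in M. ?R \<kappa>0 \<theta> \<omega> \<le> W (\<lambda>\<omega>. min (\<kappa>0 \<omega>) (\<theta> \<omega>)) \<omega>"
      using R_eq[OF \<kappa>0(1) \<theta>] \<kappa>0(3) obstacle Y_T AE_space
    proof eventually_elim
      case (elim \<omega>)
      have r: "0 \<le> \<kappa>0 \<omega>" "\<kappa>0 \<omega> \<le> T" "0 \<le> \<theta> \<omega>" "\<theta> \<omega> \<le> T"
        using stime_range[OF \<kappa>0(1) elim(6)] stime_range[OF \<theta> elim(6)] t' by auto
      \<comment> \<open>At contact \<open>\<gamma>m\<close> equals \<open>Y 1 - Y 0\<close>; if
        \<open>\<theta>\<close> comes strictly first, the obstacle of \<open>Y 1\<close> bounds
        \<open>- \<gamma>p\<close> by this difference; at \<open>T\<close> the terminal values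
        \<open>\<Gamma>\<close> and \<open>0\<close> agree with the payoff.\<close>
      consider "\<kappa>0 \<omega> \<le> \<theta> \<omega>" "\<kappa>0 \<omega> < T" | "\<theta> \<omega> < \<kappa>0 \<omega>" | "\<kappa>0 \<omega> = T" "\<theta> \<omega> = T"
        using r by linarith
      then show ?case
      proof cases
        case 2
        then have "Y 0 (\<theta> \<omega>) \<omega> - \<gamma>p (\<theta> \<omega>) \<omega> \<le> Y 1 (\<theta> \<omega>) \<omega>" using elim(3) r by auto
        then show ?thesis using 2 elim(1) by (simp add: W_def Z_def)
      qed (use elim in \<open>simp_all add: W_def Z_def\<close>)
    qed
    then have "AE \<omega> in M. ?D \<kappa>0 \<theta> \<omega> \<le> ce t (W (\<lambda>\<omega>. min (\<kappa>0 \<omega>) (\<theta> \<omega>))) \<omega>"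
      unfolding dynkin_payoff_eq by (intro ce_mono iW[OF m] iR \<kappa>0(1) \<theta>)
    moreover have "AE \<omega> in M. ce t (\<lambda>\<omega>. Y 0 (min (\<kappa>0 \<omega>) (\<theta> \<omega>)) \<omega>) \<omega> = Y 0 t \<omega>"
      by (rule E0.ce_at_stime_before_contact[OF \<kappa>0(1,4) m _ t]) simp
    ultimately show ?thesis
      using ceW[OF m] E1.ce_at_stime_le[OF m t] by eventually_elim (simp add: Z_def)
  qed
  have above: "AE \<omega> in M. ?V \<omega> \<le> ?D \<theta> \<kappa>1 \<omega>" if \<theta>: "stime t \<theta>" for \<theta>
  proof -
    have m: "stime t (\<lambda>\<omega>. min (\<theta> \<omega>) (\<kappa>1 \<omega>))" by (rule stime_min[OF \<theta> \<kappa>1(1) t'(1)])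
    have "AE \<omega> in M. W (\<lambda>\<omega>. min (\<theta> \<omega>) (\<kappa>1 \<omega>)) \<omega> \<le> ?R \<theta> \<kappa>1 \<omega>"
      using R_eq[OF \<theta> \<kappa>1(1)] \<kappa>1(3) obstacle Y_T AE_space
    proof eventually_elim
      case (elim \<omega>)
      have r: "0 \<le> \<kappa>1 \<omega>" "\<kappa>1 \<omega> \<le> T" "0 \<le> \<theta> \<omega>" "\<theta> \<omega> \<le> T"
        using stime_range[OF \<kappa>1(1) elim(6)] stime_range[OF \<theta> elim(6)] t' by auto
      \<comment> \<open>A tie before \<open>T\<close> pays \<open>\<gamma>m\<close>, as if
        \<open>\<theta>\<close> had stopped first, so it is covered by the obstacle inequality for
        \<open>Y 0\<close>; contact of \<open>Y 1\<close> is used only when \<open>\<kappa>1\<close>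
        is strictly earlier.\<close>
      consider "\<theta> \<omega> \<le> \<kappa>1 \<omega>" "\<theta> \<omega> < T" | "\<kappa>1 \<omega> < \<theta> \<omega>" | "\<kappa>1 \<omega> = T" "\<theta> \<omega> = T"
        using r by linarith
      then show ?case
      proof cases
        case 1
        then have "Y 1 (\<theta> \<omega>) \<omega> - \<gamma>m (\<theta> \<omega>) \<omega> \<le> Y 0 (\<theta> \<omega>) \<omega>" using elim(3) r by auto
        then show ?thesis using 1 elim(1) by (simp add: W_def Z_def)
      next
        case 2
        then have "Y 1 (\<kappa>1 \<omega>) \<omega> = Y 0 (\<kappa>1 \<omega>) \<omega> - \<gamma>p (\<kappa>1 \<omega>) \<omega>" using elim(2) r by (simp add: Z_def)
        then show ?thesis using 2 elim(1) by (simp add: W_def Z_def)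
      qed (use elim in \<open>simp_all add: W_def Z_def\<close>)
    qed
    then have "AE \<omega> in M. ce t (W (\<lambda>\<omega>. min (\<theta> \<omega>) (\<kappa>1 \<omega>))) \<omega> \<le> ?D \<theta> \<kappa>1 \<omega>"
      unfolding dynkin_payoff_eq by (intro ce_mono iW[OF m] iR \<kappa>1(1) \<theta>)
    moreover have "AE \<omega> in M. ce t (\<lambda>\<omega>. Z (min (\<theta> \<omega>) (\<kappa>1 \<omega>)) \<omega>) \<omega> = Z t \<omega>"
      by (rule E1.ce_at_stime_before_contact[OF \<kappa>1(1,4) m _ t]) simp
    ultimately show ?thesis
      using ceW[OF m] E0.ce_at_stime_le[OF m t] by eventually_elim (simp add: Z_def)
  qed
  note cong = dynkin_payoff_cong[OF \<psi> \<gamma> \<Gamma> t]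
  \<comment> \<open>\<open>below\<close> at \<open>\<kappa>1\<close> and \<open>above\<close> at
    \<open>\<kappa>0\<close> concern the same payoff and pin it from both sides.\<close>
  have eq: "AE \<omega> in M. ?V \<omega> = ?D (\<sigma>s t) (\<tau>s t) \<omega>"
    using below[OF \<kappa>1(1)] above[OF \<kappa>0(1)] cong[OF \<kappa>0(1) \<kappa>1(1) \<kappa>0(2) \<kappa>1(2)]
    by eventually_elim simp
  have "(AE \<omega> in M. ?D (\<sigma>s t) \<tau> \<omega> \<le> ?D (\<sigma>s t) (\<tau>s t) \<omega>) \<and>
      (AE \<omega> in M. ?D (\<sigma>s t) (\<tau>s t) \<omega> \<le> ?D \<sigma> (\<tau>s t) \<omega>)"
    if \<sigma>: "\<sigma> \<in> stopping_times M F t T" and \<tau>: "\<tau> \<in> stopping_times M F t T" for \<sigma> \<tau>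
  proof
    obtain \<theta> where \<theta>: "stime t \<theta>" "AE \<omega> in M. \<tau> \<omega> = \<theta> \<omega>" by (rule stopping_times_stime[OF \<tau> t])
    show "AE \<omega> in M. ?D (\<sigma>s t) \<tau> \<omega> \<le> ?D (\<sigma>s t) (\<tau>s t) \<omega>"
      using below[OF \<theta>(1)] eq cong[OF \<kappa>0(1) \<theta>(1) \<kappa>0(2) \<theta>(2)] by eventually_elim simp
  next
    obtain \<theta> where \<theta>: "stime t \<theta>" "AE \<omega> in M. \<sigma> \<omega> = \<theta> \<omega>" by (rule stopping_times_stime[OF \<sigma> t])
    show "AE \<omega> in M. ?D (\<sigma>s t) (\<tau>s t) \<omega> \<le> ?D \<sigma> (\<tau>s t) \<omega>"
      using above[OF \<theta>(1)] eq cong[OF \<theta>(1) \<kappa>1(1) \<theta>(2) \<kappa>1(2)] by eventually_elim simp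
  qed
  moreover have "\<sigma>s t \<in> stopping_times M F t T" "\<tau>s t \<in> stopping_times M F t T"
    by (rule stopping_times_AE_eq[OF \<kappa>0(1) t'(1) \<kappa>0(2)], rule stopping_times_AE_eq[OF \<kappa>1(1) t'(1) \<kappa>1(2)])
  ultimately show "\<sigma>s t \<in> stopping_times M F t T \<and> \<tau>s t \<in> stopping_times M F t T \<and>
    (AE \<omega> in M. ?V \<omega> = ?D (\<sigma>s t) (\<tau>s t) \<omega>) \<and>
    (\<forall>\<sigma>\<in>stopping_times M F t T. \<forall>\<tau>\<in>stopping_times M F t T.
       (AE \<omega> in M. ?D (\<sigma>s t) \<tau> \<omega> \<le> ?D (\<sigma>s t) (\<tau>s t) \<omega>) \<and>
       (AE \<omega> in M. ?D (\<sigma>s t) (\<tau>s t) \<omega> \<le> ?D \<sigma> (\<tau>s t) \<omega>))"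
    using eq by blast
qed

end
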